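(* Let $\Omega\subset E_3$ be a domain that is convex in the direction of the line $L$, and let $D:=f(\Omega)\subset\mathbb{C}$ and $\Pi:=\{\zeta\in E_3 : f(\zeta)\in D\}$. Let $\Phi:\Omega\to\mathbb{A}_3$ be a function that is continuous in $\Omega$ and satisfies condition $K'''_{\mathbb{A}_3,E_3}$ at every point $\zeta\in\Omega$ except for an at most countable set of points. Then: 1) the function $\Phi$ is monogenic in the domain $\Omega$; 2) the function $\Phi$ extends to a function that is monogenic in the domain $\Pi$; such a (monogenic) extension is unique, and it is given, for all $\zeta\in\Pi$, by $$\frac{1}{2\pi i}\int_{\gamma}\Big(F_0(\xi)+F_1(\xi)\,\rho+F_2(\xi)\,\rho^2\Big)(\xi-\zeta)^{-1}\,d\xi ,$$ where $F_0,F_1,F_2:D\to\mathbb{C}$ are some functions holomorphic in $D$ (not depending on $\zeta$), and $\gamma$ is any closed Jordan rectifiable curve, positively oriented, that lies in $D$ together with its interior and encloses the point $f(\zeta)$; 3) this monogenic extension of $\Phi$ to $\Pi$ is differentiable in the sense of Lorch in the domain $\Pi$.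
   Context: $\mathbb{A}_3$ is the three-dimensional commutative associative algebra with unit $1$ over $\mathbb{C}$ with basis $\{1,\rho,\rho^2\}$, where $\rho^3=0$. Its norm is $\|a+b\rho+c\rho^2\|:=\sqrt{|a|^2+|b|^2+|c|^2}$ for $a,b,c\in\mathbb{C}$. The radical (unique maximal ideal) is $\mathcal{I}=\{\lambda_1\rho+\lambda_2\rho^2:\lambda_1,\lambda_2\in\mathbb{C}\}$. The map $f:\mathbb{A}_3\to\mathbb{C}$, $f(a+b\rho+c\rho^2)=a$, is a continuous multiplicative linear functional with kernel $\mathcal{I}$; an element $\eta\in\mathbb{A}_3$ is invertible iff $f(\eta)\neq 0$. $E_3=\{xe_1+ye_2+ze_3: x,y,z\in\mathbb{R}\}\subset\mathbb{A}_3$ is a fixed real subspace, where $e_1,e_2,e_3\in\mathbb{A}_3$ are linearly independent over $\mathbb{R}$. It is assumed throughout that $f(E_3)=\mathbb{C}$. Then $E_3\cap\mathcal{I}$ is a real line $L=\{c\,l: c\in\mathbb{R}\}$, with $l\in E_3$ a fixed nonzero direction vector. A domain is a nonempty open connected set. A domain $\Omega\subset E_3$ is convex in the direction of $L$ if it contains every segment that joins two points of $\Omega$ and is parallel to $L$. Condition $K'''_{\mathbb{A}_3,E_3}$: a function $\Phi:\Omega\to\mathbb{A}_3$ satisfies this condition at a point $\zeta\in\Omega$ if there exist an element $\Phi_*(\zeta)\in\mathbb{A}_3$ and vectors $h_1,h_2\in E_3$ such that $h_1,h_2,l$ form a basis of the real space $E_3$ and $$\lim_{\varepsilon\to 0,\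 \varepsilon\in\mathbb{R}}\big(\Phi(\zeta+\varepsilon h)-\Phi(\zeta)\big)\varepsilon^{-1}=h\,\Phi_*(\zeta)$$ for each of the three vectors $h\in\{h_1,h_2,l\}$. The vectors $h_1,h_2$ may depend on $\zeta$. A function $\Phi:\Omega\to\mathbb{A}_3$ is monogenic in a domain $\Omega\subset E_3$ if it is continuous in $\Omega$ and has a Gateaux derivative at every point, i.e. for every $\zeta\in\Omega$ there is an element $\Phi_G'(\zeta)\in\mathbb{A}_3$ such that $$\lim_{\delta\to 0+0}\big(\Phi(\zeta+\delta h)-\Phi(\zeta)\big)\delta^{-1}=h\,\Phi_G'(\zeta)\quad\text{for all } h\in E_3.$$ A function $\Phi:\Omega\to\mathbb{A}_3$ is differentiable in the sense of Lorch in a domain $\Omega\subset E_3$ if for every $\zeta\in\Omega$ there is an element $\Phi_L'(\zeta)\in\mathbb{A}_3$ such that for every $\varepsilon>0$ there exists $\delta>0$ such that for all $h\in E_3$ with $\|h\|<\delta$ one has $\|\Phi(\zeta+h)-\Phi(\zeta)-h\,\Phi_L'(\zeta)\|\le\|h\|\,\varepsilon$. *)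

theory Defs
  imports "HOL-Complex_Analysis.Complex_Analysis"
begin

section \<open>The algebra with basis 1, rho, rho^2, where rho^3 = 0\<close>

text \<open>\<open>A3 a b c\<close> stands for \<open>a + b \<rho> + c \<rho>\<^sup>2\<close>; see \<open>A3_expansion\<close> below. The norm is not
  submultiplicative, so the type is a normed vector space and an algebra, but not an instance of
  \<^class>\<open>real_normed_algebra\<close>.\<close>

datatype a3 = A3 (coeff0: complex) (coeff1: complex) (coeff2: complex)

lemma a3_eq_iff:
  "x = y \<longleftrightarrow> coeff0 x = coeff0 y \<and> coeff1 x = coeff1 y \<and> coeff2 x = coeff2 y"
  by (cases x; cases y) simp

instantiation a3 :: comm_ring_1
begin

definition "0 = A3 0 0 0"
definition "1 = A3 1 0 0"
definition "x + y = A3 (coeff0 x + coeff0 y) (coeff1 x + coeff1 y) (coeff2 x + coeff2 y)"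
definition "x - y = A3 (coeff0 x - coeff0 y) (coeff1 x - coeff1 y) (coeff2 x - coeff2 y)"
definition "- x = A3 (- coeff0 x) (- coeff1 x) (- coeff2 x)"
definition "x * y = A3 (coeff0 x * coeff0 y)
                       (coeff0 x * coeff1 y + coeff1 x * coeff0 y)
                       (coeff0 x * coeff2 y + coeff1 x * coeff1 y + coeff2 x * coeff0 y)"

instance
  by standard
    (simp_all add: zero_a3_def one_a3_def plus_a3_def minus_a3_def uminus_a3_def times_a3_def
      algebra_simps)

end

instantiation a3 :: real_algebra_1
begin

definition "r *\<^sub>R x = A3 (r *\<^sub>R coeff0 x) (r *\<^sub>R coeff1 x) (r *\<^sub>R coeff2 x)"

instance
  by standard (simp_all add: scaleR_a3_def plus_a3_def times_a3_def algebra_simps)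

end

instantiation a3 :: real_normed_vector
begin

definition "norm x = sqrt ((cmod (coeff0 x))\<^sup>2 + (cmod (coeff1 x))\<^sup>2 + (cmod (coeff2 x))\<^sup>2)"
definition sgn_a3_def: "sgn (x::a3) = x /\<^sub>R norm x"
definition dist_a3_def: "dist (x::a3) y = norm (x - y)"
definition uniformity_a3_def [code del]:
  "(uniformity :: (a3 \<times> a3) filter) = (INF e\<in>{0 <..}. principal {(x, y). dist x y < e})"
definition open_a3_def [code del]:
  "open (U :: a3 set) \<longleftrightarrow> (\<forall>x\<in>U. eventually (\<lambda>(x', y). x' = x \<longrightarrow> y \<in> U) uniformity)"

instance
proof
  fix r :: real and x y :: a3 and S :: "a3 set"
  have norm_triple: "norm z = norm (coeff0 z, coeff1 z, coeff2 z)" for z :: a3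
    by (simp add: norm_a3_def norm_Pair)
  show "norm x = 0 \<longleftrightarrow> x = 0"
    by (simp add: norm_triple zero_a3_def a3_eq_iff zero_prod_def)
  show "norm (x + y) \<le> norm x + norm y"
    using norm_triangle_ineq[of "(coeff0 x, coeff1 x, coeff2 x)" "(coeff0 y, coeff1 y, coeff2 y)"]
    by (simp add: norm_triple plus_a3_def)
  show "norm (r *\<^sub>R x) = \<bar>r\<bar> * norm x"
    using norm_scaleR[of r "(coeff0 x, coeff1 x, coeff2 x)"]
    by (simp only: norm_triple scaleR_a3_def scaleR_Pair a3.sel)
qed (rule sgn_a3_def dist_a3_def open_a3_def uniformity_a3_def)+

end

instantiation a3 :: inverse
begin

definition "inverse x = (if x dvd 1 then THE y. x * y = 1 else (0::a3))"
definition "x div y = x * inverse (y::a3)"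

instance ..

end

definition rho :: a3 where
  "rho = A3 0 1 0"

definition of_cpx :: "complex \<Rightarrow> a3" where
  "of_cpx a = A3 a 0 0"

lemma rho_cubed: "rho ^ 3 = 0"
  by (simp add: rho_def numeral_3_eq_3 times_a3_def zero_a3_def one_a3_def)

lemma A3_expansion: "A3 a b c = of_cpx a + of_cpx b * rho + of_cpx c * rho\<^sup>2"
  by (simp add: rho_def of_cpx_def power2_eq_square times_a3_def plus_a3_def)

text \<open>The multiplicative functional \<open>f\<close> with kernel \<open>radical_a3\<close> is \<^const>\<open>coeff0\<close>.\<close>

definition radical_a3 :: "a3 set" where
  "radical_a3 = {of_cpx a * rho + of_cpx b * rho\<^sup>2 | a b. True}"

lemma radical_a3_eq_kernel: "radical_a3 = {x. coeff0 x = 0}"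
proof -
  have "x \<in> radical_a3 \<longleftrightarrow> (\<exists>a b. x = A3 0 a b)" for x
    by (simp add: radical_a3_def of_cpx_def rho_def power2_eq_square times_a3_def plus_a3_def)
  then show ?thesis
    by (auto simp: a3_eq_iff)
qed

lemma a3_dvd_1_iff: "x dvd (1::a3) \<longleftrightarrow> coeff0 x \<noteq> 0"
proof
  assume "x dvd 1"
  then obtain y where "1 = x * y" by (rule dvdE)
  then have "coeff0 x * coeff0 y = 1"
    by (simp add: times_a3_def one_a3_def)
  then show "coeff0 x \<noteq> 0" by auto
next
  assume nz: "coeff0 x \<noteq> 0"
  define p where "p = 1 / coeff0 x"
  define q where "q = - coeff1 x * p * p"
  define r where "r = - (coeff1 x * q + coeff2 x * p) * p"
  have "coeff0 x * p = 1"
    using nz by (simp add: p_def)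
  moreover have "coeff0 x * q + coeff1 x * p = 0"
    using nz by (simp add: p_def q_def field_simps)
  moreover have "coeff0 x * r + coeff1 x * q + coeff2 x * p = 0"
    using nz by (simp add: p_def r_def field_simps)
  ultimately have "1 = x * A3 p q r"
    by (simp add: times_a3_def one_a3_def)
  then show "x dvd 1" by (rule dvdI)
qed

lemma a3_inverse_right: "coeff0 x \<noteq> 0 \<Longrightarrow> x * inverse x = 1"
proof -
  assume "coeff0 x \<noteq> 0"
  then have dvd: "x dvd 1" by (simp add: a3_dvd_1_iff)
  then obtain y where y: "x * y = 1" by (metis dvdE)
  have "z = y" if "x * z = 1" for z
    by (metis that y mult.assoc mult.commute mult.right_neutral)
  with y have "(THE y. x * y = 1) = y" by (intro the_equality)
  with y dvd show ?thesis by (simp add: inverse_a3_def)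
qed


section \<open>Domains and differentiability in a real subspace\<close>

text \<open>Below, \<open>E\<close> is the real subspace in which the functions are defined. Functions on a subset
  of \<open>E\<close> are total functions of which only the values on that subset matter: the domains in
  question are open in \<open>E\<close>, and the limits below are taken inside \<open>E\<close>.\<close>

definition domain_in :: "a3 set \<Rightarrow> a3 set \<Rightarrow> bool" where
  "domain_in E \<Omega> \<longleftrightarrow> \<Omega> \<noteq> {} \<and> openin (top_of_set E) \<Omega> \<and> connected \<Omega>"

definition convex_in_direction :: "a3 set \<Rightarrow> a3 set \<Rightarrow> bool" where
  "convex_in_direction L \<Omega> \<longleftrightarrow>
     (\<forall>\<zeta>1\<in>\<Omega>. \<forall>\<zeta>2\<in>\<Omega>. \<zeta>2 - \<zeta>1 \<in> L \<longrightarrow> closed_segment \<zeta>1 \<zeta>2 \<subseteq> \<Omega>)"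

definition condition_K :: "a3 set \<Rightarrow> a3 \<Rightarrow> (a3 \<Rightarrow> a3) \<Rightarrow> a3 \<Rightarrow> bool" where
  "condition_K E l \<Phi> \<zeta> \<longleftrightarrow>
     (\<exists>\<Phi>s h1 h2. h1 \<in> E \<and> h2 \<in> E \<and>
        distinct [h1, h2, l] \<and> independent {h1, h2, l} \<and> span {h1, h2, l} = E \<and>
        (\<forall>h\<in>{h1, h2, l}.
           ((\<lambda>\<epsilon>::real. (\<Phi> (\<zeta> + \<epsilon> *\<^sub>R h) - \<Phi> \<zeta>) /\<^sub>R \<epsilon>) \<longlongrightarrow> h * \<Phi>s) (at 0)))"

definition monogenic_in :: "a3 set \<Rightarrow> a3 set \<Rightarrow> (a3 \<Rightarrow> a3) \<Rightarrow> bool" where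
  "monogenic_in E \<Omega> \<Phi> \<longleftrightarrow>
     continuous_on \<Omega> \<Phi> \<and>
     (\<forall>\<zeta>\<in>\<Omega>. \<exists>\<Phi>'. \<forall>h\<in>E.
        ((\<lambda>\<delta>::real. (\<Phi> (\<zeta> + \<delta> *\<^sub>R h) - \<Phi> \<zeta>) /\<^sub>R \<delta>) \<longlongrightarrow> h * \<Phi>') (at_right 0))"

definition lorch_differentiable_in :: "a3 set \<Rightarrow> a3 set \<Rightarrow> (a3 \<Rightarrow> a3) \<Rightarrow> bool" where
  "lorch_differentiable_in E \<Omega> \<Phi> \<longleftrightarrow>
     (\<forall>\<zeta>\<in>\<Omega>. \<exists>\<Phi>'. \<forall>\<epsilon>>0. \<exists>\<delta>>0. \<forall>h\<in>E. norm h < \<delta> \<longrightarrow>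
        \<zeta> + h \<in> \<Omega> \<and> norm (\<Phi> (\<zeta> + h) - \<Phi> \<zeta> - h * \<Phi>') \<le> norm h * \<epsilon>)"


section \<open>Integrals along rectifiable Jordan curves\<close>

definition rectifiable_path :: "(real \<Rightarrow> complex) \<Rightarrow> bool" where
  "rectifiable_path \<gamma> \<longleftrightarrow>
     path \<gamma> \<and> (\<exists>B. \<forall>d. d division_of {0..1} \<longrightarrow> (\<Sum>K\<in>d. cmod (\<gamma> (Sup K) - \<gamma> (Inf K))) \<le> B)"

text \<open>The library's \<^const>\<open>has_contour_integral\<close> integrates against the derivative of the
  path, which is wrong for rectifiable paths that are not absolutely continuous. Hence the integral
  is defined as a limit of Riemann--Stieltjes sums as the mesh tends to \<open>0\<close>.\<close>

definition has_line_integral :: "(complex \<Rightarrow> a3) \<Rightarrow> a3 \<Rightarrow> (real \<Rightarrow> complex) \<Rightarrow> bool" where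
  "has_line_integral g I \<gamma> \<longleftrightarrow>
     (\<forall>\<epsilon>>0. \<exists>\<delta>>0. \<forall>p. p tagged_division_of {0..1} \<and> (\<forall>(t, K)\<in>p. Sup K - Inf K < \<delta>) \<longrightarrow>
        norm ((\<Sum>(t, K)\<in>p. g (\<gamma> t) * of_cpx (\<gamma> (Sup K) - \<gamma> (Inf K))) - I) < \<epsilon>)"

text \<open>For a simple closed path the winding number about each interior point is \<open>1\<close> or \<open>-1\<close>
  (\<open>simple_closed_path_winding_number_inside\<close>); positive orientation means \<open>1\<close>.\<close>

definition pos_jordan_rectifiable :: "(real \<Rightarrow> complex) \<Rightarrow> bool" where
  "pos_jordan_rectifiable \<gamma> \<longleftrightarrow>
     simple_path \<gamma> \<and> pathfinish \<gamma> = pathstart \<gamma> \<and> rectifiable_path \<gamma> \<and>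
     (\<forall>z\<in>inside (path_image \<gamma>). winding_number \<gamma> z = 1)"

end

theory Submission
  imports Defs
begin

text \<open>
  Subtracting lifted holomorphic functions of one complex variable peels off the components of
  \<open>\<Phi>\<close> one at a time. A holomorphic \<open>F\<close> lifts to the algebra by its Taylor formula,
  \<open>F(z) + F'(z) (a \<rho> + b \<rho>\<^sup>2) + F''(z)/2 (a \<rho> + b \<rho>\<^sup>2)\<^sup>2\<close> at \<open>\<zeta> = z + a \<rho> + b \<rho>\<^sup>2\<close>, and the lift
  is differentiable with a derivative of the form \<open>h \<mapsto> h * c\<close>
  (\<open>principal_extension_has_derivative\<close>). Let \<open>U\<close> be the first nonzero component of \<open>\<Phi>\<close>. At a good
  point its derivative along \<open>h\<close> is \<open>f(h) c\<close> for \<open>h\<close> among \<open>h\<^sub>1\<close>, \<open>h\<^sub>2\<close>, \<open>l\<close>, because the lower components of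
  \<open>\<Phi>\<^sub>*\<close> vanish (\<open>condition_K_leading\<close>). As \<open>f(l) = 0\<close>, the derivative of \<open>U\<close> along \<open>L\<close> vanishes off
  a countable set, so \<open>U\<close> is constant on the fibres of \<open>f\<close>, which are segments, and \<open>U = F \<circ> f\<close> with
  \<open>F\<close> continuous on \<open>D\<close>. Every fibre is uncountable, hence contains a good point; so at \<^emph>\<open>every\<close> point
  of \<open>D\<close> the function \<open>F\<close> has derivatives along two independent lines, which are given by one
  complex number. By a theorem of Menchoff (\<open>directional_derivatives_imp_holomorphic\<close>) \<open>F\<close> is
  holomorphic. Three rounds, for the coefficients of \<open>1\<close>, \<open>\<rho>\<close> and \<open>\<rho>\<^sup>2\<close>, give
  \<open>\<Phi> = F\<^sub>0 + \<rho> F\<^sub>1 + \<rho>\<^sup>2 F\<^sub>2\<close> in terms of the lifts (\<open>monogenic_extension_exists\<close>).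
  The right-hand side makes sense on \<open>\<Pi>\<close>. This yields monogeneity, the extension and its Lorch
  differentiability. Uniqueness follows from the same representation for any other extension, since
  \<open>F\<^sub>0\<close>, \<open>F\<^sub>1\<close>, \<open>F\<^sub>2\<close> can be read off from the values on \<open>\<Omega>\<close>. The integral formula is
  Cauchy's formula in the three coefficients.

  Menchoff's theorem is proved as follows. Let \<open>P\<close> be the closed set of points near which \<open>F\<close> is not
  holomorphic. If two points both have good lines, two of these lines cross transversally and not far
  away; so the difference of the values of \<open>F\<close> at the two points is controlled
  (\<open>linear_on_lines_imp_linear\<close>). By the Baire category theorem \<open>F\<close> is therefore Lipschitz on a
  portion of \<open>P\<close>, and the maximum principle in the half discs cut out by a good line transports the Lipschitz
  estimate to all nearby points (\<open>lipschitz_at_point_via_half_discs\<close>). Hence the integral of \<open>F\<close>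
  around a triangle of a given shape that meets \<open>P\<close> is at most a constant times its area. Moreover \<open>F\<close> is nearly linear
  on a small triangle unless the triangle has a hole in the set of points where a fixed quality
  of approximation is reached, and such holes have small total area. A bisection as in Goursat's
  proof then shows that all these integrals vanish (\<open>holomorphic_if_lipschitz_and_directional\<close>).

  For a rectifiable curve the Riemann--Stieltjes integral of a holomorphic function equals the contour
  integral along every smooth curve with the same end points that is close enough
  (\<open>stieltjes_integral_eq_contour_integral_nearby\<close>); so the residue theorem applies.
\<close>

section \<open>Functions that are nearly linear along two lines\<close>

text \<open>The parameter \<open>\<kappa>\<close> bounds the angle of the two lines from below. The slope \<open>c\<close> is fixed for the
  whole set: only then can two of its points be compared.\<close>

definition linear_on_lines ::
    "(complex \<Rightarrow> complex) \<Rightarrow> real \<Rightarrow> real \<Rightarrow> real \<Rightarrow> complex \<Rightarrow> complex set" where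
  "linear_on_lines F \<kappa> \<delta> \<epsilon> c =
     {z. \<exists>u v. cmod u = 1 \<and> cmod v = 1 \<and> \<kappa> \<le> \<bar>Im (cnj u * v)\<bar> \<and>
        (\<forall>t. \<bar>t\<bar> \<le> \<delta> \<longrightarrow>
           cmod (F (z + of_real t * u) - F z - c * (of_real t * u)) \<le> \<epsilon> * \<bar>t\<bar> \<and>
           cmod (F (z + of_real t * v) - F z - c * (of_real t * v)) \<le> \<epsilon> * \<bar>t\<bar>)}"

text \<open>The directions of the lines range over a compact set, so the existential quantifier over
  them is a projection along a compact space, which preserves closedness. This is what makes the
  Baire category theorem and the measure estimates below applicable.\<close>

lemma closed_linear_on_lines:
  assumes "continuous_on UNIV F"
  shows "closed (linear_on_lines F \<kappa> \<delta> \<epsilon> c)"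
proof -
  have contF: "continuous_on UNIV (\<lambda>x. F (g x))" if "continuous_on UNIV g"
    for g :: "(complex \<times> complex) \<times> complex \<Rightarrow> complex"
    using continuous_on_compose2[OF assms that] by auto
  define K where "K = sphere (0::complex) 1 \<times> sphere (0::complex) 1"
  define X where "X = {q :: (complex \<times> complex) \<times> complex.
      \<kappa> \<le> \<bar>Im (cnj (fst (fst q)) * snd (fst q))\<bar> \<and>
        (\<forall>t. \<bar>t\<bar> \<le> \<delta> \<longrightarrow>
           cmod (F (snd q + of_real t * fst (fst q)) - F (snd q) - c * (of_real t * fst (fst q))) \<le> \<epsilon> * \<bar>t\<bar> \<and>
           cmod (F (snd q + of_real t * snd (fst q)) - F (snd q) - c * (of_real t * snd (fst q))) \<le> \<epsilon> * \<bar>t\<bar>)}"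
  have "closed X"
    unfolding X_def
    by (intro closed_Collect_conj closed_Collect_all closed_Collect_imp closed_Collect_le
        open_Collect_const continuous_intros contF)
  moreover have "compact K"
    unfolding K_def by (intro compact_Times compact_sphere)
  moreover have "linear_on_lines F \<kappa> \<delta> \<epsilon> c = {z. \<exists>uv. uv \<in> K \<and> (uv, z) \<in> X}"
    by (auto simp: linear_on_lines_def K_def X_def)
  ultimately show ?thesis
    using closed_compact_projection[of K X] by (simp only:)
qed

text \<open>The directions of the lines vary from point to point in an uncontrolled way. It suffices
  that a line through one point can be parallel to at most one of the two lines through the other.\<close>

lemma unit_transversal:
  assumes "cmod u = 1" "cmod a = 1" "cmod b = 1" and "\<kappa> \<le> \<bar>Im (cnj a * b)\<bar>"
  shows "\<kappa> / 2 \<le> \<bar>Im (cnj u * a)\<bar> \<or> \<kappa> / 2 \<le> \<bar>Im (cnj u * b)\<bar>"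
proof (rule ccontr)
  define x y where "x = cnj u * a" and "y = cnj u * b"
  assume "\<not> ?thesis"
  then have small: "\<bar>Im x\<bar> < \<kappa> / 2" "\<bar>Im y\<bar> < \<kappa> / 2"
    by (auto simp: x_def y_def)
  have "cmod x = 1" "cmod y = 1"
    using assms by (simp_all add: x_def y_def norm_mult)
  then have re: "\<bar>Re x\<bar> \<le> 1" "\<bar>Re y\<bar> \<le> 1"
    using abs_Re_le_cmod by metis+
  have "u * cnj u = 1"
    using assms(1) by (simp add: complex_norm_square[symmetric])
  then have "cnj a * b = cnj x * y"
    by (simp add: x_def y_def algebra_simps)
  then have "\<bar>Im (cnj a * b)\<bar> = \<bar>Re x * Im y - Im x * Re y\<bar>"
    by simp
  also have "\<dots> \<le> \<bar>Re x\<bar> * \<bar>Im y\<bar> + \<bar>Im x\<bar> * \<bar>Re y\<bar>"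
    by (metis abs_mult abs_triangle_ineq4)
  also have "\<dots> \<le> 1 * \<bar>Im y\<bar> + \<bar>Im x\<bar> * 1"
    by (intro add_mono mult_mono re) auto
  finally show False
    using small assms(4) by linarith
qed

lemma lines_meet:
  assumes "cmod u = 1" "cmod v = 1" "\<kappa> \<le> \<bar>Im (cnj u * v)\<bar>" "\<kappa> > 0"
  obtains s t :: real where "of_real s * u - of_real t * v = d"
    "\<bar>s\<bar> \<le> cmod d / \<kappa>" "\<bar>t\<bar> \<le> cmod d / \<kappa>"
proof -
  define m where "m = Im (cnj u * v)"
  have m: "m \<noteq> 0" "\<kappa> \<le> \<bar>m\<bar>"
    using assms by (auto simp: m_def)
  define A B where "A = Im (cnj d * v)" and "B = Im (cnj u * d)"
  define s t where "s = A / m" and "t = - B / m"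
  have "m * Re d = A * Re u + B * Re v" "m * Im d = A * Im u + B * Im v"
    by (simp_all add: m_def A_def B_def algebra_simps)
  then have "Re d = (A * Re u + B * Re v) / m" "Im d = (A * Im u + B * Im v) / m"
    using m(1) by (metis nonzero_mult_div_cancel_left)+
  then have "of_real s * u - of_real t * v = d"
    by (intro complex_eqI) (simp_all add: s_def t_def add_divide_distrib)
  moreover have "\<bar>s\<bar> \<le> cmod d / \<kappa>"
  proof -
    have "\<bar>Im (cnj d * v)\<bar> \<le> cmod d"
      using abs_Im_le_cmod[of "cnj d * v"] assms(2) by (simp add: norm_mult)
    then show ?thesis
      unfolding s_def A_def abs_divide using m assms(4) by (intro frac_le) auto
  qed
  moreover have "\<bar>t\<bar> \<le> cmod d / \<kappa>"
  proof -
    have "\<bar>Im (cnj u * d)\<bar> \<le> cmod d"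
      using abs_Im_le_cmod[of "cnj u * d"] assms(1) by (simp add: norm_mult)
    then show ?thesis
      unfolding t_def B_def abs_divide abs_minus_cancel using m assms(4) by (intro frac_le) auto
  qed
  ultimately show ?thesis using that by blast
qed

text \<open>One goes from \<open>z\<close> to \<open>w\<close> along a line through \<open>z\<close> as far as its intersection with a
  transversal line through \<open>w\<close>; the lengths of both pieces are comparable to the distance of the points.\<close>

lemma linear_on_lines_imp_linear:
  assumes z: "z \<in> linear_on_lines F \<kappa> \<delta> \<epsilon> c" and w: "w \<in> linear_on_lines F \<kappa> \<delta> \<epsilon> c"
    and "\<kappa> > 0" "\<epsilon> \<ge> 0" and dist: "cmod (w - z) \<le> \<kappa> * \<delta> / 2"
  shows "cmod (F w - F z - c * (w - z)) \<le> 4 * \<epsilon> / \<kappa> * cmod (w - z)"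
proof -
  obtain u where u: "cmod u = 1"
    and Fu: "\<And>t. \<bar>t\<bar> \<le> \<delta> \<Longrightarrow> cmod (F (z + of_real t * u) - F z - c * (of_real t * u)) \<le> \<epsilon> * \<bar>t\<bar>"
    using z unfolding linear_on_lines_def by blast
  obtain a b where ab: "cmod a = 1" "cmod b = 1" "\<kappa> \<le> \<bar>Im (cnj a * b)\<bar>"
    and Fab: "\<And>t. \<bar>t\<bar> \<le> \<delta> \<Longrightarrow> cmod (F (w + of_real t * a) - F w - c * (of_real t * a)) \<le> \<epsilon> * \<bar>t\<bar> \<and>
      cmod (F (w + of_real t * b) - F w - c * (of_real t * b)) \<le> \<epsilon> * \<bar>t\<bar>"
    using w unfolding linear_on_lines_def by blast
  obtain v where v: "cmod v = 1" "\<kappa> / 2 \<le> \<bar>Im (cnj u * v)\<bar>"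
    and Fv: "\<And>t. \<bar>t\<bar> \<le> \<delta> \<Longrightarrow> cmod (F (w + of_real t * v) - F w - c * (of_real t * v)) \<le> \<epsilon> * \<bar>t\<bar>"
    using unit_transversal[OF u ab] ab Fab by blast
  define d where "d = w - z"
  obtain s t :: real where st: "of_real s * u - of_real t * v = d"
    and bnd: "\<bar>s\<bar> \<le> cmod d / (\<kappa> / 2)" "\<bar>t\<bar> \<le> cmod d / (\<kappa> / 2)"
    using lines_meet[OF u v(1,2)] \<open>\<kappa> > 0\<close> by (metis half_gt_zero)
  have "cmod d / (\<kappa> / 2) \<le> \<delta>"
    using dist \<open>\<kappa> > 0\<close> by (simp add: d_def field_simps)
  with bnd have small: "\<bar>s\<bar> \<le> \<delta>" "\<bar>t\<bar> \<le> \<delta>"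
    by auto
  have meet: "z + of_real s * u = w + of_real t * v"
    using st by (simp add: d_def algebra_simps)
  have "F w - F z - c * (w - z) = (F (z + of_real s * u) - F z - c * (of_real s * u))
      - (F (w + of_real t * v) - F w - c * (of_real t * v))"
    unfolding meet d_def[symmetric] st[symmetric] by (simp add: algebra_simps)
  also have "cmod \<dots> \<le> \<epsilon> * \<bar>s\<bar> + \<epsilon> * \<bar>t\<bar>"
    by (rule order_trans[OF norm_triangle_ineq4 add_mono[OF Fu[OF small(1)] Fv[OF small(2)]]])
  also have "\<dots> \<le> \<epsilon> * (cmod d / (\<kappa> / 2)) + \<epsilon> * (cmod d / (\<kappa> / 2))"
    using bnd \<open>\<epsilon> \<ge> 0\<close> by (intro add_mono mult_left_mono)
  also have "\<dots> = 4 * \<epsilon> / \<kappa> * cmod (w - z)"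
    by (simp add: d_def)
  finally show ?thesis .
qed

lemma directional_derivative_unit:
  fixes F :: "complex \<Rightarrow> complex"
  assumes "((\<lambda>t::real. (F (z + t *\<^sub>R h) - F z) /\<^sub>R t) \<longlongrightarrow> h * c) (at 0)" and "h \<noteq> 0" "\<epsilon> > 0"
  obtains \<delta> where "\<delta> > 0"
    "\<And>t. \<bar>t\<bar> \<le> \<delta> \<Longrightarrow>
       cmod (F (z + of_real t * sgn h) - F z - c * (of_real t * sgn h)) \<le> \<epsilon> * \<bar>t\<bar>"
proof -
  have "\<epsilon> * cmod h > 0" using assms by simp
  then obtain d where "d > 0" and d: "\<And>t. \<lbrakk>t \<noteq> 0; \<bar>t\<bar> < d\<rbrakk> \<Longrightarrow>
      cmod ((F (z + t *\<^sub>R h) - F z) /\<^sub>R t - h * c) < \<epsilon> * cmod h"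
    using assms(1) unfolding LIM_def dist_norm by (metis diff_zero real_norm_def)
  define \<delta> where "\<delta> = d * cmod h / 2"
  show ?thesis
  proof
    show "\<delta> > 0" using \<open>d > 0\<close> assms by (simp add: \<delta>_def)
    fix t :: real assume t: "\<bar>t\<bar> \<le> \<delta>"
    show "cmod (F (z + of_real t * sgn h) - F z - c * (of_real t * sgn h)) \<le> \<epsilon> * \<bar>t\<bar>"
    proof (cases "t = 0")
      case False
      define s where "s = t / cmod h"
      have s: "s \<noteq> 0" "\<bar>s\<bar> < d"
        using False t assms \<open>d > 0\<close> by (auto simp: s_def \<delta>_def field_simps)
      have sh: "s *\<^sub>R h = of_real t * sgn h"
        by (simp add: s_def sgn_eq scaleR_conv_of_real)
      have "(F (z + s *\<^sub>R h) - F z) - c * (s *\<^sub>R h) = s *\<^sub>R ((F (z + s *\<^sub>R h) - F z) /\<^sub>R s - h * c)"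
        using s by (simp add: scaleR_diff_right mult.commute)
      then have "cmod ((F (z + s *\<^sub>R h) - F z) - c * (s *\<^sub>R h)) \<le> \<bar>s\<bar> * (\<epsilon> * cmod h)"
        using d[OF s] by (simp add: mult_left_mono)
      then show ?thesis
        unfolding sh using assms(2) by (simp add: s_def mult.commute)
    qed simp
  qed
qed

section \<open>The Lipschitz estimate off the exceptional set\<close>

text \<open>The quotient \<open>(F x - F w) / (x - w)\<close> is bounded by \<open>K\<close> on the frontier of each half disc
  minus \<open>P\<close>, except at \<open>w\<close>, where it need not be continuous. Moving the pole a little to the other side
  of the line makes the quotient continuous up to \<open>w\<close> and only decreases it in absolute value. So the
  maximum principle applies.\<close>

lemma lipschitz_at_point_via_half_discs:
  assumes contF: "continuous_on UNIV F" and holF: "F holomorphic_on (ball w r - P)"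
    and opn: "open (ball w r - P)" and "r > 0" and u: "cmod u = 1" and "K \<ge> 0"
    and line: "\<And>t. \<bar>t\<bar> \<le> r \<Longrightarrow> cmod (F (w + of_real t * u) - F w) \<le> K * \<bar>t\<bar>"
    and onP: "\<And>x. \<lbrakk>x \<in> P; x \<in> ball w r\<rbrakk> \<Longrightarrow> cmod (F x - F w) \<le> K * cmod (x - w)"
    and circ: "\<And>x. cmod (x - w) = r \<Longrightarrow> cmod (F x - F w) \<le> K * r"
    and x: "x \<in> ball w r"
  shows "cmod (F x - F w) \<le> K * cmod (x - w)"
proof -
  have on_line: "cmod (F y - F w) \<le> K * cmod (y - w)"
    if n: "n = \<i> * u \<or> n = - (\<i> * u)" and re: "Re (cnj n * (y - w)) = 0" and y: "cmod (y - w) \<le> r" for n y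
  proof -
    define t where "t = Re (cnj u * (y - w))"
    have "cnj u * (y - w) = of_real t"
      using n re by (auto simp: complex_eq_iff t_def algebra_simps)
    moreover have "u * cnj u = 1"
      using u by (simp add: complex_norm_square[symmetric])
    ultimately have yw: "y - w = of_real t * u"
      by (metis mult.assoc mult.commute mult.right_neutral)
    then have "cmod (y - w) = \<bar>t\<bar>" using u by (simp add: norm_mult)
    moreover have "y = w + of_real t * u" using yw by (simp add: algebra_simps)
    ultimately show ?thesis using line[of t] y by simp
  qed
  have half: "cmod (F x - F w) \<le> K * cmod (x - w)"
    if n: "n = \<i> * u \<or> n = - (\<i> * u)" and pos: "Re (cnj n * (x - w)) > 0" and "x \<notin> P" for n
  proof -
    have n1: "cmod n = 1" "cnj n * n = 1"
      using n u by (auto simp: norm_mult complex_norm_square[symmetric] mult.commute)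
    define S where "S = {y. Re (cnj n * (y - w)) > 0} \<inter> (ball w r - P)"
    have "open S"
      unfolding S_def by (intro open_Int opn open_Collect_less continuous_intros)
    have cl: "closure S \<subseteq> {y. Re (cnj n * (y - w)) \<ge> 0} \<inter> cball w r"
    proof (rule closure_minimal)
      show "closed ({y. Re (cnj n * (y - w)) \<ge> 0} \<inter> cball w r)"
        by (intro closed_Int closed_cball closed_Collect_le continuous_intros)
    qed (auto simp: S_def)
    have front: "cmod (F y - F w) \<le> K * cmod (y - w)" if y: "y \<in> frontier S" for y
    proof -
      have y': "y \<in> closure S" "y \<notin> S"
        using y \<open>open S\<close> by (auto simp: frontier_def interior_open)
      then have y'': "Re (cnj n * (y - w)) \<ge> 0" "cmod (y - w) \<le> r"
        using cl by (auto simp: dist_norm norm_minus_commute)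
      consider "Re (cnj n * (y - w)) = 0" | "cmod (y - w) = r" | "y \<in> P" "y \<in> ball w r"
        using y' y'' by (fastforce simp: S_def dist_norm norm_minus_commute)
      then show ?thesis
        by cases (use on_line[OF n] circ onP y'' in auto)
    qed
    have eps: "cmod (F x - F w) \<le> K * cmod (x - w + of_real e * n)" if "e > 0" for e :: real
    proof -
      \<comment> \<open>The normal \<open>n\<close> points into the half disc, so the pole \<open>w - e n\<close> lies outside.\<close>
      define g where "g = (\<lambda>y. (F y - F w) / (y - w + of_real e * n))"
      have shift: "cmod (y - w) \<le> cmod (y - w + of_real e * n)" "y - w + of_real e * n \<noteq> 0"
        if "Re (cnj n * (y - w)) \<ge> 0" for y
      proof -
        have "cnj n * (y - w + of_real e * n) = cnj n * (y - w) + of_real e"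
          using n1(2) by (simp add: ring_distribs mult.left_commute)
        then have re: "Re (cnj n * (y - w + of_real e * n)) = Re (cnj n * (y - w)) + e"
          by (simp only: plus_complex.sel Re_complex_of_real)
        show "y - w + of_real e * n \<noteq> 0"
        proof
          assume "y - w + of_real e * n = 0"
          then show False
            using re that \<open>e > 0\<close> by (simp only: mult_zero_right zero_complex.sel)
        qed
        have "(cmod (y - w + of_real e * n))\<^sup>2 = (cmod (y - w))\<^sup>2 + 2 * e * Re (cnj n * (y - w)) + e\<^sup>2 * (cmod n)\<^sup>2"
          unfolding cmod_power2 by (simp add: power2_eq_square algebra_simps)
        also have "\<dots> \<ge> (cmod (y - w))\<^sup>2"
          using that \<open>e > 0\<close> by simp
        finally show "cmod (y - w) \<le> cmod (y - w + of_real e * n)"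
          by (rule power2_le_imp_le) simp
      qed
      have "cmod (g x) \<le> K"
      proof (rule maximum_modulus_frontier[of g S K x])
        have "F holomorphic_on S"
          by (rule holomorphic_on_subset[OF holF]) (auto simp: S_def)
        moreover have "y - w + of_real e * n \<noteq> 0" if "y \<in> closure S" for y
          using that cl shift(2) by auto
        moreover have "continuous_on (closure S) F"
          using contF continuous_on_subset by blast
        ultimately show "g holomorphic_on interior S" "continuous_on (closure S) g"
          unfolding g_def interior_open[OF \<open>open S\<close>] using closure_subset[of S]
          by (auto intro!: holomorphic_intros continuous_intros)
        show "bounded S"
          using bounded_subset[OF bounded_ball] by (auto simp: S_def)
        show "x \<in> S"
          using pos x \<open>x \<notin> P\<close> by (simp add: S_def)
        fix y assume y: "y \<in> frontier S"
        then have re: "Re (cnj n * (y - w)) \<ge> 0"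
          using cl by (auto simp: frontier_def)
        have "cmod (F y - F w) \<le> K * cmod (y - w + of_real e * n)"
          using front[OF y] shift(1)[OF re] \<open>K \<ge> 0\<close> by (meson mult_left_mono order_trans)
        then show "cmod (g y) \<le> K"
          using shift(2)[OF re] by (simp add: g_def norm_divide divide_le_eq)
      qed
      then show ?thesis
        using shift(2)[of x] pos by (simp add: g_def norm_divide divide_le_eq)
    qed
    have lim: "((\<lambda>e. K * cmod (x - w + of_real e * n)) \<longlongrightarrow> K * cmod (x - w + of_real 0 * n)) (at_right 0)"
      by (intro tendsto_intros)
    have "\<forall>\<^sub>F e in at_right 0. cmod (F x - F w) \<le> K * cmod (x - w + of_real e * n)"
      using eventually_at_right_less[of "0::real"] by (rule eventually_mono) (rule eps)
    from tendsto_lowerbound[OF lim this] show ?thesis by simp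
  qed
  show ?thesis
  proof (cases "x \<in> P")
    case True then show ?thesis using onP x by blast
  next
    case False
    have "Re (cnj (- (\<i> * u)) * (x - w)) = - Re (cnj (\<i> * u) * (x - w))"
      by simp
    then consider "Re (cnj (\<i> * u) * (x - w)) = 0" | "Re (cnj (\<i> * u) * (x - w)) > 0"
      | "Re (cnj (- (\<i> * u)) * (x - w)) > 0"
      by linarith
    then show ?thesis
    proof cases
      case 1
      then show ?thesis
        using on_line[of "\<i> * u" x] x by (simp add: dist_norm norm_minus_commute)
    next
      case 2 then show ?thesis using half[of "\<i> * u"] False by blast
    next
      case 3 then show ?thesis using half[of "- (\<i> * u)"] False by blast
    qed
  qed
qed

section \<open>Bisection of triangles\<close>

definition triangle_integral ::
    "(complex \<Rightarrow> complex) \<Rightarrow> complex \<Rightarrow> complex \<Rightarrow> complex \<Rightarrow> complex" where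
  "triangle_integral f a b c = contour_integral (linepath a b) f +
     contour_integral (linepath b c) f + contour_integral (linepath c a) f"

lemma triangle_integral_quadrisection:
  assumes f: "continuous_on (convex hull {a, b, c}) f"
  shows "triangle_integral f a b c =
    triangle_integral f a (midpoint a b) (midpoint a c) +
    triangle_integral f (midpoint a b) b (midpoint b c) +
    triangle_integral f (midpoint a c) (midpoint b c) c +
    triangle_integral f (midpoint b c) (midpoint a c) (midpoint a b)"
proof -
  define a' b' c' where "a' = midpoint b c" and "b' = midpoint a c" and "c' = midpoint a b"
  have b'_alt: "b' = midpoint c a" by (simp add: b'_def midpoint_sym)
  have fabc: "continuous_on (closed_segment a b) f" "continuous_on (closed_segment b c) f"
      "continuous_on (closed_segment c a) f"
    using f continuous_on_subset segments_subset_convex_hull by metis+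
  have fcont': "continuous_on (closed_segment c' b') f"
               "continuous_on (closed_segment a' c') f"
               "continuous_on (closed_segment b' a') f"
    unfolding a'_def b'_alt c'_def
    by (rule continuous_on_subset [OF f],
        metis midpoints_in_convex_hull convex_hull_subset hull_subset insert_subset segment_convex_hull)+
  note rev = fcont'[THEN contour_integral_reverse_linepath]
  have "contour_integral (linepath a b) f = contour_integral (linepath a c') f + contour_integral (linepath c' b) f"
    "contour_integral (linepath b c) f = contour_integral (linepath b a') f + contour_integral (linepath a' c) f"
    "contour_integral (linepath c a) f = contour_integral (linepath c b') f + contour_integral (linepath b' a) f"
    unfolding a'_def b'_alt c'_def using fabc by (simp_all add: contour_integral_midpoint)
  then show ?thesis
    unfolding triangle_integral_def a'_def[symmetric] b'_def[symmetric] c'_def[symmetric]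
    using rev by simp
qed

lemma convex_hull_homothety:
  fixes p :: "'a::real_vector"
  shows "(\<lambda>x. p + s *\<^sub>R x) ` (convex hull {a, b, c}) = convex hull {p + s *\<^sub>R a, p + s *\<^sub>R b, p + s *\<^sub>R c}"
  using convex_hull_affinity[of p s "{a,b,c}"] by simp

lemma triangle_subset_quarters:
  fixes a b c :: "'a::real_vector"
  defines "T \<equiv> convex hull {a, b, c}"
  shows "(\<lambda>x. p + s *\<^sub>R x) ` T \<subseteq>
    (\<lambda>x. (p + (s / 2) *\<^sub>R a) + (s / 2) *\<^sub>R x) ` T \<union>
    (\<lambda>x. (p + (s / 2) *\<^sub>R b) + (s / 2) *\<^sub>R x) ` T \<union>
    (\<lambda>x. (p + (s / 2) *\<^sub>R c) + (s / 2) *\<^sub>R x) ` T \<union>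
    (\<lambda>x. (p + (s / 2) *\<^sub>R (a + b + c)) + (- s / 2) *\<^sub>R x) ` T" (is "_ \<subseteq> ?A \<union> ?B \<union> ?C \<union> ?D")
proof safe
  fix x assume "x \<in> T"
  then obtain \<alpha> \<beta> \<gamma> where coeffs: "\<alpha> \<ge> 0" "\<beta> \<ge> 0" "\<gamma> \<ge> 0" "\<alpha> + \<beta> + \<gamma> = 1"
      and x: "x = \<alpha> *\<^sub>R a + \<beta> *\<^sub>R b + \<gamma> *\<^sub>R c"
    unfolding T_def convex_hull_3 by blast
  have inT: "\<alpha>' *\<^sub>R a + \<beta>' *\<^sub>R b + \<gamma>' *\<^sub>R c \<in> T"
    if "\<alpha>' \<ge> 0" "\<beta>' \<ge> 0" "\<gamma>' \<ge> 0" "\<alpha>' + \<beta>' + \<gamma>' = 1" for \<alpha>' \<beta>' \<gamma>'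
    unfolding T_def convex_hull_3 using that by blast
  assume notD: "p + s *\<^sub>R x \<notin> ?D" and notC: "p + s *\<^sub>R x \<notin> ?C" and notB: "p + s *\<^sub>R x \<notin> ?B"
  consider "\<alpha> \<ge> 1/2" | "\<beta> \<ge> 1/2" | "\<gamma> \<ge> 1/2" | "\<alpha> \<le> 1/2" "\<beta> \<le> 1/2" "\<gamma> \<le> 1/2"
    by linarith
  then show "p + s *\<^sub>R x \<in> ?A"
  proof cases
    case 1
    have "2 *\<^sub>R x - a \<in> T"
      using inT[of "2 * \<alpha> - 1" "2 * \<beta>" "2 * \<gamma>"] coeffs 1 by (simp add: x scaleR_add_right scaleR_diff_left add_diff_eq diff_add_eq)
    then have "p + s *\<^sub>R x \<in> ?A"
      by (rule image_eqI[rotated]) (simp add: scaleR_diff_right)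
    then show ?thesis using notB notC notD by blast
  next
    case 2
    have "2 *\<^sub>R x - b \<in> T"
      using inT[of "2 * \<alpha>" "2 * \<beta> - 1" "2 * \<gamma>"] coeffs 2 by (simp add: x scaleR_add_right scaleR_diff_left add_diff_eq diff_add_eq)
    then have "p + s *\<^sub>R x \<in> ?B"
      by (rule image_eqI[rotated]) (simp add: scaleR_diff_right)
    then show ?thesis using notB notC notD by blast
  next
    case 3
    have "2 *\<^sub>R x - c \<in> T"
      using inT[of "2 * \<alpha>" "2 * \<beta>" "2 * \<gamma> - 1"] coeffs 3 by (simp add: x scaleR_add_right scaleR_diff_left add_diff_eq diff_add_eq)
    then have "p + s *\<^sub>R x \<in> ?C"
      by (rule image_eqI[rotated]) (simp add: scaleR_diff_right)
    then show ?thesis using notB notC notD by blast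
  next
    case 4
    have "(a + b + c) - 2 *\<^sub>R x \<in> T"
      using inT[of "1 - 2 * \<alpha>" "1 - 2 * \<beta>" "1 - 2 * \<gamma>"] coeffs 4
      by (simp add: x scaleR_add_right scaleR_diff_left add_diff_eq diff_add_eq diff_diff_eq add_ac)
    then have "p + s *\<^sub>R x \<in> ?D"
      by (rule image_eqI[rotated]) (simp add: scaleR_diff_right)
    then show ?thesis using notB notC notD by blast
  qed
qed

text \<open>The triangles of a bisection process are the images of one fixed triangle under the maps
  \<open>x \<mapsto> p + s x\<close>; the central one of the four quarters has negative \<open>s\<close>.\<close>

definition homothety_integral ::
    "(complex \<Rightarrow> complex) \<Rightarrow> complex \<Rightarrow> complex \<Rightarrow> complex \<Rightarrow> complex \<Rightarrow> real \<Rightarrow> complex" where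
  "homothety_integral f a b c p s = triangle_integral f (p + s *\<^sub>R a) (p + s *\<^sub>R b) (p + s *\<^sub>R c)"

lemma homothety_integral_quarters:
  assumes "continuous_on ((\<lambda>x. p + s *\<^sub>R x) ` (convex hull {a, b, c})) f"
  shows "homothety_integral f a b c p s =
    homothety_integral f a b c (p + (s / 2) *\<^sub>R a) (s / 2) +
    homothety_integral f a b c (p + (s / 2) *\<^sub>R b) (s / 2) +
    homothety_integral f a b c (p + (s / 2) *\<^sub>R c) (s / 2) +
    homothety_integral f a b c (p + (s / 2) *\<^sub>R (a + b + c)) (- s / 2)"
proof -
  have mid: "midpoint (p + s *\<^sub>R x) (p + s *\<^sub>R y) = p + (s / 2) *\<^sub>R x + (s / 2) *\<^sub>R y" for x y
    by (simp add: midpoint_def scaleR_conv_of_real field_simps)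
  have vertex: "p + (s / 2) *\<^sub>R x + (s / 2) *\<^sub>R x = p + s *\<^sub>R x" for x
    by (simp add: scaleR_conv_of_real field_simps)
  have central: "p + (s / 2) *\<^sub>R (a + b + c) + (- s / 2) *\<^sub>R a = p + (s / 2) *\<^sub>R b + (s / 2) *\<^sub>R c"
    "p + (s / 2) *\<^sub>R (a + b + c) + (- s / 2) *\<^sub>R b = p + (s / 2) *\<^sub>R a + (s / 2) *\<^sub>R c"
    "p + (s / 2) *\<^sub>R (a + b + c) + (- s / 2) *\<^sub>R c = p + (s / 2) *\<^sub>R a + (s / 2) *\<^sub>R b"
    by (simp_all add: scaleR_conv_of_real field_simps)
  have comm: "p + (s / 2) *\<^sub>R b + (s / 2) *\<^sub>R a = p + (s / 2) *\<^sub>R a + (s / 2) *\<^sub>R b"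
    "p + (s / 2) *\<^sub>R c + (s / 2) *\<^sub>R a = p + (s / 2) *\<^sub>R a + (s / 2) *\<^sub>R c"
    "p + (s / 2) *\<^sub>R c + (s / 2) *\<^sub>R b = p + (s / 2) *\<^sub>R b + (s / 2) *\<^sub>R c"
    by simp_all
  have "continuous_on (convex hull {p + s *\<^sub>R a, p + s *\<^sub>R b, p + s *\<^sub>R c}) f"
    using assms by (simp only: convex_hull_homothety)
  from triangle_integral_quadrisection[OF this] show ?thesis
    unfolding homothety_integral_def mid vertex central comm .
qed

text \<open>Goursat's argument, with a superadditive \<open>\<nu>\<close> in place of a multiple of the area: a violation
  of the bound is inherited by one of the four quarters, and so on down to a point, where it contradicts the
  local bound.\<close>

lemma triangle_bisection_principle:
  fixes a b c :: complex and \<nu> :: "complex \<Rightarrow> real \<Rightarrow> real"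
  defines "H \<equiv> \<lambda>p s. (\<lambda>x. p + s *\<^sub>R x) ` (convex hull {a, b, c})"
  assumes cont: "continuous_on (convex hull {a, b, c}) f"
    and super: "\<And>p s. \<nu> (p + (s / 2) *\<^sub>R a) (s / 2) + \<nu> (p + (s / 2) *\<^sub>R b) (s / 2) +
      \<nu> (p + (s / 2) *\<^sub>R c) (s / 2) + \<nu> (p + (s / 2) *\<^sub>R (a + b + c)) (- s / 2) \<le> \<nu> p s"
    and local: "\<And>z. z \<in> convex hull {a, b, c} \<Longrightarrow> \<exists>\<delta>>0. \<forall>p s. s \<noteq> 0 \<and> \<bar>s\<bar> < \<delta> \<and> z \<in> H p s \<and>
      H p s \<subseteq> convex hull {a, b, c} \<longrightarrow> cmod (homothety_integral f a b c p s) \<le> \<nu> p s"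
  shows "cmod (triangle_integral f a b c) \<le> \<nu> 0 1"
proof (rule ccontr)
  define M where "M = homothety_integral f a b c"
  define T where "T = convex hull {a, b, c}"
  \<comment> \<open>\<open>s \<noteq> 0\<close> excludes degenerate triangles, at which the local bound says nothing.\<close>
  define bad where "bad = (\<lambda>(p, s). s \<noteq> 0 \<and> H p s \<subseteq> T \<and> \<nu> p s < cmod (M p s))"
  define half where "half = (\<lambda>(p, s::real) (p', s'). H p' s' \<subseteq> H p s \<and> \<bar>s'\<bar> = \<bar>s\<bar> / 2)"
  have H1: "H 0 1 = T" by (simp add: H_def T_def)
  have incl: "H (p + (s / 2) *\<^sub>R a) (s / 2) \<subseteq> H p s" "H (p + (s / 2) *\<^sub>R b) (s / 2) \<subseteq> H p s"
      "H (p + (s / 2) *\<^sub>R c) (s / 2) \<subseteq> H p s" "H (p + (s / 2) *\<^sub>R (a + b + c)) (- s / 2) \<subseteq> H p s" for p s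
  proof -
    have mem: "p + (s / 2) *\<^sub>R x + (s / 2) *\<^sub>R y \<in> H p s" if "x \<in> T" "y \<in> T" for x y
    proof -
      have "(1 / 2) *\<^sub>R x + (1 / 2) *\<^sub>R y \<in> T"
        using that convex_convex_hull[of "{a,b,c}"] unfolding T_def
        by (metis convexD field_sum_of_halves half_gt_zero less_eq_real_def zero_less_one)
      then show ?thesis
        unfolding H_def T_def[symmetric] by (rule image_eqI[rotated]) (simp add: scaleR_add_right)
    qed
    have abc: "a \<in> T" "b \<in> T" "c \<in> T"
      by (simp_all add: T_def hull_inc)
    show "H (p + (s / 2) *\<^sub>R a) (s / 2) \<subseteq> H p s" "H (p + (s / 2) *\<^sub>R b) (s / 2) \<subseteq> H p s"
      "H (p + (s / 2) *\<^sub>R c) (s / 2) \<subseteq> H p s"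
      using mem abc by (auto simp: H_def T_def)
    have "H (p + (s / 2) *\<^sub>R (a + b + c)) (- s / 2) = convex hull {p + (s / 2) *\<^sub>R b + (s / 2) *\<^sub>R c,
        p + (s / 2) *\<^sub>R a + (s / 2) *\<^sub>R c, p + (s / 2) *\<^sub>R a + (s / 2) *\<^sub>R b}"
      unfolding H_def convex_hull_homothety
      by (intro arg_cong[of _ _ "\<lambda>X. convex hull X"] arg_cong2[of _ _ _ _ insert] refl)
        (simp_all add: scaleR_conv_of_real field_simps)
    also have "\<dots> \<subseteq> H p s"
    proof (rule hull_minimal)
      show "convex (H p s)"
        unfolding H_def convex_hull_homothety by (rule convex_convex_hull)
    qed (use mem abc in auto)
    finally show "H (p + (s / 2) *\<^sub>R (a + b + c)) (- s / 2) \<subseteq> H p s" .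
  qed
  assume "\<not> ?thesis"
  then have start: "bad (0, 1)"
    by (simp add: bad_def H1 M_def homothety_integral_def)
  have step: "\<exists>q'. bad q' \<and> half q q'" if "bad q" for q
  proof -
    obtain p s where q: "q = (p, s)" by force
    have s: "s \<noteq> 0" "H p s \<subseteq> T" and big: "\<nu> p s < cmod (M p s)"
      using that by (auto simp: bad_def q)
    let ?pa = "p + (s / 2) *\<^sub>R a" and ?pb = "p + (s / 2) *\<^sub>R b" and ?pc = "p + (s / 2) *\<^sub>R c"
      and ?pd = "p + (s / 2) *\<^sub>R (a + b + c)"
    have "continuous_on (H p s) f"
      using cont s continuous_on_subset unfolding T_def by blast
    then have M4: "M p s = M ?pa (s / 2) + M ?pb (s / 2) +
        M ?pc (s / 2) + M ?pd (- s / 2)"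
      unfolding M_def H_def by (rule homothety_integral_quarters)
    have "\<not> (cmod (M ?pa (s / 2)) \<le> \<nu> ?pa (s / 2) \<and>
        cmod (M ?pb (s / 2)) \<le> \<nu> ?pb (s / 2) \<and>
        cmod (M ?pc (s / 2)) \<le> \<nu> ?pc (s / 2) \<and>
        cmod (M ?pd (- s / 2)) \<le> \<nu> ?pd (- s / 2))" (is "\<not> ?small")
    proof
      assume small: ?small
      have tri: "cmod (x + y + z + t) \<le> cmod x + cmod y + cmod z + cmod t" for x y z t :: complex
        by (intro order_trans[OF norm_triangle_ineq] add_mono order_refl)
      show False
        using big small super[of p s] unfolding M4
        using tri[of "M ?pa (s / 2)" "M ?pb (s / 2)"
            "M ?pc (s / 2)" "M ?pd (- s / 2)"]
        by linarith
    qed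
    note one_of = this
    have witness: "\<exists>p' s'. \<nu> p' s' < cmod (M p' s') \<and> H p' s' \<subseteq> H p s \<and> \<bar>s'\<bar> = \<bar>s\<bar> / 2"
      if "\<nu> p' s' < cmod (M p' s')" "H p' s' \<subseteq> H p s" "\<bar>s'\<bar> = \<bar>s\<bar> / 2" for p' s'
      using that by blast
    have abs_half: "\<bar>s / 2\<bar> = \<bar>s\<bar> / 2" "\<bar>- s / 2\<bar> = \<bar>s\<bar> / 2"
      by auto
    from one_of have "\<exists>p' s'. \<nu> p' s' < cmod (M p' s') \<and> H p' s' \<subseteq> H p s \<and> \<bar>s'\<bar> = \<bar>s\<bar> / 2"
      unfolding de_Morgan_conj not_le
      using witness[OF _ incl(1) abs_half(1)] witness[OF _ incl(2) abs_half(1)]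
        witness[OF _ incl(3) abs_half(1)] witness[OF _ incl(4) abs_half(2)] by argo
    then obtain p' s' where "\<nu> p' s' < cmod (M p' s')" "H p' s' \<subseteq> H p s" "\<bar>s'\<bar> = \<bar>s\<bar> / 2"
      by blast
    then have "bad (p', s') \<and> half q (p', s')"
      using s by (auto simp: bad_def half_def q)
    then show ?thesis by blast
  qed
  obtain q where q: "\<And>n::nat. bad (q n)" "\<And>n. half (q n) (q (Suc n))"
    using dependent_nat_choice[of "\<lambda>_. bad" "\<lambda>_. half"] start step by metis
  define p s where "p = fst \<circ> q" and "s = snd \<circ> q"
  have bad: "s n \<noteq> 0" "H (p n) (s n) \<subseteq> T" "\<nu> (p n) (s n) < cmod (M (p n) (s n))" for n
    using q(1)[of n] by (auto simp: bad_def p_def s_def split: prod.splits)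
  have half: "H (p (Suc n)) (s (Suc n)) \<subseteq> H (p n) (s n)" "\<bar>s (Suc n)\<bar> = \<bar>s n\<bar> / 2" for n
    using q(2)[of n] by (auto simp: half_def p_def s_def split: prod.splits)
  have "\<Inter>(range (\<lambda>n. H (p n) (s n))) \<noteq> {}"
  proof (rule compact_nest)
    show "compact (H (p n) (s n))" for n
      unfolding H_def convex_hull_homothety by (simp add: finite_imp_compact_convex_hull)
    show "H (p n) (s n) \<noteq> {}" for n
      by (simp add: H_def)
    show "H (p n) (s n) \<subseteq> H (p m) (s m)" if "m \<le> n" for m n
      using lift_Suc_antimono_le[of "\<lambda>n. H (p n) (s n)"] half(1) that by blast
  qed
  then obtain z where z: "\<And>n. z \<in> H (p n) (s n)" by auto
  then have "z \<in> T" using bad(2) by blast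
  then obtain \<delta> where "\<delta> > 0" and \<delta>: "\<And>p s. \<lbrakk>s \<noteq> 0; \<bar>s\<bar> < \<delta>; z \<in> H p s; H p s \<subseteq> T\<rbrakk> \<Longrightarrow> cmod (M p s) \<le> \<nu> p s"
    using local[of z] unfolding T_def M_def by blast
  have sn: "\<bar>s n\<bar> = \<bar>s 0\<bar> * (1 / 2) ^ n" for n
    by (induction n) (simp_all add: half)
  have "(\<lambda>n. \<bar>s 0\<bar> * (1 / 2) ^ n) \<longlonglongrightarrow> \<bar>s 0\<bar> * 0"
    by (intro tendsto_intros LIMSEQ_power_zero) simp
  then have "\<forall>\<^sub>F n in sequentially. \<bar>s n\<bar> < \<delta>"
    using \<open>\<delta> > 0\<close> unfolding sn[symmetric] by (simp add: order_tendsto_iff)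
  then obtain n where "\<bar>s n\<bar> < \<delta>"
    by (meson eventually_sequentially order_refl)
  then show False
    using \<delta>[OF bad(1) _ z bad(2)] bad(3) by (metis not_le)
qed

lemma measure_homothety:
  "measure lebesgue ((\<lambda>x. p + s *\<^sub>R x) ` S) = s\<^sup>2 * measure lebesgue S" for p :: complex
  using measure_lebesgue_affine[of s p S] by (simp add: add.commute)

text \<open>The sum of the areas of the quarters is the area of the triangle. So it suffices that they
  cover it: this bounds the part outside \<open>B\<close> from above, hence the part inside \<open>B\<close> from below.\<close>

lemma measure_triangle_quarters:
  fixes a b c p :: complex
  defines "H \<equiv> \<lambda>p s. (\<lambda>x. p + s *\<^sub>R x) ` (convex hull {a, b, c})"
  assumes B: "B \<in> sets lebesgue"
  shows "measure lebesgue (H (p + (s / 2) *\<^sub>R a) (s / 2) \<inter> B) +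
    measure lebesgue (H (p + (s / 2) *\<^sub>R b) (s / 2) \<inter> B) +
    measure lebesgue (H (p + (s / 2) *\<^sub>R c) (s / 2) \<inter> B) +
    measure lebesgue (H (p + (s / 2) *\<^sub>R (a + b + c)) (- s / 2) \<inter> B) \<le> measure lebesgue (H p s \<inter> B)"
    (is "?m (?H1 \<inter> B) + ?m (?H2 \<inter> B) + ?m (?H3 \<inter> B) + ?m (?H4 \<inter> B) \<le> _")
proof -
  have meas: "H p s \<in> lmeasurable" for p s
    unfolding H_def convex_hull_homothety
    by (intro lmeasurable_compact finite_imp_compact_convex_hull) simp
  have split: "?m (H p s \<inter> B) = ?m (H p s) - ?m (H p s - B)" for p s
  proof -
    have "?m (H p s - (H p s - B)) = ?m (H p s) - ?m (H p s - B)"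
      using sets.Diff[OF fmeasurableD[OF meas] B] by (intro measurable_measure_Diff meas) auto
    moreover have "H p s - (H p s - B) = H p s \<inter> B" by auto
    ultimately show ?thesis by simp
  qed
  have H_measure: "?m (H p s) = s\<^sup>2 * ?m (convex hull {a, b, c})" for p s
    unfolding H_def by (rule measure_homothety)
  have diff: "H p s - B \<in> lmeasurable" for p s
    using meas B by (rule fmeasurable_Diff)
  have "H p s \<subseteq> ?H1 \<union> ?H2 \<union> ?H3 \<union> ?H4"
    unfolding H_def by (rule triangle_subset_quarters)
  then have "?m (H p s - B) \<le> ?m ((?H1 - B) \<union> (?H2 - B) \<union> (?H3 - B) \<union> (?H4 - B))"
    by (intro measure_mono_fmeasurable fmeasurable.Un diff) (use diff in \<open>auto simp: fmeasurable_def\<close>)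
  also have "\<dots> \<le> ?m (?H1 - B) + ?m (?H2 - B) + ?m (?H3 - B) + ?m (?H4 - B)"
    by (intro order_trans[OF measure_Un_le] add_mono order_refl)
      (use diff in \<open>auto simp: fmeasurable_def\<close>)
  finally show ?thesis
    unfolding split H_measure by (simp add: power2_eq_square field_simps)
qed

section \<open>Vanishing of integrals over triangles\<close>

lemma triangle_integral_holomorphic:
  assumes "f holomorphic_on convex hull {a, b, c}"
  shows "triangle_integral f a b c = 0"
  using has_chain_integral_chain_integral3[OF Cauchy_theorem_triangle[OF assms]]
  by (simp add: triangle_integral_def)

text \<open>Linear functions integrate to zero, so only the deviation from a linear function counts.\<close>

lemma triangle_integral_linear_bound:
  assumes cont: "continuous_on (convex hull {a, b, c}) f"
    and bound: "\<And>x. x \<in> convex hull {a, b, c} \<Longrightarrow> cmod (f x - (A + C * (x - z))) \<le> B"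
    and d: "cmod (b - a) \<le> d" "cmod (c - b) \<le> d" "cmod (a - c) \<le> d"
  shows "cmod (triangle_integral f a b c) \<le> 3 * d * B"
proof -
  define g where "g = (\<lambda>x. A + C * (x - z))"
  have "a \<in> convex hull {a, b, c}" by (simp add: hull_inc)
  then have "B \<ge> 0" using bound norm_ge_zero order_trans by blast
  have seg: "closed_segment a b \<subseteq> convex hull {a, b, c}" "closed_segment b c \<subseteq> convex hull {a, b, c}"
      "closed_segment c a \<subseteq> convex hull {a, b, c}"
    by (simp_all add: segments_subset_convex_hull)
  have side: "cmod (contour_integral (linepath x y) f - contour_integral (linepath x y) g) \<le> d * B"
    if "closed_segment x y \<subseteq> convex hull {a, b, c}" "cmod (y - x) \<le> d" for x y
  proof -
    have "continuous_on (closed_segment x y) g"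
      unfolding g_def by (intro continuous_intros)
    then have int: "f contour_integrable_on linepath x y" "g contour_integrable_on linepath x y"
      using that(1) cont continuous_on_subset by (auto intro!: contour_integrable_continuous_linepath)
    have "cmod (contour_integral (linepath x y) (\<lambda>w. f w - g w)) \<le> B * cmod (y - x)"
      by (rule contour_integral_bound_linepath)
        (use int that bound \<open>B \<ge> 0\<close> in \<open>auto intro: contour_integrable_diff simp: g_def\<close>)
    then show ?thesis
      using that(2) \<open>B \<ge> 0\<close> mult_left_mono[of "cmod (y - x)" d B]
      by (simp add: contour_integral_diff[OF int] mult.commute)
  qed
  have "triangle_integral g a b c = 0"
    unfolding g_def by (intro triangle_integral_holomorphic holomorphic_intros)
  then have "triangle_integral f a b c =
      (contour_integral (linepath a b) f - contour_integral (linepath a b) g) +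
      (contour_integral (linepath b c) f - contour_integral (linepath b c) g) +
      (contour_integral (linepath c a) f - contour_integral (linepath c a) g)"
    unfolding triangle_integral_def by (simp add: algebra_simps)
  also have "cmod \<dots> \<le> d * B + d * B + d * B"
    by (intro order_trans[OF norm_triangle_ineq] add_mono side seg d)
  also have "\<dots> = 3 * d * B" by simp
  finally show ?thesis .
qed

text \<open>Rational slopes suffice, and they make the family of sets countable. The precision is
  measured relative to the angle bound \<open>1 / Suc N\<close>, because the crossing argument loses this factor.\<close>

lemma directional_derivatives_imp_linear_on_lines:
  fixes F :: "complex \<Rightarrow> complex"
  assumes "Im (cnj h1 * h2) \<noteq> 0"
    and der: "((\<lambda>t::real. (F (z + t *\<^sub>R h1) - F z) /\<^sub>R t) \<longlongrightarrow> h1 * c) (at 0)"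
      "((\<lambda>t::real. (F (z + t *\<^sub>R h2) - F z) /\<^sub>R t) \<longlongrightarrow> h2 * c) (at 0)"
    and "e > 0"
  obtains N M :: nat and x y :: rat where "z \<in> linear_on_lines F (1 / Suc N) (1 / Suc M)
    (e / Suc N) (Complex (of_rat x) (of_rat y))"
proof -
  define u v where "u = sgn h1" and "v = sgn h2"
  have nz: "h1 \<noteq> 0" "h2 \<noteq> 0" using assms(1) by auto
  have uv1: "cmod u = 1" "cmod v = 1" using nz by (simp_all add: u_def v_def norm_sgn)
  define m where "m = cmod h1 * cmod h2"
  have "cnj h1 * h2 = of_real m * (cnj u * v)"
    using nz by (simp add: m_def u_def v_def sgn_eq field_simps)
  then have "Im (cnj h1 * h2) = m * Im (cnj u * v)"
    by (simp only: times_complex.sel(2) Re_complex_of_real Im_complex_of_real mult_zero_left add_0_right)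
  then have "\<bar>Im (cnj u * v)\<bar> > 0" using assms(1) by auto
  then obtain N where N: "1 / real (Suc N) < \<bar>Im (cnj u * v)\<bar>"
    by (meson nat_approx_posE)
  define \<epsilon> where "\<epsilon> = e / Suc N"
  have "\<epsilon> > 0" using \<open>e > 0\<close> by (simp add: \<epsilon>_def)
  obtain x where x: "of_rat x \<in> {Re c - \<epsilon> / 4 <..< Re c}"
    using of_rat_dense[of "Re c - \<epsilon> / 4" "Re c"] \<open>\<epsilon> > 0\<close> by auto
  obtain y where y: "of_rat y \<in> {Im c - \<epsilon> / 4 <..< Im c}"
    using of_rat_dense[of "Im c - \<epsilon> / 4" "Im c"] \<open>\<epsilon> > 0\<close> by auto
  define c' where "c' = Complex (of_rat x) (of_rat y)"
  have "cmod (c - c') \<le> \<bar>Re (c - c')\<bar> + \<bar>Im (c - c')\<bar>" by (rule cmod_le)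
  also have "\<dots> \<le> \<epsilon> / 2" using x y by (simp add: c'_def)
  finally have cc': "cmod (c - c') \<le> \<epsilon> / 2" .
  obtain d1 where d1: "d1 > 0" "\<And>t. \<bar>t\<bar> \<le> d1 \<Longrightarrow>
       cmod (F (z + of_real t * u) - F z - c * (of_real t * u)) \<le> \<epsilon> / 2 * \<bar>t\<bar>"
    using directional_derivative_unit[OF der(1) nz(1), of "\<epsilon> / 2"] \<open>\<epsilon> > 0\<close> unfolding u_def by auto
  obtain d2 where d2: "d2 > 0" "\<And>t. \<bar>t\<bar> \<le> d2 \<Longrightarrow>
       cmod (F (z + of_real t * v) - F z - c * (of_real t * v)) \<le> \<epsilon> / 2 * \<bar>t\<bar>"
    using directional_derivative_unit[OF der(2) nz(2), of "\<epsilon> / 2"] \<open>\<epsilon> > 0\<close> unfolding v_def by auto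
  obtain M where M: "1 / real (Suc M) < min d1 d2"
    using d1(1) d2(1) nat_approx_posE[of "min d1 d2"] by auto
  have change: "cmod (F (z + of_real t * w) - F z - c' * (of_real t * w)) \<le> \<epsilon> * \<bar>t\<bar>"
    if "cmod (F (z + of_real t * w) - F z - c * (of_real t * w)) \<le> \<epsilon> / 2 * \<bar>t\<bar>" "cmod w = 1" for w t
  proof -
    have "F (z + of_real t * w) - F z - c' * (of_real t * w) =
        (F (z + of_real t * w) - F z - c * (of_real t * w)) + (c - c') * (of_real t * w)"
      by (simp add: algebra_simps)
    also have "cmod \<dots> \<le> \<epsilon> / 2 * \<bar>t\<bar> + \<epsilon> / 2 * \<bar>t\<bar>"
      using that mult_right_mono[OF cc', of "\<bar>t\<bar>"]
      by (intro norm_triangle_le add_mono) (simp_all add: norm_mult)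
    finally show ?thesis by simp
  qed
  have "z \<in> linear_on_lines F (1 / Suc N) (1 / Suc M) \<epsilon> c'"
    unfolding linear_on_lines_def
    using uv1 N M d1(2) d2(2) change by (intro CollectI exI[of _ u] exI[of _ v]) auto
  then show ?thesis using that unfolding \<epsilon>_def c'_def by blast
qed

text \<open>For given \<open>\<eta>\<close> the points of \<open>P\<close> are distributed over countably many sets \<open>A i\<close>, in each
  of which \<open>F\<close> is linear with slope \<open>C i\<close> up to a relative error \<open>e\<close>. Consider a small triangle around a
  point of \<open>A i\<close>. If \<open>A i\<close> is dense in it at the scale of the triangle, the Lipschitz bound carries this
  approximate linearity over to the whole triangle, and the integral is at most \<open>\<eta> s\<^sup>2\<close>. Otherwise
  it contains a hole of \<open>A i\<close> of a proportional size, and the crude Lipschitz bound is paid for by the area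
  of the triangle within \<open>G i - A i\<close>, where \<open>G i\<close> is open and exceeds \<open>A i\<close> by very little.\<close>

lemma holomorphic_if_lipschitz_and_directional:
  assumes contF: "continuous_on UNIV F" and clo: "closed P"
    and hol: "F holomorphic_on ball w0 r - P" and "K \<ge> 0"
    and lip: "\<And>w x. \<lbrakk>w \<in> P \<inter> ball w0 r; x \<in> ball w0 r\<rbrakk> \<Longrightarrow> cmod (F x - F w) \<le> K * cmod (x - w)"
    and dirs: "\<And>z. z \<in> P \<inter> ball w0 r \<Longrightarrow> \<exists>c h1 h2. Im (cnj h1 * h2) \<noteq> 0 \<and>
      (\<forall>h\<in>{h1, h2}. ((\<lambda>t::real. (F (z + t *\<^sub>R h) - F z) /\<^sub>R t) \<longlongrightarrow> h * c) (at 0))"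
  shows "F holomorphic_on ball w0 r"
proof -
  have zero: "triangle_integral F a b c = 0" if T0: "convex hull {a, b, c} \<subseteq> ball w0 r" for a b c
  proof (cases "collinear {a, b, c}")
    case True
    have contT: "continuous_on (convex hull {x, y, z}) F" for x y z
      using contF continuous_on_subset by blast
    show ?thesis
    proof (cases "a = b")
      case True
      have "contour_integral (linepath b c) F + contour_integral (linepath c b) F = 0"
        using contour_integral_reverse_linepath[of b c F] contF continuous_on_subset
        by (metis add.left_inverse subset_UNIV)
      then show ?thesis using True by (simp add: triangle_integral_def)
    next
      case False
      then obtain k where "c = a + k *\<^sub>R (b - a)"
        using True by (auto simp: collinear_3_affine_hull affine_hull_2_alt)
      then show ?thesis
        unfolding triangle_integral_def by (intro Cauchy_theorem_flat[of _ _ _ _ k] contT) simp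
    qed
  next
    case False
    define T where "T = convex hull {a, b, c}"
    define d where "d = diameter T"
    define area where "area = measure lebesgue T"
    define H where "H = (\<lambda>p s. (\<lambda>x. p + s *\<^sub>R x) ` T)"
    define M where "M = homothety_integral F a b c"
    have "compact T"
      unfolding T_def by (simp add: finite_imp_compact_convex_hull)
    have abc: "a \<in> T" "b \<in> T" "c \<in> T" by (simp_all add: T_def hull_inc)
    have diam: "cmod (x - y) \<le> d" if "x \<in> T" "y \<in> T" for x y
      using diameter_bounded_bound[OF compact_imp_bounded[OF \<open>compact T\<close>] that]
      by (simp add: d_def dist_norm)
    have "d > 0"
    proof -
      have "a \<noteq> b" using False by auto
      then show ?thesis using diam[OF abc(1,2)] by (metis norm_le_zero_iff not_le order_trans right_minus_eq)
    qed
    have "area > 0"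
    proof -
      have "card {a, b, c} = Suc DIM(complex)" "\<not> affine_dependent {a, b, c}"
        using False by (auto simp: collinear_3_eq_affine_dependent card_insert_if)
      then have "interior T \<noteq> {}"
        using interior_convex_hull_eq_empty unfolding T_def by blast
      then have "\<not> negligible T"
        unfolding T_def by (simp add: negligible_convex_interior)
      then show ?thesis
        using \<open>compact T\<close> lmeasurable_compact negligible_iff_measure0 unfolding area_def
        by (metis measure_nonneg order_le_less)
    qed
    have Hdiam: "cmod (x - y) \<le> \<bar>s\<bar> * d" if "x \<in> H p s" "y \<in> H p s" for x y p s
    proof -
      obtain x' y' where "x' \<in> T" "y' \<in> T" "x = p + s *\<^sub>R x'" "y = p + s *\<^sub>R y'"
        using \<open>x \<in> H p s\<close> \<open>y \<in> H p s\<close> unfolding H_def by blast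
      then have "x - y = s *\<^sub>R (x' - y')" by (simp add: scaleR_diff_right)
      then show ?thesis using diam[OF \<open>x' \<in> T\<close> \<open>y' \<in> T\<close>] by (simp add: mult_left_mono)
    qed
    have Hhull: "H p s = convex hull {p + s *\<^sub>R a, p + s *\<^sub>R b, p + s *\<^sub>R c}" for p s
      unfolding H_def T_def by (rule convex_hull_homothety)
    have Mbound: "cmod (M p s) \<le> 3 * (\<bar>s\<bar> * d) * B"
      if bound: "\<And>x. x \<in> H p s \<Longrightarrow> cmod (F x - (A + C * (x - z))) \<le> B" for p s A B C z
      unfolding M_def homothety_integral_def
    proof (rule triangle_integral_linear_bound)
      show "cmod (F x - (A + C * (x - z))) \<le> B"
        if "x \<in> convex hull {p + s *\<^sub>R a, p + s *\<^sub>R b, p + s *\<^sub>R c}" for x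
        using that bound unfolding Hhull by blast
      have "p + s *\<^sub>R a \<in> H p s" "p + s *\<^sub>R b \<in> H p s" "p + s *\<^sub>R c \<in> H p s"
        using abc by (auto simp: H_def)
      then show "cmod ((p + s *\<^sub>R b) - (p + s *\<^sub>R a)) \<le> \<bar>s\<bar> * d" "cmod ((p + s *\<^sub>R c) - (p + s *\<^sub>R b)) \<le> \<bar>s\<bar> * d"
        "cmod ((p + s *\<^sub>R a) - (p + s *\<^sub>R c)) \<le> \<bar>s\<bar> * d"
        by (simp_all only: Hdiam)
    qed (use contF continuous_on_subset in blast)
    have "cmod (triangle_integral F a b c) \<le> 2 * \<eta>" if "\<eta> > 0" for \<eta> :: real
    proof -
      \<comment> \<open>Three sides of length \<open>D = \<bar>s\<bar> d\<close> and a deviation of at most \<open>3 e D\<close> from a linear function give an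
        integral of at most \<open>9 e D\<^sup>2 = \<eta> s\<^sup>2\<close>.\<close>
      define e where "e = \<eta> / (9 * d\<^sup>2)"
      have "e > 0" using \<open>\<eta> > 0\<close> \<open>d > 0\<close> by (simp add: e_def)
      define idx where "idx = (from_nat :: nat \<Rightarrow> nat \<times> nat \<times> rat \<times> rat)"
      define C where "C = (\<lambda>i. case idx i of (_, _, x, y) \<Rightarrow> Complex (of_rat x) (of_rat y))"
      define \<kappa> where "\<kappa> = (\<lambda>i. case idx i of (N, _, _, _) \<Rightarrow> 1 / real (Suc N))"
      define \<delta> where "\<delta> = (\<lambda>i. case idx i of (_, M, _, _) \<Rightarrow> 1 / real (Suc M))"
      define L where "L = (\<lambda>i. linear_on_lines F (\<kappa> i) (\<delta> i) (e / 4 * \<kappa> i) (C i))"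
      define A where "A = (\<lambda>i. P \<inter> ball w0 r \<inter> L i)"
      have pos: "\<kappa> i > 0" "\<delta> i > 0" for i
        by (simp_all add: \<kappa>_def \<delta>_def split: prod.split)
      have cover: "\<exists>i. z \<in> A i" if z: "z \<in> P \<inter> ball w0 r" for z
      proof -
        obtain c h1 h2 where dir: "Im (cnj h1 * h2) \<noteq> 0"
          "((\<lambda>t::real. (F (z + t *\<^sub>R h1) - F z) /\<^sub>R t) \<longlongrightarrow> h1 * c) (at 0)"
          "((\<lambda>t::real. (F (z + t *\<^sub>R h2) - F z) /\<^sub>R t) \<longlongrightarrow> h2 * c) (at 0)"
          using dirs[OF z] by blast
        have "e / 4 > 0" using \<open>e > 0\<close> by simp
        then obtain N M x y where "z \<in> linear_on_lines F (1 / real (Suc N)) (1 / real (Suc M))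
            (e / 4 / real (Suc N)) (Complex (of_rat x) (of_rat y))"
          by (rule directional_derivatives_imp_linear_on_lines[OF dir])
        moreover have "idx (to_nat (N, M, x, y)) = (N, M, x, y)"
          by (simp add: idx_def)
        ultimately have "z \<in> L (to_nat (N, M, x, y))"
          by (simp only: L_def \<kappa>_def \<delta>_def C_def prod.case times_divide_eq_right mult_1_right)
        then show ?thesis using z by (auto simp: A_def)
      qed
      have A_near: "cmod (F w - F z - C i * (w - z)) \<le> e * cmod (w - z)"
        if "z \<in> A i" "w \<in> A i" "cmod (w - z) \<le> \<kappa> i * \<delta> i / 2" for z w i
      proof -
        have "cmod (F w - F z - C i * (w - z)) \<le> 4 * (e / 4 * \<kappa> i) / \<kappa> i * cmod (w - z)"
          by (rule linear_on_lines_imp_linear[of _ _ _ "\<delta> i"])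
            (use that pos[of i] \<open>e > 0\<close> in \<open>auto simp: A_def L_def\<close>)
        then show ?thesis using pos(1)[of i] by simp
      qed
      \<comment> \<open>The relative size of the holes that spoil the approximation; \<open>1\<close> is added
        to avoid division by zero.\<close>
      define \<theta> where "\<theta> = (\<lambda>i. min 1 (e / (K + cmod (C i) + 1)))"
      have \<theta>: "\<theta> i > 0" "\<theta> i \<le> 1" "(K + cmod (C i)) * \<theta> i \<le> e" for i
      proof -
        have D: "K + cmod (C i) + 1 > 0" using \<open>K \<ge> 0\<close> by (simp add: add_nonneg_pos)
        then show "\<theta> i > 0" using \<open>e > 0\<close> by (simp add: \<theta>_def)
        show "\<theta> i \<le> 1" by (simp add: \<theta>_def)
        have "(K + cmod (C i)) * \<theta> i \<le> (K + cmod (C i) + 1) * (e / (K + cmod (C i) + 1))"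
          using \<open>\<theta> i > 0\<close> \<open>K \<ge> 0\<close> by (intro mult_mono) (auto simp: \<theta>_def)
        then show "(K + cmod (C i)) * \<theta> i \<le> e" using D by simp
      qed
      \<comment> \<open>A hole has at least the area \<open>(\<theta> i)\<^sup>2 s\<^sup>2 area\<close>; with the weight \<open>W i\<close> this equals the crude
        bound \<open>3 K D\<^sup>2\<close> of the integral.\<close>
      define W where "W = (\<lambda>i. 3 * K * d\<^sup>2 / ((\<theta> i)\<^sup>2 * area))"
      have W: "W i \<ge> 0" for i
        using \<open>K \<ge> 0\<close> \<open>area > 0\<close> by (simp add: W_def)
      have "\<exists>G. open G \<and> A i \<subseteq> G \<and> G - A i \<in> lmeasurable \<and>
          W i * measure lebesgue (G - A i) \<le> \<eta> * (1 / 2) ^ Suc i" for i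
      proof -
        have "A i \<in> sets lebesgue"
          unfolding A_def L_def
          by (intro sets.Int borel_closed[THEN sets_completionI_sets] borel_open[THEN sets_completionI_sets] clo
              closed_linear_on_lines contF open_ball; simp add: clo closed_linear_on_lines contF)
        moreover have epos: "\<eta> * (1 / 2) ^ Suc i / (W i + 1) > 0"
          using \<open>\<eta> > 0\<close> W[of i] by (simp add: add_nonneg_pos)
        ultimately obtain G where G: "open G" "A i \<subseteq> G" "G - A i \<in> lmeasurable"
            "emeasure lebesgue (G - A i) < ennreal (\<eta> * (1 / 2) ^ Suc i / (W i + 1))"
          using sets_lebesgue_outer_open by blast
        have "measure lebesgue (G - A i) \<le> \<eta> * (1 / 2) ^ Suc i / (W i + 1)"
          using G(4) epos emeasure_eq_measure2[OF G(3)] by (simp add: ennreal_less_iff)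
        then have "W i * measure lebesgue (G - A i) \<le> (W i + 1) * (\<eta> * (1 / 2) ^ Suc i / (W i + 1))"
          using W[of i] by (intro mult_mono) auto
        also have "\<dots> = \<eta> * (1 / 2) ^ Suc i"
          using W[of i] by (intro nonzero_mult_div_cancel_left[where a = "W i + 1", folded times_divide_eq_right]) simp
        finally show ?thesis using G by blast
      qed
      then obtain G where G: "\<And>i. open (G i)" "\<And>i. A i \<subseteq> G i" "\<And>i. G i - A i \<in> lmeasurable"
          "\<And>i. W i * measure lebesgue (G i - A i) \<le> \<eta> * (1 / 2) ^ Suc i"
        by metis
      define m where "m = (\<lambda>p s i. W i * measure lebesgue (H p s \<inter> (G i - A i)))"
      define \<nu> where "\<nu> = (\<lambda>p s. \<eta> * s\<^sup>2 + (\<Sum>i. m p s i))"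
      have m0: "m p s i \<ge> 0" for p s i
        using W by (simp add: m_def)
      have Hmeas: "H p s \<in> sets lebesgue" for p s
        unfolding Hhull by (intro fmeasurableD lmeasurable_compact finite_imp_compact_convex_hull) simp
      have m_le: "m p s i \<le> \<eta> * (1 / 2) ^ Suc i" for p s i
      proof -
        have "measure lebesgue (H p s \<inter> (G i - A i)) \<le> measure lebesgue (G i - A i)"
          by (intro measure_mono_fmeasurable G(3) sets.Int Hmeas fmeasurableD[OF G(3)]) auto
        then show ?thesis
          unfolding m_def using G(4)[of i] W[of i] by (meson mult_left_mono order_trans)
      qed
      have geo: "(\<lambda>i. \<eta> * (1 / 2) ^ Suc i) sums \<eta>"
        using sums_mult[OF power_half_series, of \<eta>] by simp
      have summ: "summable (m p s)" for p s
        by (rule summable_comparison_test'[OF sums_summable[OF geo], of 0]) (use m0 m_le in auto)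
      have "cmod (triangle_integral F a b c) \<le> \<nu> 0 1"
      proof (rule triangle_bisection_principle)
        show "continuous_on (convex hull {a, b, c}) F"
          using contF continuous_on_subset by blast
      next
        fix p :: complex and s :: real
        let ?p1 = "p + (s / 2) *\<^sub>R a" and ?p2 = "p + (s / 2) *\<^sub>R b" and ?p3 = "p + (s / 2) *\<^sub>R c"
          and ?p4 = "p + (s / 2) *\<^sub>R (a + b + c)"
        have "m ?p1 (s / 2) i + m ?p2 (s / 2) i + m ?p3 (s / 2) i + m ?p4 (- s / 2) i \<le> m p s i" for i
          using mult_left_mono[OF measure_triangle_quarters[OF fmeasurableD[OF G(3)[of i]], of p s a b c] W[of i]]
          unfolding m_def H_def T_def by (simp only: distrib_left)
        then have "(\<Sum>i. m ?p1 (s / 2) i + m ?p2 (s / 2) i + m ?p3 (s / 2) i + m ?p4 (- s / 2) i) \<le> (\<Sum>i. m p s i)"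
          by (intro suminf_le summable_add summ)
        then have "(\<Sum>i. m ?p1 (s / 2) i) + (\<Sum>i. m ?p2 (s / 2) i) + (\<Sum>i. m ?p3 (s / 2) i) +
            (\<Sum>i. m ?p4 (- s / 2) i) \<le> (\<Sum>i. m p s i)"
          by (simp add: suminf_add[symmetric] summ summable_add)
        then show "\<nu> ?p1 (s / 2) + \<nu> ?p2 (s / 2) + \<nu> ?p3 (s / 2) + \<nu> ?p4 (- s / 2) \<le> \<nu> p s"
          unfolding \<nu>_def by (simp add: power2_eq_square)
      next
        fix z assume "z \<in> convex hull {a, b, c}"
        then have zball: "z \<in> ball w0 r" using T0 by auto
        have sum0: "(\<Sum>i. m p s i) \<ge> 0" for p s
          by (intro suminf_nonneg summ m0)
        have "\<exists>\<delta>'>0. \<forall>p s. s \<noteq> 0 \<and> \<bar>s\<bar> < \<delta>' \<and> z \<in> H p s \<and> H p s \<subseteq> T \<longrightarrow> cmod (M p s) \<le> \<nu> p s"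
        proof (cases "z \<in> P")
          case False
          have "open (ball w0 r - P)" using clo by (intro open_Diff open_ball)
          then obtain \<rho> where "\<rho> > 0" and \<rho>: "ball z \<rho> \<subseteq> ball w0 r - P"
            using zball False by (meson DiffI openE)
          have "cmod (M p s) \<le> \<nu> p s" if "\<bar>s\<bar> < \<rho> / d" "z \<in> H p s" for p s
          proof -
            have "\<bar>s\<bar> * d < \<rho>" using that(1) \<open>d > 0\<close> by (simp add: field_simps)
            then have "H p s \<subseteq> ball z \<rho>"
              using Hdiam[OF that(2)] by (force simp: dist_norm)
            then have "F holomorphic_on H p s"
              using \<rho> hol holomorphic_on_subset by (meson order_trans)
            then have "M p s = 0"
              unfolding M_def homothety_integral_def Hhull by (rule triangle_integral_holomorphic)
            then show ?thesis using sum0[of p s] \<open>\<eta> > 0\<close> by (simp add: \<nu>_def)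
          qed
          then show ?thesis using \<open>\<rho> > 0\<close> \<open>d > 0\<close> by (intro exI[of _ "\<rho> / d"]) simp
        next
          case True
          then obtain i where zA: "z \<in> A i" using cover zball by blast
          then obtain \<rho> where "\<rho> > 0" and \<rho>: "ball z \<rho> \<subseteq> G i"
            using G(1)[of i] G(2)[of i] by (meson openE subsetD)
          define \<delta>' where "\<delta>' = min (\<rho> / d) (\<kappa> i * \<delta> i / (4 * d))"
          have "\<delta>' > 0" using \<open>\<rho> > 0\<close> \<open>d > 0\<close> pos by (simp add: \<delta>'_def)
          moreover have "cmod (M p s) \<le> \<nu> p s"
            if "s \<noteq> 0" "\<bar>s\<bar> < \<delta>'" and zH: "z \<in> H p s" and HT: "H p s \<subseteq> T" for p s
          proof -
            define D where "D = \<bar>s\<bar> * d"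
            have "D \<ge> 0" using \<open>d > 0\<close> by (simp add: D_def)
            have D2: "D\<^sup>2 = s\<^sup>2 * d\<^sup>2" by (simp add: D_def power_mult_distrib)
            have Dsmall: "D < \<rho>" "2 * D \<le> \<kappa> i * \<delta> i / 2"
              using that(2) \<open>d > 0\<close> by (simp_all add: D_def \<delta>'_def field_simps)
            have HG: "H p s \<subseteq> G i"
              using Hdiam[OF zH] \<rho> Dsmall(1) by (force simp: dist_norm D_def)
            have HB: "H p s \<subseteq> ball w0 r" using HT T0 by (simp add: T_def)
            show ?thesis
            proof (cases "\<forall>x\<in>H p s. \<exists>w\<in>A i. cmod (x - w) \<le> \<theta> i * D")
              case True
              have "cmod (F x - (F z + C i * (x - z))) \<le> 3 * e * D" if x: "x \<in> H p s" for x
              proof -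
                obtain w where w: "w \<in> A i" "cmod (x - w) \<le> \<theta> i * D"
                  using True x by blast
                have xz: "cmod (x - z) \<le> D" using Hdiam[OF x zH] by (simp add: D_def)
                have xw: "cmod (x - w) \<le> D"
                  using w(2) \<theta>(2)[of i] \<open>D \<ge> 0\<close> by (meson mult_left_le_one_le order_trans \<theta>(1) less_imp_le)
                have wz: "cmod (w - z) \<le> 2 * D"
                  using norm_triangle_ineq4[of "x - z" "x - w"] xz xw by simp
                have "F x - (F z + C i * (x - z)) =
                    (F x - F w) + ((F w - F z - C i * (w - z)) - C i * (x - w))"
                  by (simp add: algebra_simps)
                also have "cmod \<dots> \<le> cmod (F x - F w) + (cmod (F w - F z - C i * (w - z)) + cmod (C i) * cmod (x - w))"
                  unfolding norm_mult[symmetric]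
                  by (intro order_trans[OF norm_triangle_ineq] add_left_mono norm_triangle_ineq4)
                also have "\<dots> \<le> K * cmod (x - w) + (e * cmod (w - z) + cmod (C i) * cmod (x - w))"
                proof (intro add_mono order_refl)
                  show "cmod (F x - F w) \<le> K * cmod (x - w)"
                    using lip[of w x] w(1) x HB by (auto simp: A_def)
                  show "cmod (F w - F z - C i * (w - z)) \<le> e * cmod (w - z)"
                    using A_near[OF zA w(1)] wz Dsmall(2) by linarith
                qed
                also have "\<dots> = (K + cmod (C i)) * cmod (x - w) + e * cmod (w - z)"
                  by (simp add: algebra_simps)
                also have "\<dots> \<le> (K + cmod (C i)) * (\<theta> i * D) + e * (2 * D)"
                  using w(2) wz \<open>K \<ge> 0\<close> \<open>e > 0\<close> by (intro add_mono mult_left_mono) auto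
                also have "\<dots> \<le> e * D + e * (2 * D)"
                  using mult_right_mono[OF \<theta>(3)[of i] \<open>D \<ge> 0\<close>]
                  by (intro add_right_mono) (simp only: mult.assoc)
                also have "\<dots> = 3 * e * D" by simp
                finally show ?thesis .
              qed
              then have "cmod (M p s) \<le> 3 * (\<bar>s\<bar> * d) * (3 * e * D)"
                by (rule Mbound)
              also have "\<dots> = 9 * e * D\<^sup>2"
                by (simp add: D_def power2_eq_square)
              also have "\<dots> = \<eta> * s\<^sup>2"
                using \<open>d > 0\<close> by (simp add: D2 e_def)
              also have "\<dots> \<le> \<nu> p s" using sum0 by (simp add: \<nu>_def)
              finally show ?thesis .
            next
              case False
              then obtain x where x: "x \<in> H p s" and hole: "\<And>w. w \<in> A i \<Longrightarrow> cmod (x - w) > \<theta> i * D"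
                by (meson not_le)
              \<comment> \<open>The triangle shrunk towards \<open>x\<close>: it lies in the triangle and in the disc around \<open>x\<close> that avoids \<open>A i\<close>.\<close>
              define Q where "Q = (\<lambda>y. (1 - \<theta> i) *\<^sub>R x + \<theta> i *\<^sub>R y) ` H p s"
              have "Q \<subseteq> H p s \<inter> (G i - A i)"
              proof
                fix q assume "q \<in> Q"
                then obtain y where y: "y \<in> H p s" "q = (1 - \<theta> i) *\<^sub>R x + \<theta> i *\<^sub>R y"
                  by (auto simp: Q_def)
                have "convex (H p s)" unfolding Hhull by (rule convex_convex_hull)
                then have "q \<in> H p s"
                  using x y \<theta>(1,2)[of i] unfolding y(2) by (intro convexD) auto
                moreover have "q \<notin> A i"
                proof
                  assume "q \<in> A i"
                  have "x - q = \<theta> i *\<^sub>R (x - y)" by (simp add: y(2) algebra_simps)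
                  then have "cmod (x - q) \<le> \<theta> i * D"
                    using Hdiam[OF x y(1)] \<theta>(1)[of i] by (simp add: D_def)
                  then show False using hole[OF \<open>q \<in> A i\<close>] by simp
                qed
                ultimately show "q \<in> H p s \<inter> (G i - A i)" using HG by blast
              qed
              then have "measure lebesgue Q \<le> measure lebesgue (H p s \<inter> (G i - A i))"
              proof (rule measure_mono_fmeasurable)
                show "Q \<in> sets lebesgue"
                  unfolding Q_def Hhull convex_hull_homothety
                  by (intro fmeasurableD lmeasurable_compact finite_imp_compact_convex_hull) simp
                show "H p s \<inter> (G i - A i) \<in> lmeasurable"
                  using fmeasurable_Int_fmeasurable[OF G(3)[of i] Hmeas[of p s]] by (simp add: Int_commute)
              qed
              moreover have "measure lebesgue Q = (\<theta> i)\<^sup>2 * (s\<^sup>2 * area)"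
                unfolding Q_def H_def area_def by (simp only: measure_homothety)
              ultimately have "W i * ((\<theta> i)\<^sup>2 * (s\<^sup>2 * area)) \<le> m p s i"
                unfolding m_def using W[of i] by (simp add: mult_left_mono)
              moreover have "W i * ((\<theta> i)\<^sup>2 * (s\<^sup>2 * area)) = 3 * K * D\<^sup>2"
                using \<theta>(1)[of i] \<open>area > 0\<close> by (simp add: W_def D2)
              moreover have "m p s i \<le> (\<Sum>i. m p s i)"
                using sum_le_suminf[OF summ, of "{i}" p s] m0 by simp
              moreover have "cmod (M p s) \<le> 3 * (\<bar>s\<bar> * d) * (K * D)"
              proof (rule Mbound[of p s "F z" 0 z])
                fix x assume "x \<in> H p s"
                then show "cmod (F x - (F z + 0 * (x - z))) \<le> K * D"
                  using lip[of z x] True zball HB mult_left_mono[OF Hdiam[OF _ zH, of x] \<open>K \<ge> 0\<close>]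
                  by (force simp: D_def)
              qed
              moreover have "3 * (\<bar>s\<bar> * d) * (K * D) = 3 * K * D\<^sup>2"
                by (simp add: D_def power2_eq_square)
              moreover have "\<eta> * s\<^sup>2 \<ge> 0" using \<open>\<eta> > 0\<close> by simp
              ultimately show ?thesis unfolding \<nu>_def by linarith
            qed
          qed
          ultimately show ?thesis by blast
        qed
        then show "\<exists>\<delta>>0. \<forall>p s. s \<noteq> 0 \<and> \<bar>s\<bar> < \<delta> \<and> z \<in> (\<lambda>x. p + s *\<^sub>R x) ` (convex hull {a, b, c}) \<and>
            (\<lambda>x. p + s *\<^sub>R x) ` (convex hull {a, b, c}) \<subseteq> convex hull {a, b, c} \<longrightarrow>
            cmod (homothety_integral F a b c p s) \<le> \<nu> p s"
          unfolding H_def M_def T_def .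
      qed
      also have "\<nu> 0 1 \<le> \<eta> + \<eta>"
        unfolding \<nu>_def using suminf_le[OF m_le summ sums_summable[OF geo]] sums_unique[OF geo] by simp
      finally show ?thesis by simp
    qed
    then have "cmod (triangle_integral F a b c) \<le> 0 + \<eta>" if "\<eta> > 0" for \<eta>
      using that by (metis add_0 field_sum_of_halves half_gt_zero mult_2)
    then have "cmod (triangle_integral F a b c) \<le> 0"
      by (rule field_le_epsilon)
    then show ?thesis by simp
  qed
  have "F analytic_on ball w0 r"
  proof (rule Morera_triangle)
    show "continuous_on (ball w0 r) F" using contF continuous_on_subset by blast
  qed (use zero in \<open>auto simp: triangle_integral_def\<close>)
  then show ?thesis by (rule analytic_imp_holomorphic)
qed

section \<open>Menchoff's theorem\<close>

lemma closed_cover_contains_portion: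
  fixes P :: "'a::euclidean_space set"
  assumes "z0 \<in> P" and "\<rho> > 0" and cl: "closedin (top_of_set U) P" and U: "cball z0 \<rho> \<subseteq> U"
    and C: "\<And>n::nat. closed (C n)" and cover: "P \<inter> ball z0 \<rho> \<subseteq> (\<Union>n. C n)"
  obtains n w r where "w \<in> P" "r > 0" "ball w r \<subseteq> ball z0 \<rho>" "P \<inter> ball w r \<subseteq> C n"
proof (rule ccontr)
  note found = that
  assume none: "\<not> thesis"
  \<comment> \<open>Every relatively open part of this closed set meets \<open>P\<close> inside the open ball; for \<open>P \<inter> cball z0 \<rho>\<close>
    a portion could sit on the sphere.\<close>
  define S where "S = closure (P \<inter> ball z0 (\<rho> / 2))"
  have S_ball: "S \<subseteq> ball z0 \<rho>"
  proof -
    have "S \<subseteq> closure (ball z0 (\<rho> / 2))" unfolding S_def by (intro closure_mono) auto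
    then show ?thesis using \<open>\<rho> > 0\<close> by (auto simp: dist_norm)
  qed
  have "S \<subseteq> P"
  proof -
    obtain T where T: "closed T" "P = U \<inter> T" using cl by (meson closedin_closed)
    have "S \<subseteq> T" unfolding S_def using T by (intro closure_minimal) auto
    moreover have "S \<subseteq> U" using S_ball U by (meson ball_subset_cball subset_trans)
    ultimately show ?thesis using T by blast
  qed
  have "z0 \<in> S"
    unfolding S_def using closure_subset assms(1,2) by fastforce
  have "S \<subseteq> closure (\<Inter>(range (\<lambda>n. S - C n)))"
  proof (rule Baire)
    show "closed S" "countable (range (\<lambda>n. S - C n))" by (simp_all add: S_def)
    fix T assume "T \<in> range (\<lambda>n. S - C n)"
    then obtain n where T: "T = S - C n" by blast
    have "x \<in> closure (S - C n)" if "x \<in> S" for x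
    proof (rule ccontr)
      assume "x \<notin> closure (S - C n)"
      then obtain e where "e > 0" and e: "\<And>y. dist y x < e \<Longrightarrow> y \<notin> S - C n"
        unfolding closure_approachable by blast
      obtain w where w: "w \<in> P" "w \<in> ball z0 (\<rho> / 2)" "dist w x < e"
        using \<open>x \<in> S\<close> \<open>e > 0\<close> unfolding S_def closure_approachable by blast
      have "open (ball z0 (\<rho> / 2) \<inter> ball x e)" by (intro open_Int open_ball)
      then obtain r where r: "r > 0" "ball w r \<subseteq> ball z0 (\<rho> / 2) \<inter> ball x e"
        using w by (metis IntI dist_commute mem_ball openE)
      have "P \<inter> ball w r \<subseteq> S"
        using r(2) closure_subset[of "P \<inter> ball z0 (\<rho> / 2)"] by (auto simp: S_def)
      have "P \<inter> ball w r \<subseteq> C n"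
      proof
        fix y assume y: "y \<in> P \<inter> ball w r"
        then have "y \<in> ball x e" using r(2) by blast
        then have "dist y x < e" by (simp add: dist_commute)
        then show "y \<in> C n" using e y \<open>P \<inter> ball w r \<subseteq> S\<close> by blast
      qed
      moreover have "ball w r \<subseteq> ball z0 \<rho>"
        using r(2) \<open>\<rho> > 0\<close> by auto
      ultimately have thesis by (intro found[OF w(1) r(1)])
      with none show False ..
    qed
    then show "openin (top_of_set S) T \<and> S \<subseteq> closure T"
      unfolding T Diff_eq using openin_open_Int[OF open_Compl[OF C[of n]], of S] by blast
  qed
  moreover have "\<Inter>(range (\<lambda>n. S - C n)) = {}"
    using cover S_ball \<open>S \<subseteq> P\<close> by blast
  ultimately have "S \<subseteq> closure {}" by (simp only:)
  then show False using \<open>z0 \<in> S\<close> by simp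
qed

text \<open>If \<open>F\<close> failed to be holomorphic somewhere, Baire's theorem would supply a portion of the
  closed exceptional set on which the difference quotients along the lines are uniformly bounded. Near it \<open>F\<close> is
  Lipschitz, hence holomorphic.\<close>

theorem directional_derivatives_imp_holomorphic_UNIV:
  assumes contF: "continuous_on UNIV F" and "open D"
    and dirs: "\<And>z. z \<in> D \<Longrightarrow> \<exists>c h1 h2. Im (cnj h1 * h2) \<noteq> 0 \<and>
      (\<forall>h\<in>{h1, h2}. ((\<lambda>t::real. (F (z + t *\<^sub>R h) - F z) /\<^sub>R t) \<longlongrightarrow> h * c) (at 0))"
  shows "F holomorphic_on D"
proof -
  define U where "U = (\<Union>W\<in>{W. open W \<and> F holomorphic_on W}. W)"
  have "open U" unfolding U_def by auto
  have holU: "F holomorphic_on U"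
    unfolding U_def by (rule holomorphic_on_UN_open) auto
  have in_U: "W \<subseteq> U" if "open W" "F holomorphic_on W" for W
    using that by (auto simp: U_def)
  have "D \<subseteq> U"
  proof (rule ccontr)
    assume "\<not> D \<subseteq> U"
    then obtain z0 where z0: "z0 \<in> D" "z0 \<notin> U" by blast
    then obtain \<rho> where "\<rho> > 0" and \<rho>: "cball z0 \<rho> \<subseteq> D"
      using \<open>open D\<close> open_contains_cball by blast
    define P where "P = - U"
    have "closed P" unfolding P_def using \<open>open U\<close> by (rule closed_Compl)
    \<comment> \<open>Slope zero: only a bound for the difference quotients is recorded here.\<close>
    define C where "C = (\<lambda>n. linear_on_lines F (1 / Suc n) (1 / Suc n) (real n) 0)"
    have cover: "P \<inter> ball z0 \<rho> \<subseteq> (\<Union>n. C n)"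
    proof
      fix z assume "z \<in> P \<inter> ball z0 \<rho>"
      then have "z \<in> D" using \<rho> by auto
      then obtain c h1 h2 where dir: "Im (cnj h1 * h2) \<noteq> 0"
          "((\<lambda>t::real. (F (z + t *\<^sub>R h1) - F z) /\<^sub>R t) \<longlongrightarrow> h1 * c) (at 0)"
          "((\<lambda>t::real. (F (z + t *\<^sub>R h2) - F z) /\<^sub>R t) \<longlongrightarrow> h2 * c) (at 0)"
        using dirs[of z] by blast
      obtain N M :: nat and x y :: rat where "z \<in> linear_on_lines F (1 / Suc N) (1 / Suc M)
          (1 / Suc N) (Complex (of_rat x) (of_rat y))"
        by (rule directional_derivatives_imp_linear_on_lines[OF dir zero_less_one])
      then obtain u v where uv: "cmod u = 1" "cmod v = 1" "1 / real (Suc N) \<le> \<bar>Im (cnj u * v)\<bar>"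
        and Fuv: "\<And>t. \<bar>t\<bar> \<le> 1 / real (Suc M) \<Longrightarrow>
          cmod (F (z + of_real t * u) - F z - Complex (of_rat x) (of_rat y) * (of_real t * u)) \<le> 1 / Suc N * \<bar>t\<bar> \<and>
          cmod (F (z + of_real t * v) - F z - Complex (of_rat x) (of_rat y) * (of_real t * v)) \<le> 1 / Suc N * \<bar>t\<bar>"
        unfolding linear_on_lines_def by blast
      define c' where "c' = Complex (of_rat x) (of_rat y)"
      define k where "k = nat \<lceil>1 + cmod c'\<rceil>"
      define n where "n = max N (max M k)"
      have k: "1 + cmod c' \<le> real n"
      proof -
        have "1 + cmod c' \<le> real k" unfolding k_def by (rule real_nat_ceiling_ge)
        also have "k \<le> n" by (simp add: n_def)
        finally show ?thesis by simp
      qed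
      have bound: "cmod (F (z + of_real t * w) - F z - 0 * (of_real t * w)) \<le> real n * \<bar>t\<bar>"
        if "cmod (F (z + of_real t * w) - F z - c' * (of_real t * w)) \<le> 1 / Suc N * \<bar>t\<bar>" "cmod w = 1" for t w
      proof -
        have "cmod (F (z + of_real t * w) - F z) \<le>
            cmod (F (z + of_real t * w) - F z - c' * (of_real t * w)) + cmod (c' * (of_real t * w))"
          by (metis diff_add_cancel norm_triangle_ineq)
        also have "\<dots> \<le> 1 * \<bar>t\<bar> + cmod c' * \<bar>t\<bar>"
          using that mult_right_mono[of "1 / real (Suc N)" 1 "\<bar>t\<bar>"]
          by (intro add_mono) (auto simp: norm_mult)
        also have "\<dots> = (1 + cmod c') * \<bar>t\<bar>" by (simp add: algebra_simps)
        also have "\<dots> \<le> real n * \<bar>t\<bar>" using k by (intro mult_right_mono) auto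
        finally show ?thesis by simp
      qed
      have "1 / real (Suc n) \<le> 1 / real (Suc N)" "1 / real (Suc n) \<le> 1 / real (Suc M)"
        by (simp_all add: n_def frac_le)
      then have "z \<in> C n"
        unfolding C_def linear_on_lines_def
        using uv Fuv[folded c'_def] bound by (intro CollectI exI[of _ u] exI[of _ v]) (meson order_trans)
      then show "z \<in> (\<Union>n. C n)" by blast
    qed
    obtain n w0 r0 where w0: "w0 \<in> P" "r0 > 0" "ball w0 r0 \<subseteq> ball z0 \<rho>" "P \<inter> ball w0 r0 \<subseteq> C n"
    proof (rule closed_cover_contains_portion[of z0 P \<rho> UNIV C])
      show "closed (C n)" for n
        unfolding C_def using contF by (rule closed_linear_on_lines)
    qed (use z0 \<open>\<rho> > 0\<close> \<open>closed P\<close> cover in \<open>auto simp: P_def\<close>)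
    define \<kappa> where "\<kappa> = 1 / real (Suc n)"
    have \<kappa>: "\<kappa> > 0" "\<kappa> \<le> 1" by (simp_all add: \<kappa>_def)
    define r where "r = min (r0 / 2) (\<kappa> * \<kappa> / 4)"
    have "0 < \<kappa> * \<kappa>" "\<kappa> * \<kappa> \<le> \<kappa>" using \<kappa> by (simp_all add: mult_left_le)
    moreover have "r \<le> r0 / 2" "r \<le> \<kappa> * \<kappa> / 4" "r > 0"
      using w0(2) \<kappa> by (auto simp: r_def)
    ultimately have r: "r > 0" "r \<le> r0 / 2" "r \<le> \<kappa> * \<kappa> / 4" "r \<le> \<kappa>" "r \<le> \<kappa> * \<kappa> / 2"
      by linarith+
    have "bounded (F ` cball w0 r0)"
      by (intro compact_imp_bounded compact_continuous_image continuous_on_subset[OF contF]) auto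
    then obtain B where B: "\<And>x. x \<in> cball w0 r0 \<Longrightarrow> cmod (F x) \<le> B"
      unfolding bounded_iff by blast
    have "B \<ge> 0" using B[of w0] w0(2) norm_ge_zero[of "F w0"] by (simp del: norm_ge_zero)
    define K where "K = 4 * real n / \<kappa> + 2 * B / r"
    have K1: "4 * real n / \<kappa> \<le> K" "2 * B / r \<le> K" "K \<ge> 0"
      using r(1) \<kappa>(1) \<open>B \<ge> 0\<close> by (simp_all add: K_def)
    have Kn: "real n \<le> K"
    proof -
      have "real n \<le> 4 * real n / \<kappa>"
        using \<kappa> mult_left_mono[of \<kappa> 4 "real n"] by (simp add: field_simps)
      then show ?thesis using K1(1) by linarith
    qed
    have lip: "cmod (F x - F w) \<le> K * cmod (x - w)"
      if w: "w \<in> P \<inter> ball w0 (r / 2)" and x: "x \<in> ball w0 (r / 2)" for w x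
    proof -
      have sub: "cball w r \<subseteq> ball w0 r0"
      proof
        fix y assume "y \<in> cball w r"
        then have "dist w0 y \<le> dist w0 w + r" using dist_triangle[of w0 y w] by simp
        then show "y \<in> ball w0 r0" using w r by simp
      qed
      have "w \<in> cball w r" using r(1) by simp
      then have wC: "w \<in> C n" using w sub w0(4) by blast
      then obtain u where u: "cmod u = 1" and Fu: "\<And>t. \<bar>t\<bar> \<le> \<kappa> \<Longrightarrow> cmod (F (w + of_real t * u) - F w) \<le> real n * \<bar>t\<bar>"
        unfolding C_def linear_on_lines_def \<kappa>_def by auto
      show ?thesis
      proof (rule lipschitz_at_point_via_half_discs[of F w r P u K])
        show "F holomorphic_on ball w r - P"
          using holU by (rule holomorphic_on_subset) (auto simp: P_def)
        show "open (ball w r - P)" using \<open>closed P\<close> by (intro open_Diff open_ball)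
        show "cmod (F (w + of_real t * u) - F w) \<le> K * \<bar>t\<bar>" if "\<bar>t\<bar> \<le> r" for t
          using Fu[of t] that r(4) mult_right_mono[OF Kn, of "\<bar>t\<bar>"] by linarith
        show "cmod (F y - F w) \<le> K * cmod (y - w)" if "y \<in> P" "y \<in> ball w r" for y
        proof -
          have "cmod (y - w) \<le> \<kappa> * \<kappa> / 2"
            using that(2) r(5) by (simp add: dist_norm norm_minus_commute)
          moreover have "y \<in> C n" using that sub w0(4) ball_subset_cball[of w r] by blast
          ultimately have "cmod (F y - F w - 0 * (y - w)) \<le> 4 * real n / \<kappa> * cmod (y - w)"
            using wC \<kappa> unfolding C_def \<kappa>_def[symmetric] by (intro linear_on_lines_imp_linear) auto
          also have "\<dots> \<le> K * cmod (y - w)" using K1(1) by (intro mult_right_mono) auto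
          finally show ?thesis by simp
        qed
        show "cmod (F y - F w) \<le> K * r" if "cmod (y - w) = r" for y
        proof -
          have "y \<in> cball w r" "w \<in> cball w r"
            using that r(1) by (simp_all add: dist_norm norm_minus_commute)
          then have "y \<in> cball w0 r0" "w \<in> cball w0 r0"
            using sub ball_subset_cball by blast+
          then have "cmod (F y - F w) \<le> 2 * B"
            using B[of y] B[of w] norm_triangle_ineq4[of "F y" "F w"] by linarith
          also have "\<dots> \<le> K * r" using K1(2) r(1) by (simp add: divide_le_eq)
          finally show ?thesis .
        qed
        show "x \<in> ball w r"
          using w x dist_triangle2[of w x w0] by (simp add: dist_commute)
      qed (use contF u r(1) K1(3) in auto)
    qed
    have "F holomorphic_on ball w0 (r / 2)"
    proof (rule holomorphic_if_lipschitz_and_directional[OF contF \<open>closed P\<close> _ K1(3) lip])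
      show "F holomorphic_on ball w0 (r / 2) - P"
        using holU by (rule holomorphic_on_subset) (auto simp: P_def)
      fix z assume z: "z \<in> P \<inter> ball w0 (r / 2)"
      then have "z \<in> ball w0 r0" using r by auto
      then have "z \<in> D" using w0(3) \<rho> ball_subset_cball[of z0 \<rho>] by blast
      then show "\<exists>c h1 h2. Im (cnj h1 * h2) \<noteq> 0 \<and>
          (\<forall>h\<in>{h1, h2}. ((\<lambda>t::real. (F (z + t *\<^sub>R h) - F z) /\<^sub>R t) \<longlongrightarrow> h * c) (at 0))"
        by (rule dirs)
    qed
    then have "ball w0 (r / 2) \<subseteq> U" by (intro in_U open_ball)
    moreover have "w0 \<in> ball w0 (r / 2)" using r(1) by simp
    ultimately show False using w0(1) unfolding P_def by blast
  qed
  then show ?thesis using holU holomorphic_on_subset by blast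
qed

text \<open>Menchoff's theorem. Locally \<open>F\<close> agrees with a continuous function on the whole plane,
  obtained by composition with the nearest-point map of a disc.\<close>

theorem directional_derivatives_imp_holomorphic:
  fixes F :: "complex \<Rightarrow> complex"
  assumes contF: "continuous_on D F" and "open D"
    and dirs: "\<And>z. z \<in> D \<Longrightarrow> \<exists>c h1 h2. Im (cnj h1 * h2) \<noteq> 0 \<and>
      (\<forall>h\<in>{h1, h2}. ((\<lambda>t::real. (F (z + t *\<^sub>R h) - F z) /\<^sub>R t) \<longlongrightarrow> h * c) (at 0))"
  shows "F holomorphic_on D"
proof -
  have "\<exists>r>0. F holomorphic_on ball z r" if "z \<in> D" for z
  proof -
    obtain r where "r > 0" and r: "cball z r \<subseteq> D"
      using \<open>open D\<close> \<open>z \<in> D\<close> by (meson open_contains_cball)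
    define G where "G = (\<lambda>w. F (closest_point (cball z r) w))"
    have GF: "G w = F w" if "w \<in> ball z r" for w
      using that by (simp add: G_def closest_point_self)
    have "G holomorphic_on ball z r"
    proof (rule directional_derivatives_imp_holomorphic_UNIV)
      show "continuous_on UNIV G"
        unfolding G_def using \<open>r > 0\<close> r closest_point_in_set[of "cball z r"]
        by (intro continuous_on_compose2[OF contF] continuous_on_closest_point) auto
      fix w assume w: "w \<in> ball z r"
      then obtain c h1 h2 where c: "Im (cnj h1 * h2) \<noteq> 0"
          "\<And>h. h \<in> {h1, h2} \<Longrightarrow> ((\<lambda>t::real. (F (w + t *\<^sub>R h) - F w) /\<^sub>R t) \<longlongrightarrow> h * c) (at 0)"
        using dirs[of w] r by (meson ball_subset_cball subsetD)
      have "((\<lambda>t::real. (G (w + t *\<^sub>R h) - G w) /\<^sub>R t) \<longlongrightarrow> h * c) (at 0)" if "h \<in> {h1, h2}" for h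
      proof (rule Lim_transform_eventually[OF c(2)[OF that]])
        have "((\<lambda>t::real. w + t *\<^sub>R h) \<longlongrightarrow> w + 0 *\<^sub>R h) (at 0)"
          by (intro tendsto_intros)
        then have "\<forall>\<^sub>F t::real in at 0. w + t *\<^sub>R h \<in> ball z r"
          using w by (intro topological_tendstoD) auto
        then show "\<forall>\<^sub>F t::real in at 0. (F (w + t *\<^sub>R h) - F w) /\<^sub>R t = (G (w + t *\<^sub>R h) - G w) /\<^sub>R t"
          by eventually_elim (simp add: GF w del: mem_ball)
      qed
      then show "\<exists>c h1 h2. Im (cnj h1 * h2) \<noteq> 0 \<and>
          (\<forall>h\<in>{h1, h2}. ((\<lambda>t::real. (G (w + t *\<^sub>R h) - G w) /\<^sub>R t) \<longlongrightarrow> h * c) (at 0))"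
        using c(1) by blast
    qed simp
    then show ?thesis using holomorphic_cong[OF refl, of "ball z r" G F] GF \<open>r > 0\<close> by blast
  qed
  then have "F field_differentiable at z within D" if "z \<in> D" for z
    using that by (meson centre_in_ball field_differentiable_at_within holomorphic_on_imp_differentiable_at open_ball)
  then show ?thesis by (simp add: holomorphic_on_def)
qed

section \<open>Integrals of holomorphic functions along rectifiable curves\<close>

text \<open>The scalar version of \<^const>\<open>has_line_integral\<close>.\<close>

definition has_stieltjes_integral :: "(complex \<Rightarrow> complex) \<Rightarrow> complex \<Rightarrow> (real \<Rightarrow> complex) \<Rightarrow> bool" where
  "has_stieltjes_integral g I \<gamma> \<longleftrightarrow>
     (\<forall>\<epsilon>>0. \<exists>\<delta>>0. \<forall>p. p tagged_division_of {0..1} \<and> (\<forall>(t, K)\<in>p. Sup K - Inf K < \<delta>) \<longrightarrow>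
        cmod ((\<Sum>(t, K)\<in>p. g (\<gamma> t) * (\<gamma> (Sup K) - \<gamma> (Inf K))) - I) < \<epsilon>)"

text \<open>As convergence along the filter of fine tagged divisions, the integral inherits the
  limit laws.\<close>

lemma has_stieltjes_integral_iff_tendsto:
  "has_stieltjes_integral g I \<gamma> \<longleftrightarrow>
    ((\<lambda>p. \<Sum>(t, K)\<in>p. g (\<gamma> t) * (\<gamma> (Sup K) - \<gamma> (Inf K))) \<longlongrightarrow> I)
      (INF \<delta>\<in>{0<..}. principal {p. p tagged_division_of {0..1} \<and> (\<forall>(t, K)\<in>p. Sup K - Inf K < \<delta>)})"
proof -
  have ev: "eventually P (INF \<delta>\<in>{0<..}. principal {p. p tagged_division_of {0..1} \<and> (\<forall>(t, K)\<in>p. Sup K - Inf K < \<delta>)})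
    \<longleftrightarrow> (\<exists>\<delta>>0. \<forall>p. p tagged_division_of {0..1::real} \<and> (\<forall>(t, K)\<in>p. Sup K - Inf K < \<delta>) \<longrightarrow> P p)" for P
  proof (subst eventually_INF_base)
    fix a b :: real assume "a \<in> {0<..}" "b \<in> {0<..}"
    then show "\<exists>x\<in>{0<..}. principal {p. p tagged_division_of {0..1} \<and> (\<forall>(t, K)\<in>p. Sup K - Inf K < x)}
        \<le> inf (principal {p. p tagged_division_of {0..1} \<and> (\<forall>(t, K)\<in>p. Sup K - Inf K < a)})
            (principal {p. p tagged_division_of {0..1} \<and> (\<forall>(t, K)\<in>p. Sup K - Inf K < b)})"
      by (intro bexI[of _ "min a b"]) (auto split: prod.splits)
  qed (auto simp: eventually_principal)
  show ?thesis
    unfolding tendsto_iff ev dist_norm has_stieltjes_integral_def ..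
qed

lemma has_stieltjes_integral_add:
  assumes "has_stieltjes_integral g I \<gamma>" "has_stieltjes_integral h J \<gamma>"
  shows "has_stieltjes_integral (\<lambda>x. g x + h x) (I + J) \<gamma>"
  using tendsto_add[OF assms[unfolded has_stieltjes_integral_iff_tendsto]]
  unfolding has_stieltjes_integral_iff_tendsto
  by (simp add: case_prod_unfold sum.distrib[symmetric] distrib_right)

lemma has_stieltjes_integral_cmult:
  assumes "has_stieltjes_integral g I \<gamma>"
  shows "has_stieltjes_integral (\<lambda>x. c * g x) (c * I) \<gamma>"
  using tendsto_mult_left[OF assms[unfolded has_stieltjes_integral_iff_tendsto], of c]
  unfolding has_stieltjes_integral_iff_tendsto
  by (simp add: case_prod_unfold sum_distrib_left mult.assoc)

lemma rectifiable_path_sum_bound: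
  assumes "rectifiable_path \<gamma>"
  obtains B where "B > 0" "\<And>p. p tagged_division_of {0..1} \<Longrightarrow>
    (\<Sum>(t, K)\<in>p. cmod (\<gamma> (Sup K) - \<gamma> (Inf K))) \<le> B"
proof -
  obtain B where B: "\<And>d. d division_of {0..1} \<Longrightarrow> (\<Sum>K\<in>d. cmod (\<gamma> (Sup K) - \<gamma> (Inf K))) \<le> B"
    using assms unfolding rectifiable_path_def by blast
  have "(\<Sum>(t, K)\<in>p. cmod (\<gamma> (Sup K) - \<gamma> (Inf K))) \<le> max B 1" if p: "p tagged_division_of {0..1}" for p
  proof -
    \<comment> \<open>For the empty interval \<open>Sup\<close> and \<open>Inf\<close> are unspecified.\<close>
    define jump where "jump = (\<lambda>K. if K = {} then 0 else cmod (\<gamma> (Sup K) - \<gamma> (Inf K)))"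
    have "(\<Sum>(t, K)\<in>p. cmod (\<gamma> (Sup K) - \<gamma> (Inf K))) = (\<Sum>(t, K)\<in>p. jump K)"
      by (intro sum.cong refl) (auto simp: jump_def dest: tagged_division_ofD(2)[OF p])
    also have "\<dots> = (\<Sum>K\<in>snd ` p. jump K)"
    proof (rule sum.over_tagged_division_lemma[OF p])
      fix u v :: real assume "box u v = {}"
      then have "u \<ge> v" by simp
      then consider "u = v" | "v < u" by force
      then show "jump (cbox u v) = 0"
        by cases (simp_all add: jump_def)
    qed
    also have "\<dots> = (\<Sum>K\<in>snd ` p. cmod (\<gamma> (Sup K) - \<gamma> (Inf K)))"
      using division_ofD(3)[OF division_of_tagged_division[OF p]]
      by (intro sum.cong refl) (auto simp: jump_def)
    also have "\<dots> \<le> B"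
      using B[OF division_of_tagged_division[OF p]] .
    finally show ?thesis by simp
  qed
  then show ?thesis using that[of "max B 1"] by simp
qed

text \<open>The function \<open>\<Theta> t\<close>, the integral along \<open>q\<close> up to \<open>q t\<close> and back to \<open>\<gamma> t\<close> on a segment, serves as
  a primitive of \<open>g\<close> along \<open>\<gamma>\<close>: over a short interval it increases like a local primitive of \<open>g\<close>. Therefore
  the Riemann--Stieltjes sums differ from the telescoping sums of its increments
  by at most \<open>e\<close> times the length of \<open>\<gamma>\<close>.\<close>

lemma stieltjes_integral_eq_contour_integral_nearby:
  assumes rect: "rectifiable_path \<gamma>" and "open S" and hol: "g holomorphic_on S" and sub: "path_image \<gamma> \<subseteq> S"
  obtains d where "d > 0" "\<And>q. \<lbrakk>valid_path q; pathstart q = pathstart \<gamma>; pathfinish q = pathfinish \<gamma>;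
      \<And>t. t \<in> {0..1} \<Longrightarrow> cmod (q t - \<gamma> t) < d\<rbrakk> \<Longrightarrow>
    path_image q \<subseteq> S \<and> has_stieltjes_integral g (contour_integral q g) \<gamma>"
proof -
  have "path \<gamma>" using rect by (simp add: rectifiable_path_def)
  then have compact: "compact (path_image \<gamma>)" and cont: "continuous_on {0..1} \<gamma>"
    by (simp_all add: compact_path_image path_def)
  obtain r where "r > 0" and r: "(\<Union>x\<in>path_image \<gamma>. cball x r) \<subseteq> S"
    using compact_subset_open_imp_cball_epsilon_subset[OF compact \<open>open S\<close> sub] .
  have in_S: "x \<in> S" if "t \<in> {0..1}" "cmod (x - \<gamma> t) \<le> r" for x t
  proof -
    have "\<gamma> t \<in> path_image \<gamma>" "x \<in> cball (\<gamma> t) r"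
      using that by (auto simp: path_image_def dist_norm norm_minus_commute)
    then show ?thesis using r by blast
  qed
  define N where "N = {x + y |x y. x \<in> path_image \<gamma> \<and> y \<in> cball 0 r}"
  have "compact N" unfolding N_def by (intro compact_sums compact compact_cball)
  moreover have "N \<subseteq> S" using r by (force simp: N_def dist_norm)
  ultimately have ucont_g: "uniformly_continuous_on N g"
    using hol holomorphic_on_imp_continuous_on continuous_on_subset compact_uniformly_continuous by blast
  have ucont_\<gamma>: "uniformly_continuous_on {0..1} \<gamma>"
    using cont compact_uniformly_continuous by blast
  obtain B where "B > 0" and B: "\<And>p. p tagged_division_of {0..1} \<Longrightarrow>
      (\<Sum>(t, K)\<in>p. cmod (\<gamma> (Sup K) - \<gamma> (Inf K))) \<le> B"
    using rectifiable_path_sum_bound[OF rect] by blast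
  have main: "path_image q \<subseteq> S \<and> has_stieltjes_integral g (contour_integral q g) \<gamma>"
    if q: "valid_path q" "pathstart q = pathstart \<gamma>" "pathfinish q = pathfinish \<gamma>"
      and near: "\<And>t. t \<in> {0..1} \<Longrightarrow> cmod (q t - \<gamma> t) < r / 2" for q
  proof
    show qS: "path_image q \<subseteq> S"
      using near in_S \<open>r > 0\<close> by (fastforce simp: path_image_def)
    have int: "g contour_integrable_on q"
      using contour_integrable_holomorphic_simple hol \<open>open S\<close> q(1) qS by blast
    \<comment> \<open>At the end points \<open>q\<close> and \<open>\<gamma>\<close> agree, so the segments contribute nothing to the total increment.\<close>
    define \<Theta> where "\<Theta> = (\<lambda>t. contour_integral (subpath 0 t q) g - contour_integral (linepath (\<gamma> t) (q t)) g)"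
    have \<Theta>_total: "\<Theta> 1 - \<Theta> 0 = contour_integral q g"
      using q by (simp add: \<Theta>_def pathstart_def pathfinish_def)
    have ends: "\<Theta> v - \<Theta> u = contour_integral (linepath (\<gamma> u) (\<gamma> v)) g"
      if uv: "0 \<le> u" "u \<le> v" "v \<le> 1" and close: "\<And>t. t \<in> {u..v} \<Longrightarrow> cmod (\<gamma> t - \<gamma> u) < r / 2" for u v
    proof -
      define b where "b = ball (\<gamma> u) r"
      have "b \<subseteq> S" unfolding b_def using uv in_S by (force simp: dist_norm norm_minus_commute)
      have "convex b" "open b" by (simp_all add: b_def)
      obtain G where G: "\<And>x. x \<in> b \<Longrightarrow> (G has_field_derivative g x) (at x within b)"
        using holomorphic_convex_primitive'[OF \<open>convex b\<close> \<open>open b\<close> holomorphic_on_subset[OF hol \<open>b \<subseteq> S\<close>]] by blast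
      have \<gamma>b: "\<gamma> t \<in> b" if "t \<in> {u..v}" for t
        using close[OF that] \<open>r > 0\<close> by (simp add: b_def dist_norm norm_minus_commute)
      have qb: "q t \<in> b" if "t \<in> {u..v}" for t
      proof -
        have "cmod (q t - \<gamma> u) \<le> cmod (q t - \<gamma> t) + cmod (\<gamma> t - \<gamma> u)"
          by (metis diff_add_cancel diff_add_eq norm_triangle_ineq add_diff_eq)
        also have "\<dots> < r" using close[OF that] near[of t] that uv by simp
        finally show ?thesis by (simp add: b_def dist_norm norm_minus_commute)
      qed
      have line: "contour_integral (linepath x y) g = G y - G x" if "x \<in> b" "y \<in> b" for x y
      proof -
        have "path_image (linepath x y) \<subseteq> b"
          using that \<open>convex b\<close> by (simp add: closed_segment_subset)
        from contour_integral_unique[OF contour_integral_primitive[OF G valid_path_linepath this]]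
        show ?thesis by simp
      qed
      have "contour_integral (subpath u v q) g = G (q v) - G (q u)"
      proof -
        have "valid_path (subpath u v q)" using q(1) uv by (intro valid_path_subpath) auto
        moreover have "path_image (subpath u v q) \<subseteq> b"
          using qb uv by (auto simp: path_image_subpath)
        ultimately show ?thesis
          using contour_integral_unique[OF contour_integral_primitive[OF G]] by (simp add: pathstart_def pathfinish_def subpath_def)
      qed
      moreover have "contour_integral (subpath 0 u q) g + contour_integral (subpath u v q) g =
          contour_integral (subpath 0 v q) g"
        using uv by (intro contour_integral_subpath_combine int q(1)) auto
      ultimately have "contour_integral (subpath 0 v q) g =
          contour_integral (subpath 0 u q) g + (G (q v) - G (q u))"
        by simp
      then show ?thesis
        using \<gamma>b[of u] \<gamma>b[of v] qb[of u] qb[of v] uv by (simp add: \<Theta>_def line)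
    qed
    show "has_stieltjes_integral g (contour_integral q g) \<gamma>"
      unfolding has_stieltjes_integral_def
    proof (intro allI impI)
      fix \<epsilon> :: real assume "\<epsilon> > 0"
      define e where "e = \<epsilon> / (2 * B)"
      have "e > 0" using \<open>\<epsilon> > 0\<close> \<open>B > 0\<close> by (simp add: e_def)
      obtain \<rho> where "\<rho> > 0" and \<rho>: "\<And>x y. \<lbrakk>x \<in> N; y \<in> N; dist y x < \<rho>\<rbrakk> \<Longrightarrow> dist (g y) (g x) < e"
        using ucont_g \<open>e > 0\<close> unfolding uniformly_continuous_on_def by blast
      obtain \<delta> where "\<delta> > 0" and \<delta>: "\<And>s t. \<lbrakk>s \<in> {0..1}; t \<in> {0..1}; dist t s < \<delta>\<rbrakk> \<Longrightarrow>
          dist (\<gamma> t) (\<gamma> s) < min \<rho> (r / 2)"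
        using ucont_\<gamma> \<open>\<rho> > 0\<close> \<open>r > 0\<close> unfolding uniformly_continuous_on_def
        by (metis half_gt_zero min_less_iff_conj)
      have "cmod ((\<Sum>(t, K)\<in>p. g (\<gamma> t) * (\<gamma> (Sup K) - \<gamma> (Inf K))) - contour_integral q g) < \<epsilon>"
        if p: "p tagged_division_of {0..1}" and fine: "\<And>t K. (t, K) \<in> p \<Longrightarrow> Sup K - Inf K < \<delta>" for p
      proof -
        have piece: "cmod (g (\<gamma> t) * (\<gamma> (Sup K) - \<gamma> (Inf K)) - (\<Theta> (Sup K) - \<Theta> (Inf K))) \<le>
            e * cmod (\<gamma> (Sup K) - \<gamma> (Inf K))" if tK: "(t, K) \<in> p" for t K
        proof -
          obtain u v where K: "K = {u..v}"
            using tagged_division_ofD(4)[OF p tK] by (auto simp: cbox_interval)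
          have t: "t \<in> {u..v}" and K01: "{u..v} \<subseteq> {0..1}"
            using tagged_division_ofD(2,3)[OF p tK] K by auto
          then have uv: "0 \<le> u" "u \<le> v" "v \<le> 1" by auto
          then have SI: "Sup K = v" "Inf K = u" by (simp_all add: K)
          have short: "v - u < \<delta>" using fine[OF tK] SI by simp
          have close: "cmod (\<gamma> s - \<gamma> s') < min \<rho> (r / 2)" if "s \<in> {u..v}" "s' \<in> {u..v}" for s s'
          proof -
            have "dist s s' < \<delta>" using that short by (auto simp: dist_real_def)
            then show ?thesis using \<delta>[of s' s] that K01 by (auto simp: dist_norm)
          qed
          define h where "h = (\<lambda>x. g x - g (\<gamma> t))"
          have seg: "cmod (x - \<gamma> t) < min \<rho> (r / 2)" if "x \<in> closed_segment (\<gamma> u) (\<gamma> v)" for x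
          proof -
            have "closed_segment (\<gamma> u) (\<gamma> v) \<subseteq> ball (\<gamma> t) (min \<rho> (r / 2))"
              using close[of u t] close[of v t] t uv
              by (intro closed_segment_subset) (auto simp: dist_norm norm_minus_commute)
            then show ?thesis using that by (auto simp: dist_norm norm_minus_commute)
          qed
          have "t \<in> {0..1}" using t K01 by blast
          have segS: "closed_segment (\<gamma> u) (\<gamma> v) \<subseteq> S"
            using seg in_S[OF \<open>t \<in> {0..1}\<close>] \<open>r > 0\<close> by fastforce
          have "g contour_integrable_on linepath (\<gamma> u) (\<gamma> v)"
            using hol segS holomorphic_on_imp_continuous_on continuous_on_subset
            by (blast intro: contour_integrable_continuous_linepath)
          then have g_int: "(g has_contour_integral (\<Theta> v - \<Theta> u)) (linepath (\<gamma> u) (\<gamma> v))"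
            using ends[OF uv] close uv by (simp add: has_contour_integral_integral)
          have h_int: "(h has_contour_integral (\<Theta> v - \<Theta> u) - g (\<gamma> t) * (\<gamma> v - \<gamma> u)) (linepath (\<gamma> u) (\<gamma> v))"
            unfolding h_def by (intro has_contour_integral_diff g_int has_contour_integral_const_linepath)
          have "cmod ((\<Theta> v - \<Theta> u) - g (\<gamma> t) * (\<gamma> v - \<gamma> u)) \<le> e * cmod (\<gamma> v - \<gamma> u)"
          proof (rule has_contour_integral_bound_linepath[OF h_int])
            fix x assume x: "x \<in> closed_segment (\<gamma> u) (\<gamma> v)"
            have "\<gamma> t \<in> path_image \<gamma>" "x - \<gamma> t \<in> cball 0 r" "0 \<in> cball (0::complex) r"
              using seg[OF x] \<open>t \<in> {0..1}\<close> \<open>r > 0\<close> by (auto simp: path_image_def)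
            then have "\<gamma> t + (x - \<gamma> t) \<in> N" "\<gamma> t + 0 \<in> N"
              unfolding N_def by blast+
            then show "cmod (h x) \<le> e"
              using \<rho>[of "\<gamma> t" x] seg[OF x] by (simp add: h_def dist_norm)
          qed (use \<open>e > 0\<close> in simp)
          then show ?thesis by (simp add: SI norm_minus_commute)
        qed
        have "(\<Sum>(t, K)\<in>p. \<Theta> (Sup K) - \<Theta> (Inf K)) = contour_integral q g"
          using additive_tagged_division_1[OF _ p, of \<Theta>] \<Theta>_total by simp
        then have "(\<Sum>(t, K)\<in>p. g (\<gamma> t) * (\<gamma> (Sup K) - \<gamma> (Inf K))) - contour_integral q g =
            (\<Sum>(t, K)\<in>p. g (\<gamma> t) * (\<gamma> (Sup K) - \<gamma> (Inf K)) - (\<Theta> (Sup K) - \<Theta> (Inf K)))"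
          by (simp add: case_prod_unfold sum_subtractf)
        also have "cmod \<dots> \<le> (\<Sum>(t, K)\<in>p. e * cmod (\<gamma> (Sup K) - \<gamma> (Inf K)))"
          using piece by (intro sum_norm_le) auto
        also have "\<dots> = e * (\<Sum>(t, K)\<in>p. cmod (\<gamma> (Sup K) - \<gamma> (Inf K)))"
          by (simp add: case_prod_unfold sum_distrib_left)
        also have "\<dots> \<le> e * B" using B[OF p] \<open>e > 0\<close> by (intro mult_left_mono) auto
        also have "\<dots> < \<epsilon>" using \<open>\<epsilon> > 0\<close> \<open>B > 0\<close> by (simp add: e_def)
        finally show ?thesis .
      qed
      then show "\<exists>\<delta>>0. \<forall>p. p tagged_division_of {0..1} \<and> (\<forall>(t, K)\<in>p. Sup K - Inf K < \<delta>) \<longrightarrow>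
          cmod ((\<Sum>(t, K)\<in>p. g (\<gamma> t) * (\<gamma> (Sup K) - \<gamma> (Inf K))) - contour_integral q g) < \<epsilon>"
        using \<open>\<delta> > 0\<close> by (intro exI[of _ \<delta>]) blast
    qed
  qed
  show ?thesis
    by (rule that[of "r / 2"]) (use \<open>r > 0\<close> main in auto)
qed

text \<open>A polynomial curve close to \<open>\<gamma>\<close> has the same winding numbers about \<open>z\<close> and about the points outside \<open>D\<close>,
  so that the residue theorem evaluates its integral.\<close>

lemma cauchy_formula_rectifiable:
  assumes "open D" "connected D" and hol: "F holomorphic_on D" and \<gamma>: "pos_jordan_rectifiable \<gamma>"
    and sub: "path_image \<gamma> \<subseteq> D" "inside (path_image \<gamma>) \<subseteq> D" and z: "z \<in> inside (path_image \<gamma>)"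
  shows "has_stieltjes_integral (\<lambda>\<xi>. F \<xi> / (\<xi> - z) ^ Suc k)
    (2 * of_real pi * \<i> * ((deriv ^^ k) F z / fact k)) \<gamma>"
proof -
  have rect: "rectifiable_path \<gamma>" and loop: "pathfinish \<gamma> = pathstart \<gamma>" and wind: "winding_number \<gamma> z = 1"
    using \<gamma> z by (auto simp: pos_jordan_rectifiable_def)
  have "path \<gamma>" using rect by (simp add: rectifiable_path_def)
  have "z \<in> D" using z sub by blast
  define g where "g = (\<lambda>\<xi>. F \<xi> / (\<xi> - z) ^ Suc k)"
  have holg: "g holomorphic_on D - {z}"
    unfolding g_def by (intro holomorphic_intros holomorphic_on_subset[OF hol]) auto
  have opn: "open (D - {z})" using \<open>open D\<close> by (rule open_delete)
  have sub': "path_image \<gamma> \<subseteq> D - {z}"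
    using sub(1) z inside_no_overlap[of "path_image \<gamma>"] by blast
  obtain d where "d > 0" and d: "\<And>q. \<lbrakk>valid_path q; pathstart q = pathstart \<gamma>; pathfinish q = pathfinish \<gamma>;
      \<And>t. t \<in> {0..1} \<Longrightarrow> cmod (q t - \<gamma> t) < d\<rbrakk> \<Longrightarrow>
    path_image q \<subseteq> D - {z} \<and> has_stieltjes_integral g (contour_integral q g) \<gamma>"
    using stieltjes_integral_eq_contour_integral_nearby[OF rect opn holg sub'] by blast
  obtain r where "r > 0" and r: "(\<Union>x\<in>path_image \<gamma>. cball x r) \<subseteq> D - {z}"
    using compact_subset_open_imp_cball_epsilon_subset[OF compact_path_image[OF \<open>path \<gamma>\<close>] opn sub'] .
  have "0 < min d r" using \<open>d > 0\<close> \<open>r > 0\<close> by simp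
  then obtain q where poly: "polynomial_function q" and q: "pathstart q = pathstart \<gamma>" "pathfinish q = pathfinish \<gamma>"
      and near: "\<And>t. t \<in> {0..1} \<Longrightarrow> cmod (q t - \<gamma> t) < min d r"
    using path_approx_polynomial_function[OF \<open>path \<gamma>\<close>] by blast
  have "valid_path q" using poly by (rule valid_path_polynomial_function)
  then have qD: "path_image q \<subseteq> D - {z}" and int: "has_stieltjes_integral g (contour_integral q g) \<gamma>"
    using d[of q] q near by auto
  have wind_q: "winding_number q w = winding_number \<gamma> w" if "w \<notin> D - {z}" for w
  proof (rule winding_number_nearby_loops_eq)
    fix t :: real assume t: "t \<in> {0..1}"
    have "\<gamma> t \<in> path_image \<gamma>" using t by (simp add: path_image_def)
    then have "w \<notin> cball (\<gamma> t) r" using that r by blast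
    then show "cmod (q t - \<gamma> t) < cmod (\<gamma> t - w)"
      using near[OF t] by (simp add: dist_norm)
  qed (use \<open>path \<gamma>\<close> \<open>valid_path q\<close> valid_path_imp_path loop q in auto)
  have outside: "winding_number q w = 0" if "w \<notin> D" for w
  proof -
    have "w \<in> outside (path_image \<gamma>)"
      using that sub inside_Un_outside[of "path_image \<gamma>"] by blast
    then show ?thesis
      using wind_q[of w] that winding_number_zero_in_outside[OF \<open>path \<gamma>\<close> loop] by auto
  qed
  have "contour_integral q g = 2 * pi * \<i> * (\<Sum>p\<in>{z}. winding_number q p * residue g p)"
  proof (rule Residue_theorem[OF \<open>open D\<close> \<open>connected D\<close> _ holg \<open>valid_path q\<close> _ qD])
    show "pathfinish q = pathstart q" using q loop by simp
  qed (use outside in auto)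
  also have "\<dots> = 2 * of_real pi * \<i> * ((deriv ^^ k) F z / fact k)"
    using residue_holomorphic_over_power[OF \<open>open D\<close> \<open>z \<in> D\<close> hol] wind_q[of z] wind
    by (simp add: g_def)
  finally show ?thesis using int by (simp add: g_def)
qed

section \<open>Calculus in the algebra\<close>

lemma coeff_simps [simp]:
  "coeff0 (0::a3) = 0" "coeff1 (0::a3) = 0" "coeff2 (0::a3) = 0"
  "coeff0 (x + y) = coeff0 x + coeff0 y" "coeff1 (x + y) = coeff1 x + coeff1 y" "coeff2 (x + y) = coeff2 x + coeff2 y"
  "coeff0 (x - y) = coeff0 x - coeff0 y" "coeff1 (x - y) = coeff1 x - coeff1 y" "coeff2 (x - y) = coeff2 x - coeff2 y"
  "coeff0 (r *\<^sub>R x) = r *\<^sub>R coeff0 x" "coeff1 (r *\<^sub>R x) = r *\<^sub>R coeff1 x" "coeff2 (r *\<^sub>R x) = r *\<^sub>R coeff2 x"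
  "coeff0 (x * y) = coeff0 x * coeff0 y"
  "coeff1 (x * y) = coeff0 x * coeff1 y + coeff1 x * coeff0 y"
  "coeff2 (x * y) = coeff0 x * coeff2 y + coeff1 x * coeff1 y + coeff2 x * coeff0 y"
  by (simp_all add: zero_a3_def plus_a3_def minus_a3_def scaleR_a3_def times_a3_def)

lemma coeff_of_cpx_rho [simp]:
  "coeff0 (of_cpx a) = a" "coeff1 (of_cpx a) = 0" "coeff2 (of_cpx a) = 0"
  "coeff0 rho = 0" "coeff1 rho = 1" "coeff2 rho = 0"
  "coeff0 (rho\<^sup>2) = 0" "coeff1 (rho\<^sup>2) = 0" "coeff2 (rho\<^sup>2) = 1"
  by (simp_all add: of_cpx_def rho_def power2_eq_square)

lemma norm_coeff_le:
  "cmod (coeff0 x) \<le> norm x" "cmod (coeff1 x) \<le> norm x" "cmod (coeff2 x) \<le> norm x"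
  unfolding norm_a3_def by (intro real_le_rsqrt; simp)+

lemma norm_A3_le: "norm (A3 a b c) \<le> cmod a + cmod b + cmod c"
  unfolding norm_a3_def by (intro real_le_lsqrt) (auto simp: power2_eq_square algebra_simps)

lemma bounded_linear_coeff:
  "bounded_linear coeff0" "bounded_linear coeff1" "bounded_linear coeff2"
  by (rule bounded_linear_intro[where K = 1]; simp add: norm_coeff_le)+

lemma bounded_linear_A3:
  "bounded_linear (\<lambda>a. A3 a 0 0)" "bounded_linear (\<lambda>a. A3 0 a 0)" "bounded_linear (\<lambda>a. A3 0 0 a)"
  by (rule bounded_linear_intro[where K = 1];
      simp add: plus_a3_def scaleR_a3_def norm_A3_le[THEN order_trans])+

lemma A3_split: "A3 a b c = A3 a 0 0 + A3 0 b 0 + A3 0 0 c"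
  by (simp add: plus_a3_def)

lemma has_derivative_A3:
  assumes "(f has_derivative f') F" "(g has_derivative g') F" "(h has_derivative h') F"
  shows "((\<lambda>x. A3 (f x) (g x) (h x)) has_derivative (\<lambda>x. A3 (f' x) (g' x) (h' x))) F"
  by (subst A3_split, subst (2) A3_split)
    (intro has_derivative_add bounded_linear.has_derivative[OF bounded_linear_A3(1)]
      bounded_linear.has_derivative[OF bounded_linear_A3(2)]
      bounded_linear.has_derivative[OF bounded_linear_A3(3)] assms)

lemma bounded_linear_a3_mult: "bounded_linear (\<lambda>x::a3. c * x)"
proof -
  have "(\<lambda>x. A3 (coeff0 c * coeff0 x) (coeff0 c * coeff1 x + coeff1 c * coeff0 x)
      (coeff0 c * coeff2 x + coeff1 c * coeff1 x + coeff2 c * coeff0 x)) = (\<lambda>x. c * x)"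
    by (simp add: times_a3_def)
  moreover have "((\<lambda>x. A3 (coeff0 c * coeff0 x) (coeff0 c * coeff1 x + coeff1 c * coeff0 x)
      (coeff0 c * coeff2 x + coeff1 c * coeff1 x + coeff2 c * coeff0 x)) has_derivative
    (\<lambda>x. A3 (coeff0 c * coeff0 x) (coeff0 c * coeff1 x + coeff1 c * coeff0 x)
      (coeff0 c * coeff2 x + coeff1 c * coeff1 x + coeff2 c * coeff0 x))) (at 0)"
    by (intro has_derivative_A3 has_derivative_add has_derivative_mult_right
        bounded_linear_imp_has_derivative bounded_linear_coeff)
  ultimately show ?thesis using has_derivative_bounded_linear by metis
qed

text \<open>The geometric series of \<open>1 / (w - a \<rho> - b \<rho>\<^sup>2)\<close> stops after the square of
  the nilpotent part.\<close>

lemma a3_inverse_resolvent: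
  assumes "coeff0 \<zeta> \<noteq> \<xi>"
  shows "inverse (of_cpx \<xi> - \<zeta>) = A3 (1 / (\<xi> - coeff0 \<zeta>)) (coeff1 \<zeta> / (\<xi> - coeff0 \<zeta>)\<^sup>2)
    (coeff2 \<zeta> / (\<xi> - coeff0 \<zeta>)\<^sup>2 + (coeff1 \<zeta>)\<^sup>2 / (\<xi> - coeff0 \<zeta>) ^ 3)" (is "_ = ?R")
proof -
  have nz: "\<xi> - coeff0 \<zeta> \<noteq> 0" using assms by simp
  have "(of_cpx \<xi> - \<zeta>) * ?R = 1"
  proof -
    define w a b where "w = \<xi> - coeff0 \<zeta>" and "a = coeff1 \<zeta>" and "b = coeff2 \<zeta>"
    have "w \<noteq> 0" using nz by (simp add: w_def)
    then have "w * (a / w\<^sup>2) + (- a) * (1 / w) = 0"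
      "w * (b / w\<^sup>2 + a\<^sup>2 / w ^ 3) + (- a) * (a / w\<^sup>2) + (- b) * (1 / w) = 0"
      by (simp_all add: power2_eq_square power3_eq_cube distrib_left)
    then show ?thesis
      using \<open>w \<noteq> 0\<close> unfolding a3_eq_iff w_def a_def b_def by (simp add: one_a3_def)
  qed
  moreover have "(of_cpx \<xi> - \<zeta>) * inverse (of_cpx \<xi> - \<zeta>) = 1"
    using nz by (intro a3_inverse_right) simp
  moreover have "y = y'" if "x * y = 1" "x * y' = 1" for x y y' :: a3
    using that by (metis mult.assoc mult.commute mult_1)
  ultimately show ?thesis by blast
qed

lemma has_line_integral_coeffs:
  assumes "has_stieltjes_integral (\<lambda>\<xi>. coeff0 (g \<xi>)) a \<gamma>" "has_stieltjes_integral (\<lambda>\<xi>. coeff1 (g \<xi>)) b \<gamma>"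
    "has_stieltjes_integral (\<lambda>\<xi>. coeff2 (g \<xi>)) c \<gamma>"
  shows "has_line_integral g (A3 a b c) \<gamma>"
  unfolding has_line_integral_def
proof (intro allI impI)
  fix \<epsilon> :: real assume "\<epsilon> > 0"
  then have e: "\<epsilon> / 3 > 0" by simp
  let ?S = "\<lambda>p. \<Sum>(t, K)\<in>p. g (\<gamma> t) * of_cpx (\<gamma> (Sup K) - \<gamma> (Inf K))"
  have S: "coeff0 (?S p) = (\<Sum>(t, K)\<in>p. coeff0 (g (\<gamma> t)) * (\<gamma> (Sup K) - \<gamma> (Inf K)))"
    "coeff1 (?S p) = (\<Sum>(t, K)\<in>p. coeff1 (g (\<gamma> t)) * (\<gamma> (Sup K) - \<gamma> (Inf K)))"
    "coeff2 (?S p) = (\<Sum>(t, K)\<in>p. coeff2 (g (\<gamma> t)) * (\<gamma> (Sup K) - \<gamma> (Inf K)))" for p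
    by (simp_all add: linear_sum[OF bounded_linear.linear[OF bounded_linear_coeff(1)]]
        linear_sum[OF bounded_linear.linear[OF bounded_linear_coeff(2)]]
        linear_sum[OF bounded_linear.linear[OF bounded_linear_coeff(3)]] case_prod_unfold)
  obtain d0 where d0: "d0 > 0" "\<And>p. \<lbrakk>p tagged_division_of {0..1}; \<forall>(t, K)\<in>p. Sup K - Inf K < d0\<rbrakk> \<Longrightarrow> cmod (coeff0 (?S p) - a) < \<epsilon> / 3"
    using assms(1) e unfolding has_stieltjes_integral_def S by meson
  obtain d1 where d1: "d1 > 0" "\<And>p. \<lbrakk>p tagged_division_of {0..1}; \<forall>(t, K)\<in>p. Sup K - Inf K < d1\<rbrakk> \<Longrightarrow> cmod (coeff1 (?S p) - b) < \<epsilon> / 3"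
    using assms(2) e unfolding has_stieltjes_integral_def S by meson
  obtain d2 where d2: "d2 > 0" "\<And>p. \<lbrakk>p tagged_division_of {0..1}; \<forall>(t, K)\<in>p. Sup K - Inf K < d2\<rbrakk> \<Longrightarrow> cmod (coeff2 (?S p) - c) < \<epsilon> / 3"
    using assms(3) e unfolding has_stieltjes_integral_def S by meson
  have "norm (?S p - A3 a b c) < \<epsilon>"
    if p: "p tagged_division_of {0..1}" "\<forall>(t, K)\<in>p. Sup K - Inf K < min d0 (min d1 d2)" for p
  proof -
    have fine: "\<forall>(t, K)\<in>p. Sup K - Inf K < d0" "\<forall>(t, K)\<in>p. Sup K - Inf K < d1" "\<forall>(t, K)\<in>p. Sup K - Inf K < d2"
      using p(2) by auto
    have "norm (?S p - A3 a b c) \<le> cmod (coeff0 (?S p) - a) + cmod (coeff1 (?S p) - b) + cmod (coeff2 (?S p) - c)"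
    proof -
      have "?S p - A3 a b c = A3 (coeff0 (?S p) - a) (coeff1 (?S p) - b) (coeff2 (?S p) - c)"
        by (simp add: minus_a3_def)
      then show ?thesis using norm_A3_le by simp
    qed
    also have "\<dots> < \<epsilon>"
      using d0(2)[OF p(1) fine(1)] d1(2)[OF p(1) fine(2)] d2(2)[OF p(1) fine(3)] by linarith
    finally show ?thesis .
  qed
  then show "\<exists>\<delta>>0. \<forall>p. p tagged_division_of {0..1} \<and> (\<forall>(t, K)\<in>p. Sup K - Inf K < \<delta>) \<longrightarrow> norm (?S p - A3 a b c) < \<epsilon>"
    using d0(1) d1(1) d2(1) by (intro exI[of _ "min d0 (min d1 d2)"]) auto
qed

section \<open>Lifts of holomorphic functions\<close>

text \<open>The Taylor formula for \<open>F\<close> at \<open>coeff0 \<zeta>\<close>, evaluated at \<open>\<zeta>\<close>; it stops after the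
  quadratic term because the nilpotent part of \<open>\<zeta>\<close> has vanishing cube.\<close>

definition principal_extension :: "(complex \<Rightarrow> complex) \<Rightarrow> a3 \<Rightarrow> a3" where
  "principal_extension F \<zeta> = A3 (F (coeff0 \<zeta>)) (coeff1 \<zeta> * deriv F (coeff0 \<zeta>))
     (coeff2 \<zeta> * deriv F (coeff0 \<zeta>) + (coeff1 \<zeta>)\<^sup>2 * deriv (deriv F) (coeff0 \<zeta>) / 2)"

lemma coeff_principal_extension [simp]:
  "coeff0 (principal_extension F \<zeta>) = F (coeff0 \<zeta>)"
  "coeff1 (principal_extension F \<zeta>) = coeff1 \<zeta> * deriv F (coeff0 \<zeta>)"
  "coeff2 (principal_extension F \<zeta>) = coeff2 \<zeta> * deriv F (coeff0 \<zeta>) + (coeff1 \<zeta>)\<^sup>2 * deriv (deriv F) (coeff0 \<zeta>) / 2"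
  by (simp_all add: principal_extension_def)

lemma principal_extension_has_derivative:
  assumes hol: "F holomorphic_on D" and "open D" and "coeff0 \<zeta> \<in> D"
  shows "(principal_extension F has_derivative (\<lambda>h. h * principal_extension (deriv F) \<zeta>)) (at \<zeta>)"
proof -
  have chain: "((\<lambda>x. G (coeff0 x)) has_derivative (\<lambda>h. deriv G (coeff0 \<zeta>) * coeff0 h)) (at \<zeta>)"
    if "G holomorphic_on D" for G
  proof -
    have "(G has_derivative (*) (deriv G (coeff0 \<zeta>))) (at (coeff0 \<zeta>))"
      using holomorphic_derivI[OF that assms(2,3)] by (simp add: has_field_derivative_def)
    from has_derivative_compose[OF bounded_linear_imp_has_derivative[OF bounded_linear_coeff(1)] this]
    show ?thesis .
  qed
  note hol' = holomorphic_deriv[OF hol \<open>open D\<close>]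
  note hol'' = holomorphic_deriv[OF hol' \<open>open D\<close>]
  show ?thesis
    unfolding principal_extension_def[abs_def]
    by (rule has_derivative_eq_rhs, rule has_derivative_A3)
      (rule derivative_eq_intros chain[OF hol] chain[OF hol'] chain[OF hol''] refl
        bounded_linear_imp_has_derivative[OF bounded_linear_coeff(2)]
        bounded_linear_imp_has_derivative[OF bounded_linear_coeff(3)] |
        simp add: fun_eq_iff a3_eq_iff algebra_simps power2_eq_square)+
qed

definition monogenic_extension ::
    "(complex \<Rightarrow> complex) \<Rightarrow> (complex \<Rightarrow> complex) \<Rightarrow> (complex \<Rightarrow> complex) \<Rightarrow> a3 \<Rightarrow> a3" where
  "monogenic_extension F0 F1 F2 \<zeta> = principal_extension F0 \<zeta> + rho * principal_extension F1 \<zeta> +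
     rho\<^sup>2 * principal_extension F2 \<zeta>"

lemma monogenic_extension_has_derivative:
  assumes "F0 holomorphic_on D" "F1 holomorphic_on D" "F2 holomorphic_on D" and "open D" "coeff0 \<zeta> \<in> D"
  shows "(monogenic_extension F0 F1 F2 has_derivative
    (\<lambda>h. h * monogenic_extension (deriv F0) (deriv F1) (deriv F2) \<zeta>)) (at \<zeta>)"
proof -
  have "((\<lambda>x. principal_extension F0 x + rho * principal_extension F1 x + rho\<^sup>2 * principal_extension F2 x)
      has_derivative (\<lambda>h. h * principal_extension (deriv F0) \<zeta> + rho * (h * principal_extension (deriv F1) \<zeta>)
        + rho\<^sup>2 * (h * principal_extension (deriv F2) \<zeta>))) (at \<zeta>)"
    by (intro has_derivative_add bounded_linear.has_derivative[OF bounded_linear_a3_mult]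
        principal_extension_has_derivative[OF _ assms(4,5)] assms)
  then show ?thesis
    unfolding monogenic_extension_def[abs_def] by (simp add: distrib_left mult.left_commute)
qed

text \<open>Multiplication of the density by the resolvent leads to the Cauchy kernels of orders one
  to three, whose integrals are the values and the derivatives that enter the lifts.\<close>

lemma monogenic_extension_cauchy_integral:
  assumes "open D" "connected D" and hol: "F0 holomorphic_on D" "F1 holomorphic_on D" "F2 holomorphic_on D"
    and \<gamma>: "pos_jordan_rectifiable \<gamma>" and sub: "path_image \<gamma> \<subseteq> D" "inside (path_image \<gamma>) \<subseteq> D"
    and z: "coeff0 \<zeta> \<in> inside (path_image \<gamma>)"
  shows "has_line_integral
      (\<lambda>\<xi>. (of_cpx (F0 \<xi>) + of_cpx (F1 \<xi>) * rho + of_cpx (F2 \<xi>) * rho\<^sup>2) * inverse (of_cpx \<xi> - \<zeta>))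
      (of_cpx (2 * of_real pi * \<i>) * monogenic_extension F0 F1 F2 \<zeta>) \<gamma>"
proof -
  let ?g = "\<lambda>\<xi>. (of_cpx (F0 \<xi>) + of_cpx (F1 \<xi>) * rho + of_cpx (F2 \<xi>) * rho\<^sup>2) * inverse (of_cpx \<xi> - \<zeta>)"
  define w a b where "w = coeff0 \<zeta>" and "a = coeff1 \<zeta>" and "b = coeff2 \<zeta>"
  define P where "P = (2 * of_real pi * \<i> :: complex)"
  have off: "\<gamma> t \<noteq> w" if "t \<in> {0..1}" for t
  proof -
    have "\<gamma> t \<in> path_image \<gamma>" using that by (simp add: path_image_def)
    moreover have "w \<notin> path_image \<gamma>"
      using z inside_no_overlap[of "path_image \<gamma>"] unfolding w_def by blast
    ultimately show ?thesis by metis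
  qed
  have cong: "has_stieltjes_integral g I \<gamma>" if "has_stieltjes_integral h I \<gamma>" "\<And>\<xi>. \<xi> \<noteq> w \<Longrightarrow> g \<xi> = h \<xi>" for g h I
  proof -
    have eq: "(\<Sum>(t, K)\<in>p. g (\<gamma> t) * (\<gamma> (Sup K) - \<gamma> (Inf K))) = (\<Sum>(t, K)\<in>p. h (\<gamma> t) * (\<gamma> (Sup K) - \<gamma> (Inf K)))"
      if "p tagged_division_of {0..1}" for p
    proof (intro sum.cong refl, clarify)
      fix t K assume "(t, K) \<in> p"
      then have "t \<in> {0..1}" using tagged_division_ofD(2,3)[OF \<open>p tagged_division_of {0..1}\<close>] by blast
      then show "g (\<gamma> t) * (\<gamma> (Sup K) - \<gamma> (Inf K)) = h (\<gamma> t) * (\<gamma> (Sup K) - \<gamma> (Inf K))"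
        using \<open>\<And>\<xi>. \<xi> \<noteq> w \<Longrightarrow> g \<xi> = h \<xi>\<close> off by simp
    qed
    show ?thesis
      unfolding has_stieltjes_integral_def
    proof (intro allI impI)
      fix \<epsilon> :: real assume "\<epsilon> > 0"
      then obtain \<delta> where "\<delta> > 0" and \<delta>: "\<And>p. p tagged_division_of {0..1} \<and> (\<forall>(t, K)\<in>p. Sup K - Inf K < \<delta>) \<Longrightarrow>
          cmod ((\<Sum>(t, K)\<in>p. h (\<gamma> t) * (\<gamma> (Sup K) - \<gamma> (Inf K))) - I) < \<epsilon>"
        using \<open>has_stieltjes_integral h I \<gamma>\<close> unfolding has_stieltjes_integral_def by blast
      show "\<exists>\<delta>>0. \<forall>p. p tagged_division_of {0..1} \<and> (\<forall>(t, K)\<in>p. Sup K - Inf K < \<delta>) \<longrightarrow>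
          cmod ((\<Sum>(t, K)\<in>p. g (\<gamma> t) * (\<gamma> (Sup K) - \<gamma> (Inf K))) - I) < \<epsilon>" (is "\<exists>\<delta>>0. \<forall>p. _ \<longrightarrow> ?close p")
      proof (intro exI[of _ \<delta>] conjI \<open>\<delta> > 0\<close> allI impI)
        fix p :: "(real \<times> real set) set"
        assume p: "p tagged_division_of {0..1} \<and> (\<forall>(t, K)\<in>p. Sup K - Inf K < \<delta>)"
        show "?close p"
          using \<delta>[OF p] by (simp only: eq[OF conjunct1[OF p]])
      qed
    qed
  qed
  note C = cauchy_formula_rectifiable[OF assms(1,2) _ \<gamma> sub z, folded w_def P_def]
  have C0: "has_stieltjes_integral (\<lambda>\<xi>. F \<xi> / (\<xi> - w)) (P * F w) \<gamma>" if "F holomorphic_on D" for F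
    using C[OF that, of 0] by simp
  have C1: "has_stieltjes_integral (\<lambda>\<xi>. F \<xi> / (\<xi> - w)\<^sup>2) (P * deriv F w) \<gamma>" if "F holomorphic_on D" for F
    using C[OF that, of 1] by (simp add: power2_eq_square)
  have C2: "has_stieltjes_integral (\<lambda>\<xi>. F \<xi> / (\<xi> - w) ^ 3) (P * (deriv (deriv F) w / 2)) \<gamma>" if "F holomorphic_on D" for F
    using C[OF that, of 2] by (simp add: numeral_2_eq_2 numeral_3_eq_3)
  have "has_line_integral ?g (A3 (P * F0 w) (a * (P * deriv F0 w) + P * F1 w)
     (b * (P * deriv F0 w) + a\<^sup>2 * (P * (deriv (deriv F0) w / 2)) + a * (P * deriv F1 w) + P * F2 w)) \<gamma>"
  proof (rule has_line_integral_coeffs)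
    show "has_stieltjes_integral (\<lambda>\<xi>. coeff0 (?g \<xi>)) (P * F0 w) \<gamma>"
      by (rule cong[OF C0[OF hol(1)]]) (simp add: a3_inverse_resolvent w_def)
    show "has_stieltjes_integral (\<lambda>\<xi>. coeff1 (?g \<xi>)) (a * (P * deriv F0 w) + P * F1 w) \<gamma>"
      by (rule cong[OF has_stieltjes_integral_add[OF has_stieltjes_integral_cmult[OF C1[OF hol(1)]] C0[OF hol(2)]]])
        (simp add: a3_inverse_resolvent w_def a_def)
    show "has_stieltjes_integral (\<lambda>\<xi>. coeff2 (?g \<xi>))
        (b * (P * deriv F0 w) + a\<^sup>2 * (P * (deriv (deriv F0) w / 2)) + a * (P * deriv F1 w) + P * F2 w) \<gamma>"
      by (rule cong[OF has_stieltjes_integral_add[OF has_stieltjes_integral_add[OF has_stieltjes_integral_add[OF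
              has_stieltjes_integral_cmult[OF C1[OF hol(1)]] has_stieltjes_integral_cmult[OF C2[OF hol(1)]]]
              has_stieltjes_integral_cmult[OF C1[OF hol(2)]]] C0[OF hol(3)]]])
        (simp add: a3_inverse_resolvent w_def a_def b_def algebra_simps)
  qed
  moreover have "A3 (P * F0 w) (a * (P * deriv F0 w) + P * F1 w)
     (b * (P * deriv F0 w) + a\<^sup>2 * (P * (deriv (deriv F0) w / 2)) + a * (P * deriv F1 w) + P * F2 w) =
     of_cpx P * monogenic_extension F0 F1 F2 \<zeta>"
    by (simp add: a3_eq_iff monogenic_extension_def w_def a_def b_def algebra_simps)
  ultimately show ?thesis by (simp add: P_def)
qed

section \<open>Derivatives that vanish off a countable set\<close>

text \<open>If \<open>h\<close> increased from \<open>0\<close> to \<open>1\<close>, so would \<open>k x = h x - \<eta> x\<close> for some \<open>\<eta> > 0\<close>. At the last point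
  where \<open>k\<close> takes a given intermediate value, \<open>k\<close> cannot have the derivative \<open>- \<eta>\<close>, so
  this point is exceptional. There are uncountably many such values.\<close>

lemma not_increasing_if_derivative_zero_off_countable:
  fixes h :: "real \<Rightarrow> real"
  assumes cont: "continuous_on {0..1} h" and "countable S"
    and der: "\<And>t. t \<in> {0<..<1} - S \<Longrightarrow> (h has_real_derivative 0) (at t)"
  shows "h 1 \<le> h 0"
proof (rule ccontr)
  assume "\<not> h 1 \<le> h 0"
  define \<eta> where "\<eta> = (h 1 - h 0) / 2"
  have "\<eta> > 0" using \<open>\<not> h 1 \<le> h 0\<close> by (simp add: \<eta>_def)
  \<comment> \<open>Half of the increase is spent on the tilt, so that \<open>k 0 < k 1\<close> still holds.\<close>
  define k where "k = (\<lambda>x. h x - \<eta> * x)"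
  have contk: "continuous_on {0..1} k"
    unfolding k_def by (intro continuous_intros cont)
  have k01: "k 0 < k 1" using \<open>\<eta> > 0\<close> by (simp add: k_def \<eta>_def field_simps)
  have "y \<in> k ` S" if y: "y \<in> {k 0<..<k 1}" for y
  proof -
    define X where "X = {x \<in> {0..1}. k x \<le> y}"
    have "closed X" unfolding X_def
      using continuous_closed_preimage[OF contk closed_atLeastAtMost, of "{..y}"]
      by (simp add: vimage_def Int_def)
    moreover have "bounded X" by (rule bounded_subset[OF bounded_closed_interval[of 0 1]]) (auto simp: X_def)
    ultimately have "compact X" by (simp add: compact_eq_bounded_closed)
    moreover have "0 \<in> X" using y by (simp add: X_def)
    ultimately obtain x where x: "x \<in> X" and max: "\<And>x'. x' \<in> X \<Longrightarrow> x' \<le> x"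
      using compact_attains_sup[of X] by blast
    have x01: "0 \<le> x" "x \<le> 1" "k x \<le> y" using x by (auto simp: X_def)
    have "x < 1" using x01 y by (cases "x = 1") auto
    have after: "y < k x'" if "x < x'" "x' \<le> 1" for x'
      using max[of x'] that x01(1) by (force simp: X_def)
    have "k x = y"
    proof (rule ccontr)
      assume "k x \<noteq> y"
      then have "k x \<le> y" "y \<le> k 1" using x01 y by auto
      then obtain x' where x': "x \<le> x'" "x' \<le> 1" "k x' = y"
        using IVT'[of k x y 1] x01 continuous_on_subset[OF contk, of "{x..1}"] by auto
      then have "x < x'" using \<open>k x \<noteq> y\<close> by (cases "x = x'") auto
      then show False using after[of x'] x' by simp
    qed
    have "0 < x" using \<open>k x = y\<close> y x01 by (cases "x = 0") auto
    have "x \<in> S"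
    proof (rule ccontr)
      assume "x \<notin> S"
      then have "(h has_real_derivative 0) (at x)" using der \<open>0 < x\<close> \<open>x < 1\<close> by simp
      then have "(k has_real_derivative (0 - \<eta>)) (at x)"
        unfolding k_def by (auto intro!: derivative_eq_intros)
      then obtain d where d: "d > 0" "\<And>s. \<lbrakk>0 < s; s < d\<rbrakk> \<Longrightarrow> k (x + s) < k x"
        using DERIV_neg_dec_right[of k "0 - \<eta>" x] \<open>\<eta> > 0\<close> by auto
      define s where "s = min (d / 2) (1 - x)"
      have "0 < s" "s < d" "x + s \<le> 1" using d(1) \<open>x < 1\<close> by (auto simp: s_def)
      then show False using d(2)[of s] after[of "x + s"] \<open>k x = y\<close> by simp
    qed
    then show ?thesis using \<open>k x = y\<close> by blast
  qed
  then have "{k 0<..<k 1} \<subseteq> k ` S" by (rule subsetI)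
  from countable_subset[OF this countable_image[OF \<open>countable S\<close>]]
  show False using k01 uncountable_open_interval[of "k 0" "k 1"] by simp
qed

lemma constant_if_derivative_zero_off_countable:
  fixes g :: "real \<Rightarrow> complex"
  assumes cont: "continuous_on {0..1} g" and "countable S"
    and der: "\<And>t. t \<in> {0<..<1} - S \<Longrightarrow> (g has_vector_derivative 0) (at t)"
  shows "g 1 = g 0"
proof -
  have real: "h (g 1) = h (g 0)" if h: "bounded_linear h" for h :: "complex \<Rightarrow> real"
  proof -
    have c: "continuous_on {0..1} (\<lambda>t. h (g t))"
      using cont by (rule bounded_linear.continuous_on[OF h])
    have d: "((\<lambda>t. h (g t)) has_real_derivative 0) (at t)" if "t \<in> {0<..<1} - S" for t
      using bounded_linear.has_vector_derivative[OF h der[OF that]] linear_0[OF bounded_linear.linear[OF h]]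
      by (simp add: has_real_derivative_iff_has_vector_derivative)
    show ?thesis
      using not_increasing_if_derivative_zero_off_countable[OF c \<open>countable S\<close> d]
        not_increasing_if_derivative_zero_off_countable[of "\<lambda>t. - h (g t)", OF continuous_on_minus[OF c] \<open>countable S\<close>]
        DERIV_minus[OF d] by fastforce
  qed
  show ?thesis
    using real[OF bounded_linear_Re] real[OF bounded_linear_Im] by (simp add: complex_eq_iff)
qed

lemma tendsto_difference_quotient_iff:
  fixes f :: "real \<Rightarrow> 'a::real_normed_vector"
  shows "((\<lambda>s. (f (t + s) - f t) /\<^sub>R s) \<longlongrightarrow> v) (at 0) \<longleftrightarrow> (f has_vector_derivative v) (at t)"
proof -
  have "(f has_vector_derivative v) (at t) \<longleftrightarrow>
      ((\<lambda>s. norm (f (t + s) - f t - s *\<^sub>R v) / norm s) \<longlongrightarrow> 0) (at 0)"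
    unfolding has_vector_derivative_def has_derivative_at by (simp add: bounded_linear_scaleR_left)
  also have "\<dots> \<longleftrightarrow> ((\<lambda>s. norm ((f (t + s) - f t) /\<^sub>R s - v)) \<longlongrightarrow> 0) (at 0)"
  proof (rule filterlim_cong[OF refl refl])
    have "norm (f (t + s) - f t - s *\<^sub>R v) / norm s = norm ((f (t + s) - f t) /\<^sub>R s - v)" if "s \<noteq> 0" for s
    proof -
      have "(f (t + s) - f t) /\<^sub>R s - v = (f (t + s) - f t - s *\<^sub>R v) /\<^sub>R s"
        using that by (simp add: scaleR_diff_right)
      then show ?thesis by (simp add: divide_inverse_commute)
    qed
    then show "\<forall>\<^sub>F s in at 0. norm (f (t + s) - f t - s *\<^sub>R v) / norm s = norm ((f (t + s) - f t) /\<^sub>R s - v)"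
      by (simp add: eventually_at_filter)
  qed
  finally show ?thesis by (simp add: tendsto_norm_zero_iff LIM_zero_iff)
qed

lemma has_derivative_imp_directional:
  fixes f :: "'a::real_normed_vector \<Rightarrow> 'b::real_normed_vector"
  assumes "(f has_derivative f') (at x)"
  shows "((\<lambda>s. (f (x + s *\<^sub>R h) - f x) /\<^sub>R s) \<longlongrightarrow> f' h) (at 0)"
proof -
  have "((\<lambda>s. x + s *\<^sub>R h) has_derivative (\<lambda>s. s *\<^sub>R h)) (at 0)"
    by (auto intro!: derivative_eq_intros)
  moreover have "(f has_derivative f') (at (x + 0 *\<^sub>R h))" using assms by simp
  ultimately have "((\<lambda>s. f (x + s *\<^sub>R h)) has_derivative (\<lambda>s. f' (s *\<^sub>R h))) (at 0)"
    by (rule has_derivative_compose)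
  then have "((\<lambda>s. f (x + s *\<^sub>R h)) has_vector_derivative f' h) (at 0)"
    using linear_cmul[OF has_derivative_linear[OF assms]] by (simp add: has_vector_derivative_def)
  then show ?thesis
    unfolding tendsto_difference_quotient_iff[symmetric] by simp
qed

section \<open>The fibration of the subspace by lines\<close>

text \<open>The vectors \<open>b1\<close> and \<open>b2\<close> fix a real-linear right inverse of \<^const>\<open>coeff0\<close> with values in
  \<open>E\<close>, so that \<open>E\<close> becomes the product of the complex plane and the line through \<open>l\<close>.\<close>

locale fibred_subspace =
  fixes E :: "a3 set" and l b1 b2 :: a3
  assumes subsp: "subspace E" and b: "b1 \<in> E" "b2 \<in> E" "coeff0 b1 = 1" "coeff0 b2 = \<i>"
    and l: "l \<in> E" "coeff0 l = 0" "l \<noteq> 0"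
    and kernel: "\<And>x. \<lbrakk>x \<in> E; coeff0 x = 0\<rbrakk> \<Longrightarrow> \<exists>c::real. x = c *\<^sub>R l"
begin

definition slice :: "complex \<Rightarrow> a3" where
  "slice z = Re z *\<^sub>R b1 + Im z *\<^sub>R b2"

lemma coeff0_slice [simp]: "coeff0 (slice z) = z"
  using b by (simp add: slice_def complex_eq_iff)

lemma slice_in_E: "slice z \<in> E"
  unfolding slice_def using b subsp by (intro subspace_add subspace_scale)

lemma bounded_linear_slice: "bounded_linear slice"
  unfolding slice_def[abs_def]
  by (intro bounded_linear_add bounded_linear_scaleR_const bounded_linear_Re bounded_linear_Im)

lemma E_decomp:
  assumes "x \<in> E" obtains t where "x = slice (coeff0 x) + t *\<^sub>R l"
proof -
  have "x - slice (coeff0 x) \<in> E" using assms slice_in_E subsp by (intro subspace_diff)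
  then obtain t where "x - slice (coeff0 x) = t *\<^sub>R l" using kernel by (metis coeff0_slice coeff_simps(7) right_minus_eq)
  then show ?thesis using that[of t] by (simp add: algebra_simps)
qed

lemma line_in_open:
  assumes \<Omega>: "openin (top_of_set E) \<Omega>" and "\<zeta> \<in> \<Omega>" "h \<in> E"
  shows "\<forall>\<^sub>F s::real in at 0. \<zeta> + s *\<^sub>R h \<in> \<Omega>"
proof -
  obtain T where T: "open T" "\<Omega> = E \<inter> T" using \<Omega> by (auto simp: openin_open)
  have "((\<lambda>s::real. \<zeta> + s *\<^sub>R h) \<longlongrightarrow> \<zeta> + 0 *\<^sub>R h) (at 0)"
    by (intro tendsto_intros)
  then have "\<forall>\<^sub>F s::real in at 0. \<zeta> + s *\<^sub>R h \<in> T"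
    using assms T by (intro topological_tendstoD) auto
  then show ?thesis
  proof eventually_elim
    case (elim s)
    have "\<zeta> \<in> E" using assms(2) T by simp
    then have "\<zeta> + s *\<^sub>R h \<in> E" using subsp assms(3) by (intro subspace_add subspace_scale)
    then show ?case using elim T by simp
  qed
qed

lemma open_coeff0_image:
  assumes \<Omega>: "openin (top_of_set E) \<Omega>"
  shows "open (coeff0 ` \<Omega>)"
proof -
  obtain T where T: "open T" "\<Omega> = E \<inter> T" using \<Omega> by (auto simp: openin_open)
  have "\<exists>W. open W \<and> coeff0 \<zeta> \<in> W \<and> W \<subseteq> coeff0 ` \<Omega>" if "\<zeta> \<in> \<Omega>" for \<zeta>
  proof (intro exI conjI)
    \<comment> \<open>A continuous local right inverse of \<^const>\<open>coeff0\<close> through \<open>\<zeta>\<close>.\<close>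
    define s where "s = (\<lambda>z. \<zeta> + slice (z - coeff0 \<zeta>))"
    have "continuous_on UNIV s"
      unfolding s_def
      by (intro continuous_intros bounded_linear.continuous_on[OF bounded_linear_slice])
    then show "open (s -` T)" using T(1) by (simp add: open_vimage)
    have "slice 0 = 0" by (simp add: slice_def)
    then show "coeff0 \<zeta> \<in> s -` T" using that T by (simp add: s_def)
    show "s -` T \<subseteq> coeff0 ` \<Omega>"
    proof
      fix z assume "z \<in> s -` T"
      moreover have "s z \<in> E" unfolding s_def using that T subsp slice_in_E by (intro subspace_add) auto
      ultimately have "s z \<in> \<Omega>" using T by simp
      moreover have "coeff0 (s z) = z" by (simp add: s_def)
      ultimately show "z \<in> coeff0 ` \<Omega>" by force
    qed
  qed
  then show ?thesis by (subst open_subopen) blast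
qed

text \<open>This is why no exceptional points remain in the plane: each point of the
  image of \<open>\<Omega>\<close> is the image of a good point.\<close>

lemma uncountable_fibre:
  assumes \<Omega>: "openin (top_of_set E) \<Omega>" and "\<zeta> \<in> \<Omega>" and "countable N"
  obtains \<zeta>' where "\<zeta>' \<in> \<Omega>" "\<zeta>' \<notin> N" "coeff0 \<zeta>' = coeff0 \<zeta>"
proof -
  obtain d where "d > 0" and d: "\<And>s. \<lbrakk>s \<noteq> 0; \<bar>s\<bar> < d\<rbrakk> \<Longrightarrow> \<zeta> + s *\<^sub>R l \<in> \<Omega>"
    using line_in_open[OF assms(1,2) l(1)] unfolding eventually_at by (auto simp: dist_real_def)
  have inj: "inj_on (\<lambda>s. \<zeta> + s *\<^sub>R l) {0<..<d}" using l(3) by (auto simp: inj_on_def)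
  have "\<not> (\<lambda>s. \<zeta> + s *\<^sub>R l) ` {0<..<d} \<subseteq> N"
  proof
    assume "(\<lambda>s. \<zeta> + s *\<^sub>R l) ` {0<..<d} \<subseteq> N"
    from countable_image_inj_on[OF countable_subset[OF this \<open>countable N\<close>] inj] show False
      using \<open>d > 0\<close> uncountable_open_interval[of 0 d] by simp
  qed
  then obtain s where "s \<in> {0<..<d}" "\<zeta> + s *\<^sub>R l \<notin> N" by blast
  then show ?thesis using that[of "\<zeta> + s *\<^sub>R l"] d l(2) by auto
qed

text \<open>The images of \<open>h1\<close> and \<open>h2\<close> span the plane over the reals, since \<open>l\<close> is mapped to zero.\<close>

lemma basis_transversal:
  assumes span: "span {h1, h2, l} = E"
  shows "Im (cnj (coeff0 h1) * coeff0 h2) \<noteq> 0"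
proof
  define \<alpha> \<beta> where "\<alpha> = coeff0 h1" and "\<beta> = coeff0 h2"
  assume "Im (cnj (coeff0 h1) * coeff0 h2) = 0"
  then have im: "Re \<alpha> * Im \<beta> = Im \<alpha> * Re \<beta>" by (simp add: \<alpha>_def \<beta>_def)
  have comb: "\<exists>x y::real. w = x *\<^sub>R \<alpha> + y *\<^sub>R \<beta>" for w
  proof -
    have "slice w \<in> span {h1, h2, l}" using slice_in_E span by simp
    then obtain x y z where "slice w = x *\<^sub>R h1 + y *\<^sub>R h2 + z *\<^sub>R l"
      by (auto simp: span_insert algebra_simps)
    then have "w = x *\<^sub>R \<alpha> + y *\<^sub>R \<beta>"
      using l(2) coeff0_slice[of w] by (simp add: \<alpha>_def \<beta>_def)
    then show ?thesis by blast
  qed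
  have "\<alpha> = 0"
  proof -
    obtain x y where "\<i> * \<alpha> = x *\<^sub>R \<alpha> + y *\<^sub>R \<beta>" using comb by blast
    then have e: "- Im \<alpha> = x * Re \<alpha> + y * Re \<beta>" "Re \<alpha> = x * Im \<alpha> + y * Im \<beta>"
      by (simp_all add: complex_eq_iff)
    have "Re \<alpha> * Re \<alpha> + Im \<alpha> * Im \<alpha> = Re \<alpha> * (x * Im \<alpha> + y * Im \<beta>) - Im \<alpha> * (x * Re \<alpha> + y * Re \<beta>)"
      unfolding e(1)[symmetric] e(2)[symmetric] by simp
    also have "\<dots> = y * (Re \<alpha> * Im \<beta> - Im \<alpha> * Re \<beta>)" by (simp add: algebra_simps)
    also have "\<dots> = 0" using im by simp
    finally show ?thesis by (simp add: complex_eq_iff)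
  qed
  moreover have "\<beta> = 0"
  proof -
    obtain x y where "\<i> * \<beta> = x *\<^sub>R \<alpha> + y *\<^sub>R \<beta>" using comb by blast
    then have "\<i> * \<beta> = y *\<^sub>R \<beta>" using \<open>\<alpha> = 0\<close> by simp
    then show ?thesis by (metis complex_i_not_zero scaleR_conv_of_real mult_right_cancel Im_complex_of_real imaginary_unit.sel(2) zero_neq_one)
  qed
  ultimately show False using comb[of 1] by simp
qed

lemma descends_to_holomorphic:
  fixes U :: "a3 \<Rightarrow> complex"
  assumes \<Omega>: "openin (top_of_set E) \<Omega>" and conv: "convex_in_direction (E \<inter> radical_a3) \<Omega>"
    and cont: "continuous_on \<Omega> U" and "countable N"
    and dirs: "\<And>\<zeta>. \<zeta> \<in> \<Omega> - N \<Longrightarrow> \<exists>c h1 h2. h1 \<in> E \<and> h2 \<in> E \<and> span {h1, h2, l} = E \<and>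
      (\<forall>h\<in>{h1, h2, l}. ((\<lambda>s::real. (U (\<zeta> + s *\<^sub>R h) - U \<zeta>) /\<^sub>R s) \<longlongrightarrow> coeff0 h * c) (at 0))"
  obtains F where "F holomorphic_on coeff0 ` \<Omega>" "\<And>\<zeta>. \<zeta> \<in> \<Omega> \<Longrightarrow> U \<zeta> = F (coeff0 \<zeta>)"
proof -
  have "\<Omega> \<subseteq> E" using \<Omega> openin_imp_subset by blast
  have fibre: "U \<zeta>2 = U \<zeta>1" if \<zeta>: "\<zeta>1 \<in> \<Omega>" "\<zeta>2 \<in> \<Omega>" "coeff0 \<zeta>1 = coeff0 \<zeta>2" for \<zeta>1 \<zeta>2
  proof (cases "\<zeta>1 = \<zeta>2")
    case False
    have "\<zeta>2 - \<zeta>1 \<in> E" using \<zeta> \<open>\<Omega> \<subseteq> E\<close> subsp by (intro subspace_diff) auto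
    then obtain c where c: "\<zeta>2 - \<zeta>1 = c *\<^sub>R l" using kernel[of "\<zeta>2 - \<zeta>1"] \<zeta>(3) by auto
    then have "c \<noteq> 0" using False by auto
    have "\<zeta>2 - \<zeta>1 \<in> E \<inter> radical_a3"
      using \<open>\<zeta>2 - \<zeta>1 \<in> E\<close> \<zeta>(3) by (simp add: radical_a3_eq_kernel)
    then have seg: "closed_segment \<zeta>1 \<zeta>2 \<subseteq> \<Omega>"
      using conv \<zeta> unfolding convex_in_direction_def by blast
    define p where "p = (\<lambda>t::real. \<zeta>1 + (c * t) *\<^sub>R l)"
    have p_seg: "p t \<in> \<Omega>" if "t \<in> {0..1}" for t
    proof -
      have "p t = (1 - t) *\<^sub>R \<zeta>1 + t *\<^sub>R \<zeta>2"
      proof -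
        have "(c * t) *\<^sub>R l = t *\<^sub>R (\<zeta>2 - \<zeta>1)" by (simp add: c)
        then show ?thesis by (simp add: p_def algebra_simps)
      qed
      then have "p t \<in> closed_segment \<zeta>1 \<zeta>2" using that by (auto simp: closed_segment_def)
      then show ?thesis using seg by blast
    qed
    have "inj p" using \<open>c \<noteq> 0\<close> l(3) by (auto simp: inj_def p_def)
    have "U (p 1) = U (p 0)"
    proof (rule constant_if_derivative_zero_off_countable)
      show "continuous_on {0..1} (\<lambda>t. U (p t))"
        by (rule continuous_on_compose2[OF cont]) (auto simp: p_def[abs_def] p_seg[unfolded p_def] intro!: continuous_intros)
      show "countable (p -` N)"
        using countable_image_inj_on[of p "p -` N"] countable_subset[OF _ \<open>countable N\<close>, of "p ` (p -` N)"] \<open>inj p\<close> by (auto intro: inj_on_subset)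
      fix t assume t: "t \<in> {0<..<1} - p -` N"
      then have "p t \<in> \<Omega> - N" using p_seg[of t] by auto
      then have "((\<lambda>s::real. (U (p t + s *\<^sub>R l) - U (p t)) /\<^sub>R s) \<longlongrightarrow> 0) (at 0)"
        using dirs[of "p t"] l(2) by fastforce
      then have "((\<lambda>s. U (p t + s *\<^sub>R l)) has_vector_derivative 0) (at (c * 0))"
        using tendsto_difference_quotient_iff[of "\<lambda>s. U (p t + s *\<^sub>R l)" 0 0] by simp
      moreover have "((\<lambda>s. c * s) has_vector_derivative c) (at 0)"
        by (auto intro!: derivative_eq_intros)
      ultimately have "(((\<lambda>s. U (p t + s *\<^sub>R l)) \<circ> (\<lambda>s. c * s)) has_vector_derivative (c *\<^sub>R 0)) (at 0)"
        by (intro vector_diff_chain_at)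
      moreover have "p t + (c * s) *\<^sub>R l = p (t + s)" for s
        by (simp add: p_def algebra_simps)
      ultimately have "((\<lambda>s. U (p (t + s))) has_vector_derivative 0) (at 0)"
        by (simp add: o_def)
      then show "((\<lambda>t. U (p t)) has_vector_derivative 0) (at t)"
        unfolding tendsto_difference_quotient_iff[symmetric] by simp
    qed
    moreover have "p 0 = \<zeta>1" "p 1 = \<zeta>2"
      using c by (simp_all add: p_def) (metis add_diff_cancel_left' add.commute diff_add_cancel)
    ultimately show ?thesis by simp
  qed simp
  define F where "F = (\<lambda>z. U (SOME \<zeta>. \<zeta> \<in> \<Omega> \<and> coeff0 \<zeta> = z))"
  have UF: "U \<zeta> = F (coeff0 \<zeta>)" if "\<zeta> \<in> \<Omega>" for \<zeta>
  proof -
    have "\<exists>\<zeta>'. \<zeta>' \<in> \<Omega> \<and> coeff0 \<zeta>' = coeff0 \<zeta>" using that by blast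
    from someI_ex[OF this] show ?thesis unfolding F_def by (intro fibre that) auto
  qed
  have "F holomorphic_on coeff0 ` \<Omega>"
  proof (rule directional_derivatives_imp_holomorphic)
    show opn: "open (coeff0 ` \<Omega>)" by (rule open_coeff0_image[OF \<Omega>])
    show "continuous_on (coeff0 ` \<Omega>) F"
    proof (rule continuous_at_imp_continuous_on, intro ballI)
      fix z assume "z \<in> coeff0 ` \<Omega>"
      then obtain \<zeta> where \<zeta>: "\<zeta> \<in> \<Omega>" "z = coeff0 \<zeta>" by blast
      obtain T where T: "open T" "\<Omega> = E \<inter> T" using \<Omega> by (auto simp: openin_open)
      define s where "s = (\<lambda>w. \<zeta> + slice (w - z))"
      have conts: "continuous_on UNIV s"
        unfolding s_def by (intro continuous_intros bounded_linear.continuous_on[OF bounded_linear_slice])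
      have s\<Omega>: "s w \<in> \<Omega>" if "w \<in> s -` T" for w
        using that T \<zeta> subsp slice_in_E by (auto simp: s_def intro: subspace_add)
      have "slice 0 = 0" by (simp add: slice_def)
      then have "z \<in> s -` T" using \<zeta> T by (simp add: s_def)
      moreover have "open (s -` T)" using T(1) conts by (simp add: open_vimage)
      moreover have "continuous_on (s -` T) (\<lambda>w. U (s w))"
        by (rule continuous_on_compose2[OF cont continuous_on_subset[OF conts]]) (use s\<Omega> in auto)
      moreover have "U (s w) = F w" if "w \<in> s -` T" for w
        using UF[OF s\<Omega>[OF that]] \<zeta>(2) by (simp add: s_def)
      ultimately have "continuous_on (s -` T) F" by (metis (mono_tags, lifting) continuous_on_cong)
      then show "isCont F z"
        using \<open>z \<in> s -` T\<close> \<open>open (s -` T)\<close> continuous_on_eq_continuous_at by blast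
    qed
    fix z assume "z \<in> coeff0 ` \<Omega>"
    then obtain \<zeta>0 where "\<zeta>0 \<in> \<Omega>" "z = coeff0 \<zeta>0" by blast
    \<comment> \<open>A good point over \<open>z\<close>, even if \<open>\<zeta>0\<close> itself is exceptional.\<close>
    then obtain \<zeta> where \<zeta>: "\<zeta> \<in> \<Omega>" "\<zeta> \<notin> N" "coeff0 \<zeta> = z"
      using uncountable_fibre[OF \<Omega> _ \<open>countable N\<close>] by metis
    then obtain c h1 h2 where h: "h1 \<in> E" "h2 \<in> E" "span {h1, h2, l} = E"
      and lim: "\<And>h. h \<in> {h1, h2, l} \<Longrightarrow> ((\<lambda>s::real. (U (\<zeta> + s *\<^sub>R h) - U \<zeta>) /\<^sub>R s) \<longlongrightarrow> coeff0 h * c) (at 0)"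
      using dirs[of \<zeta>] by blast
    have "((\<lambda>s::real. (F (z + s *\<^sub>R coeff0 h) - F z) /\<^sub>R s) \<longlongrightarrow> coeff0 h * c) (at 0)"
      if "h \<in> {h1, h2}" for h
    proof (rule Lim_transform_eventually)
      show "((\<lambda>s::real. (U (\<zeta> + s *\<^sub>R h) - U \<zeta>) /\<^sub>R s) \<longlongrightarrow> coeff0 h * c) (at 0)"
        using lim that by blast
      have "h \<in> E" using that h by blast
      from line_in_open[OF \<Omega> \<zeta>(1) this]
      show "\<forall>\<^sub>F s in at 0. (U (\<zeta> + s *\<^sub>R h) - U \<zeta>) /\<^sub>R s = (F (z + s *\<^sub>R coeff0 h) - F z) /\<^sub>R s"
        by eventually_elim (use \<zeta> UF in simp)
    qed
    then have "Im (cnj (coeff0 h1) * coeff0 h2) \<noteq> 0 \<and> (\<forall>h\<in>{coeff0 h1, coeff0 h2}.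
        ((\<lambda>s::real. (F (z + s *\<^sub>R h) - F z) /\<^sub>R s) \<longlongrightarrow> h * c) (at 0))"
      using basis_transversal[OF h(3)] by blast
    then show "\<exists>c h1 h2. Im (cnj h1 * h2) \<noteq> 0 \<and>
        (\<forall>h\<in>{h1, h2}. ((\<lambda>s::real. (F (z + s *\<^sub>R h) - F z) /\<^sub>R s) \<longlongrightarrow> h * c) (at 0))"
      by - (rule exI[of _ c], rule exI[of _ "coeff0 h1"], rule exI[of _ "coeff0 h2"])
  qed
  then show ?thesis using UF by (rule that)
qed

end

section \<open>Representation by holomorphic functions\<close>

text \<open>Differentiable functions can be subtracted without losing the condition; in particular
  lifts of holomorphic functions can.\<close>

lemma condition_K_diff:
  assumes "condition_K E l \<Phi> \<zeta>" and X: "(X has_derivative (\<lambda>h. h * c)) (at \<zeta>)"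
  shows "condition_K E l (\<lambda>x. \<Phi> x - X x) \<zeta>"
proof -
  obtain \<Phi>s h1 h2 where h: "h1 \<in> E" "h2 \<in> E" "distinct [h1, h2, l]" "independent {h1, h2, l}" "span {h1, h2, l} = E"
    and lim: "\<And>h. h \<in> {h1, h2, l} \<Longrightarrow> ((\<lambda>\<epsilon>::real. (\<Phi> (\<zeta> + \<epsilon> *\<^sub>R h) - \<Phi> \<zeta>) /\<^sub>R \<epsilon>) \<longlongrightarrow> h * \<Phi>s) (at 0)"
    using assms(1) unfolding condition_K_def by blast
  have "((\<lambda>\<epsilon>::real. ((\<Phi> (\<zeta> + \<epsilon> *\<^sub>R h) - X (\<zeta> + \<epsilon> *\<^sub>R h)) - (\<Phi> \<zeta> - X \<zeta>)) /\<^sub>R \<epsilon>) \<longlongrightarrow> h * (\<Phi>s - c)) (at 0)"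
    if "h \<in> {h1, h2, l}" for h
    using tendsto_diff[OF lim[OF that] has_derivative_imp_directional[OF X, of h]]
    by (simp add: right_diff_distrib scaleR_diff_right algebra_simps)
  then show ?thesis unfolding condition_K_def using h by blast
qed

context fibred_subspace
begin

text \<open>If the lower coefficients of \<open>\<Psi>\<close> vanish on \<open>\<Omega>\<close>, hence near \<open>\<zeta>\<close>, so do those of \<open>h1 * c\<close>. As \<open>h1\<close> is
  invertible, they vanish for \<open>c\<close> as well.\<close>

lemma condition_K_leading:
  assumes \<Omega>: "openin (top_of_set E) \<Omega>" "\<zeta> \<in> \<Omega>" and K: "condition_K E l \<Psi> \<zeta>"
  obtains c h1 h2 where "h1 \<in> E" "h2 \<in> E" "span {h1, h2, l} = E"
    "\<And>h. h \<in> {h1, h2, l} \<Longrightarrow> ((\<lambda>s::real. (\<Psi> (\<zeta> + s *\<^sub>R h) - \<Psi> \<zeta>) /\<^sub>R s) \<longlongrightarrow> h * c) (at 0)"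
    "(\<forall>x\<in>\<Omega>. coeff0 (\<Psi> x) = 0) \<Longrightarrow> coeff0 c = 0"
    "(\<forall>x\<in>\<Omega>. coeff0 (\<Psi> x) = 0 \<and> coeff1 (\<Psi> x) = 0) \<Longrightarrow> coeff1 c = 0"
proof -
  obtain c h1 h2 where h: "h1 \<in> E" "h2 \<in> E" "span {h1, h2, l} = E"
    and lim: "\<And>h. h \<in> {h1, h2, l} \<Longrightarrow> ((\<lambda>s::real. (\<Psi> (\<zeta> + s *\<^sub>R h) - \<Psi> \<zeta>) /\<^sub>R s) \<longlongrightarrow> h * c) (at 0)"
    using K unfolding condition_K_def by blast
  have nz: "coeff0 h1 \<noteq> 0" using basis_transversal[OF h(3)] by auto
  have vanish: "f (h1 * c) = 0" if f: "bounded_linear f" and zero: "\<forall>x\<in>\<Omega>. f (\<Psi> x) = 0" for f :: "a3 \<Rightarrow> complex"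
  proof -
    have "((\<lambda>s::real. f ((\<Psi> (\<zeta> + s *\<^sub>R h1) - \<Psi> \<zeta>) /\<^sub>R s)) \<longlongrightarrow> f (h1 * c)) (at 0)"
      using lim[of h1] by (intro bounded_linear.tendsto[OF f]) auto
    moreover have "\<forall>\<^sub>F s::real in at 0. f ((\<Psi> (\<zeta> + s *\<^sub>R h1) - \<Psi> \<zeta>) /\<^sub>R s) = 0"
      using line_in_open[OF \<Omega> h(1)]
      by eventually_elim
        (simp add: linear_cmul[OF bounded_linear.linear[OF f]] linear_diff[OF bounded_linear.linear[OF f]] zero \<Omega>(2))
    ultimately have "((\<lambda>s::real. 0) \<longlongrightarrow> f (h1 * c)) (at (0::real))"
      by (rule Lim_transform_eventually)
    then show ?thesis using tendsto_unique[OF _ tendsto_const] by (metis trivial_limit_at)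
  qed
  have c0: "coeff0 c = 0" if "\<forall>x\<in>\<Omega>. coeff0 (\<Psi> x) = 0"
    using vanish[OF bounded_linear_coeff(1) that] nz by simp
  have c1: "coeff1 c = 0" if "\<forall>x\<in>\<Omega>. coeff0 (\<Psi> x) = 0 \<and> coeff1 (\<Psi> x) = 0"
    using vanish[OF bounded_linear_coeff(2)] c0 that nz by simp
  show ?thesis by (rule that[OF h lim c0 c1])
qed

text \<open>The functional \<open>f\<close> is to be the first nonvanishing coefficient of \<open>\<Psi>\<close>. Coefficients of a product are
  convolutions, so \<open>f (h * c)\<close> is then as simple as for the coefficient of \<open>1\<close>.\<close>

lemma coefficient_descends:
  assumes \<Omega>: "openin (top_of_set E) \<Omega>" and conv: "convex_in_direction (E \<inter> radical_a3) \<Omega>"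
    and cont: "continuous_on \<Omega> \<Psi>" and "countable N"
    and K: "\<And>\<zeta>. \<zeta> \<in> \<Omega> - N \<Longrightarrow> condition_K E l \<Psi> \<zeta>" and f: "bounded_linear f"
    and leading: "\<And>h c. \<lbrakk>(\<forall>x\<in>\<Omega>. coeff0 (\<Psi> x) = 0) \<Longrightarrow> coeff0 c = 0;
        (\<forall>x\<in>\<Omega>. coeff0 (\<Psi> x) = 0 \<and> coeff1 (\<Psi> x) = 0) \<Longrightarrow> coeff1 c = 0\<rbrakk> \<Longrightarrow> f (h * c) = coeff0 h * f c"
  obtains F where "F holomorphic_on coeff0 ` \<Omega>" "\<And>\<zeta>. \<zeta> \<in> \<Omega> \<Longrightarrow> f (\<Psi> \<zeta>) = F (coeff0 \<zeta>)"
proof (rule descends_to_holomorphic[OF \<Omega> conv bounded_linear.continuous_on[OF f cont] \<open>countable N\<close>])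
  fix \<zeta> assume \<zeta>: "\<zeta> \<in> \<Omega> - N"
  then have "\<zeta> \<in> \<Omega>" by simp
  obtain h1 h2 c where h: "h1 \<in> E" "h2 \<in> E" "span {h1, h2, l} = E"
    and lim: "\<And>h. h \<in> {h1, h2, l} \<Longrightarrow> ((\<lambda>s::real. (\<Psi> (\<zeta> + s *\<^sub>R h) - \<Psi> \<zeta>) /\<^sub>R s) \<longlongrightarrow> h * c) (at 0)"
    and c0: "(\<forall>x\<in>\<Omega>. coeff0 (\<Psi> x) = 0) \<Longrightarrow> coeff0 c = 0"
    and c1: "(\<forall>x\<in>\<Omega>. coeff0 (\<Psi> x) = 0 \<and> coeff1 (\<Psi> x) = 0) \<Longrightarrow> coeff1 c = 0"
    by (rule condition_K_leading[OF \<Omega> \<open>\<zeta> \<in> \<Omega>\<close> K[OF \<zeta>]], rule that)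
  have "\<forall>h\<in>{h1, h2, l}. ((\<lambda>s::real. (f (\<Psi> (\<zeta> + s *\<^sub>R h)) - f (\<Psi> \<zeta>)) /\<^sub>R s) \<longlongrightarrow> coeff0 h * f c) (at 0)"
  proof
    fix h assume "h \<in> {h1, h2, l}"
    from bounded_linear.tendsto[OF f lim[OF this]]
    show "((\<lambda>s::real. (f (\<Psi> (\<zeta> + s *\<^sub>R h)) - f (\<Psi> \<zeta>)) /\<^sub>R s) \<longlongrightarrow> coeff0 h * f c) (at 0)"
      by (simp add: linear_cmul[OF bounded_linear.linear[OF f]] linear_diff[OF bounded_linear.linear[OF f]]
          leading[OF c0 c1])
  qed
  with h show "\<exists>c h1 h2. h1 \<in> E \<and> h2 \<in> E \<and> span {h1, h2, l} = E \<and>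
    (\<forall>h\<in>{h1, h2, l}. ((\<lambda>s::real. (f (\<Psi> (\<zeta> + s *\<^sub>R h)) - f (\<Psi> \<zeta>)) /\<^sub>R s) \<longlongrightarrow> coeff0 h * c) (at 0))"
    by blast
qed (rule that)

lemma monogenic_extension_exists:
  assumes \<Omega>: "openin (top_of_set E) \<Omega>" and conv: "convex_in_direction (E \<inter> radical_a3) \<Omega>"
    and cont: "continuous_on \<Omega> \<Phi>" and count: "countable {\<zeta> \<in> \<Omega>. \<not> condition_K E l \<Phi> \<zeta>}"
  obtains F0 F1 F2 where "F0 holomorphic_on coeff0 ` \<Omega>" "F1 holomorphic_on coeff0 ` \<Omega>"
    "F2 holomorphic_on coeff0 ` \<Omega>" "\<And>\<zeta>. \<zeta> \<in> \<Omega> \<Longrightarrow> \<Phi> \<zeta> = monogenic_extension F0 F1 F2 \<zeta>"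
proof -
  define D where "D = coeff0 ` \<Omega>"
  have "open D" unfolding D_def by (rule open_coeff0_image[OF \<Omega>])
  define N where "N = {\<zeta> \<in> \<Omega>. \<not> condition_K E l \<Phi> \<zeta>}"
  have count: "countable N" using count by (simp add: N_def)
  have pe: "(principal_extension F has_derivative (\<lambda>h. h * principal_extension (deriv F) \<zeta>)) (at \<zeta>)"
    if "F holomorphic_on D" "\<zeta> \<in> \<Omega>" for F \<zeta>
    using principal_extension_has_derivative[OF that(1) \<open>open D\<close>] that(2) by (simp add: D_def)
  have cont_pe: "continuous_on \<Omega> (principal_extension F)" if "F holomorphic_on D" for F
    using pe[OF that] by (meson continuous_at_imp_continuous_on has_derivative_continuous)
  have K0: "condition_K E l \<Phi> \<zeta>" if "\<zeta> \<in> \<Omega> - N" for \<zeta>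
    using that by (auto simp: N_def)
  obtain F0 where F0: "F0 holomorphic_on D" "\<And>\<zeta>. \<zeta> \<in> \<Omega> \<Longrightarrow> coeff0 (\<Phi> \<zeta>) = F0 (coeff0 \<zeta>)"
  proof (rule coefficient_descends[OF \<Omega> conv cont count K0 bounded_linear_coeff(1), folded D_def])
    fix h c :: a3
    assume "(\<forall>x\<in>\<Omega>. coeff0 (\<Phi> x) = 0) \<Longrightarrow> coeff0 c = 0"
      "(\<forall>x\<in>\<Omega>. coeff0 (\<Phi> x) = 0 \<and> coeff1 (\<Phi> x) = 0) \<Longrightarrow> coeff1 c = 0"
    then show "coeff0 (h * c) = coeff0 h * coeff0 c" by simp
  qed (assumption, rule that)
  define \<Phi>1 where "\<Phi>1 = (\<lambda>\<zeta>. \<Phi> \<zeta> - principal_extension F0 \<zeta>)"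
  have cont1: "continuous_on \<Omega> \<Phi>1"
    unfolding \<Phi>1_def by (intro continuous_intros cont cont_pe F0)
  have K1: "condition_K E l \<Phi>1 \<zeta>" if "\<zeta> \<in> \<Omega> - N" for \<zeta>
    unfolding \<Phi>1_def using K0[OF that] pe[OF F0(1)] that by (intro condition_K_diff) auto
  have zero1: "coeff0 (\<Phi>1 x) = 0" if "x \<in> \<Omega>" for x
    using F0(2)[OF that] by (simp add: \<Phi>1_def)
  obtain F1 where F1: "F1 holomorphic_on D" "\<And>\<zeta>. \<zeta> \<in> \<Omega> \<Longrightarrow> coeff1 (\<Phi>1 \<zeta>) = F1 (coeff0 \<zeta>)"
  proof (rule coefficient_descends[OF \<Omega> conv cont1 count K1 bounded_linear_coeff(2), folded D_def])
    fix h c :: a3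
    assume "(\<forall>x\<in>\<Omega>. coeff0 (\<Phi>1 x) = 0) \<Longrightarrow> coeff0 c = 0"
      "(\<forall>x\<in>\<Omega>. coeff0 (\<Phi>1 x) = 0 \<and> coeff1 (\<Phi>1 x) = 0) \<Longrightarrow> coeff1 c = 0"
    then show "coeff1 (h * c) = coeff0 h * coeff1 c" by (simp add: zero1)
  qed (assumption, rule that)
  define \<Phi>2 where "\<Phi>2 = (\<lambda>\<zeta>. \<Phi>1 \<zeta> - rho * principal_extension F1 \<zeta>)"
  have cont2: "continuous_on \<Omega> \<Phi>2"
    unfolding \<Phi>2_def
    by (intro continuous_on_diff cont1 bounded_linear.continuous_on[OF bounded_linear_a3_mult] cont_pe F1)
  have K2: "condition_K E l \<Phi>2 \<zeta>" if "\<zeta> \<in> \<Omega> - N" for \<zeta>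
  proof -
    have "((\<lambda>x. rho * principal_extension F1 x) has_derivative
        (\<lambda>h. rho * (h * principal_extension (deriv F1) \<zeta>))) (at \<zeta>)"
      using that by (intro bounded_linear.has_derivative[OF bounded_linear_a3_mult] pe F1) auto
    then have "((\<lambda>x. rho * principal_extension F1 x) has_derivative
        (\<lambda>h. h * (rho * principal_extension (deriv F1) \<zeta>))) (at \<zeta>)"
      by (simp add: mult.left_commute)
    then show ?thesis unfolding \<Phi>2_def using K1[OF that] by (intro condition_K_diff)
  qed
  have zero2: "coeff0 (\<Phi>2 x) = 0 \<and> coeff1 (\<Phi>2 x) = 0" if "x \<in> \<Omega>" for x
    using zero1[OF that] F1(2)[OF that] by (simp add: \<Phi>2_def)
  obtain F2 where F2: "F2 holomorphic_on D" "\<And>\<zeta>. \<zeta> \<in> \<Omega> \<Longrightarrow> coeff2 (\<Phi>2 \<zeta>) = F2 (coeff0 \<zeta>)"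
  proof (rule coefficient_descends[OF \<Omega> conv cont2 count K2 bounded_linear_coeff(3), folded D_def])
    fix h c :: a3
    assume "(\<forall>x\<in>\<Omega>. coeff0 (\<Phi>2 x) = 0) \<Longrightarrow> coeff0 c = 0"
      "(\<forall>x\<in>\<Omega>. coeff0 (\<Phi>2 x) = 0 \<and> coeff1 (\<Phi>2 x) = 0) \<Longrightarrow> coeff1 c = 0"
    then show "coeff2 (h * c) = coeff0 h * coeff2 c" by (simp add: zero2)
  qed (assumption, rule that)
  have "\<Phi> \<zeta> = monogenic_extension F0 F1 F2 \<zeta>" if "\<zeta> \<in> \<Omega>" for \<zeta>
  proof -
    have "\<Phi>2 \<zeta> = rho\<^sup>2 * principal_extension F2 \<zeta>"
      using zero2[OF that] F2(2)[OF that] by (simp add: a3_eq_iff)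
    then show ?thesis by (simp add: \<Phi>2_def \<Phi>1_def monogenic_extension_def algebra_simps)
  qed
  then show ?thesis by (rule that[OF F0(1)[unfolded D_def] F1(1)[unfolded D_def] F2(1)[unfolded D_def]])
qed

lemma basis_spans: "distinct [b1, b2, l]" "independent {b1, b2, l}" "span {b1, b2, l} = E"
proof -
  have ker: "subspace {x. coeff0 x = 0}" and imag: "subspace {x. Re (coeff0 x) = 0}"
    by (auto simp: subspace_def)
  show d: "distinct [b1, b2, l]" using b l by (auto simp: complex_eq_iff)
  have "span {l} \<subseteq> {x. coeff0 x = 0}" using l by (intro span_minimal ker) auto
  then have "b2 \<notin> span {l}" using b by auto
  moreover have "span {b2, l} \<subseteq> {x. Re (coeff0 x) = 0}" using l b by (intro span_minimal imag) auto
  then have "b1 \<notin> span {b2, l}" using b by auto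
  ultimately show "independent {b1, b2, l}"
    using l(3) d by (simp add: independent_insert)
  show "span {b1, b2, l} = E"
  proof
    show "span {b1, b2, l} \<subseteq> E" using b l subsp by (intro span_minimal) auto
    show "E \<subseteq> span {b1, b2, l}"
    proof
      fix x assume "x \<in> E"
      then obtain t where "x = slice (coeff0 x) + t *\<^sub>R l" by (rule E_decomp)
      also have "\<dots> \<in> span {b1, b2, l}"
        unfolding slice_def by (intro span_add span_scale span_base) auto
      finally show "x \<in> span {b1, b2, l}" .
    qed
  qed
qed

text \<open>The one-sided limits for \<open>h\<close> and \<open>- h\<close> make up a two-sided one.\<close>

lemma monogenic_imp_condition_K:
  assumes "monogenic_in E \<Omega> \<Phi>" "\<zeta> \<in> \<Omega>"
  shows "condition_K E l \<Phi> \<zeta>"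
proof -
  obtain c where c: "\<And>h. h \<in> E \<Longrightarrow>
      ((\<lambda>\<delta>::real. (\<Phi> (\<zeta> + \<delta> *\<^sub>R h) - \<Phi> \<zeta>) /\<^sub>R \<delta>) \<longlongrightarrow> h * c) (at_right 0)"
    using assms unfolding monogenic_in_def by blast
  have "((\<lambda>\<delta>::real. (\<Phi> (\<zeta> + \<delta> *\<^sub>R h) - \<Phi> \<zeta>) /\<^sub>R \<delta>) \<longlongrightarrow> h * c) (at 0)" if "h \<in> E" for h
  proof (rule filterlim_split_at[OF _ c[OF that]])
    have "- h \<in> E" using that subsp by (rule subspace_neg[rotated])
    from tendsto_minus[OF c[OF this]]
    show "((\<lambda>\<delta>::real. (\<Phi> (\<zeta> + \<delta> *\<^sub>R h) - \<Phi> \<zeta>) /\<^sub>R \<delta>) \<longlongrightarrow> h * c) (at_left 0)"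
      by (simp add: filterlim_at_left_to_right)
  qed
  then show ?thesis
    unfolding condition_K_def using basis_spans b l by (intro exI[of _ c] exI[of _ b1] exI[of _ b2]) auto
qed

end

section \<open>Properties of the extension\<close>

lemma has_derivative_imp_monogenic:
  assumes "\<And>\<zeta>. \<zeta> \<in> \<Omega> \<Longrightarrow> (\<Phi> has_derivative (\<lambda>h. h * c \<zeta>)) (at \<zeta>)"
  shows "monogenic_in E \<Omega> \<Phi>"
  unfolding monogenic_in_def
proof (intro conjI ballI)
  show "continuous_on \<Omega> \<Phi>"
    using assms by (meson continuous_at_imp_continuous_on has_derivative_continuous)
  fix \<zeta> assume "\<zeta> \<in> \<Omega>"
  then have "((\<lambda>\<delta>::real. (\<Phi> (\<zeta> + \<delta> *\<^sub>R h) - \<Phi> \<zeta>) /\<^sub>R \<delta>) \<longlongrightarrow> h * c \<zeta>) (at_right 0)" for h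
    by (intro tendsto_mono[OF at_within_le_at has_derivative_imp_directional[OF assms]])
  then show "\<exists>\<Phi>'. \<forall>h\<in>E. ((\<lambda>\<delta>::real. (\<Phi> (\<zeta> + \<delta> *\<^sub>R h) - \<Phi> \<zeta>) /\<^sub>R \<delta>) \<longlongrightarrow> h * \<Phi>') (at_right 0)"
    by blast
qed

lemma has_derivative_imp_lorch:
  assumes der: "\<And>\<zeta>. \<zeta> \<in> \<Omega> \<Longrightarrow> (\<Phi> has_derivative (\<lambda>h. h * c \<zeta>)) (at \<zeta>)"
    and "subspace E" and opn: "openin (top_of_set E) \<Omega>"
  shows "lorch_differentiable_in E \<Omega> \<Phi>"
  unfolding lorch_differentiable_in_def
proof (rule ballI, rule exI, intro allI impI)
  fix \<zeta> and \<epsilon> :: real assume "\<zeta> \<in> \<Omega>" "\<epsilon> > 0"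
  obtain T where T: "open T" "\<Omega> = E \<inter> T" using opn by (auto simp: openin_open)
  then obtain d1 where d1: "d1 > 0" "ball \<zeta> d1 \<subseteq> T" using \<open>\<zeta> \<in> \<Omega>\<close> by (meson IntD2 openE)
  obtain d2 where d2: "d2 > 0" "\<And>y. norm (y - \<zeta>) < d2 \<Longrightarrow>
      norm (\<Phi> y - \<Phi> \<zeta> - (y - \<zeta>) * c \<zeta>) \<le> \<epsilon> * norm (y - \<zeta>)"
    using der[OF \<open>\<zeta> \<in> \<Omega>\<close>] \<open>\<epsilon> > 0\<close> unfolding has_derivative_at_alt by blast
  have "\<zeta> + h \<in> \<Omega> \<and> norm (\<Phi> (\<zeta> + h) - \<Phi> \<zeta> - h * c \<zeta>) \<le> norm h * \<epsilon>"
    if "h \<in> E" "norm h < min d1 d2" for h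
  proof
    have "\<zeta> + h \<in> E" using that \<open>\<zeta> \<in> \<Omega>\<close> T \<open>subspace E\<close> by (auto intro: subspace_add)
    moreover have "\<zeta> + h \<in> T" using that d1(2) by (auto simp: dist_norm)
    ultimately show "\<zeta> + h \<in> \<Omega>" using T by simp
    show "norm (\<Phi> (\<zeta> + h) - \<Phi> \<zeta> - h * c \<zeta>) \<le> norm h * \<epsilon>"
      using d2(2)[of "\<zeta> + h"] that by (simp add: mult.commute)
  qed
  then show "\<exists>\<delta>>0. \<forall>h\<in>E. norm h < \<delta> \<longrightarrow>
      \<zeta> + h \<in> \<Omega> \<and> norm (\<Phi> (\<zeta> + h) - \<Phi> \<zeta> - h * c \<zeta>) \<le> norm h * \<epsilon>"
    using d1(1) d2(1) by (intro exI[of _ "min d1 d2"]) auto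
qed

lemma holomorphic_eq_imp_deriv_eq:
  assumes "open D" "\<And>z. z \<in> D \<Longrightarrow> F z = G z" "z \<in> D"
  shows "deriv F z = deriv G z"
proof (rule deriv_cong_ev[OF _ refl])
  show "\<forall>\<^sub>F x in nhds z. F x = G x"
    using eventually_nhds_in_open[OF assms(1,3)] by eventually_elim (rule assms(2))
qed

text \<open>On \<open>\<Omega>\<close> the coefficients determine \<open>F0\<close>, then \<open>F1\<close> and \<open>F2\<close>, as functions on \<open>D\<close>; the
  formula uses nothing else, so it has the same values in the whole cylinder over \<open>D\<close>.\<close>

lemma monogenic_extension_determined:
  assumes "open D" "D = coeff0 ` \<Omega>"
    and eq: "\<And>\<zeta>. \<zeta> \<in> \<Omega> \<Longrightarrow> monogenic_extension G0 G1 G2 \<zeta> = monogenic_extension F0 F1 F2 \<zeta>"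
    and "coeff0 \<zeta> \<in> D"
  shows "monogenic_extension G0 G1 G2 \<zeta> = monogenic_extension F0 F1 F2 \<zeta>"
proof -
  note d = holomorphic_eq_imp_deriv_eq[OF \<open>open D\<close>]
  have e0: "G0 z = F0 z" if "z \<in> D" for z
    using that assms(2) eq by (auto simp: a3_eq_iff monogenic_extension_def)
  have e0': "deriv G0 z = deriv F0 z" if "z \<in> D" for z
    by (rule d[OF e0 that])
  have e0'': "deriv (deriv G0) z = deriv (deriv F0) z" if "z \<in> D" for z
    by (rule d[OF e0' that])
  have e1: "G1 z = F1 z" if z: "z \<in> D" for z
  proof -
    obtain x where "x \<in> \<Omega>" "z = coeff0 x" using z assms(2) by blast
    then show ?thesis using eq[of x] e0'[OF z] by (simp add: a3_eq_iff monogenic_extension_def)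
  qed
  have e1': "deriv G1 z = deriv F1 z" if "z \<in> D" for z
    by (rule d[OF e1 that])
  have e2: "G2 z = F2 z" if z: "z \<in> D" for z
  proof -
    obtain x where "x \<in> \<Omega>" "z = coeff0 x" using z assms(2) by blast
    then show ?thesis using eq[of x] e0'[OF z] e0''[OF z] e1'[OF z]
      by (simp add: a3_eq_iff monogenic_extension_def)
  qed
  show ?thesis
    using assms(4) e0 e0' e0'' e1 e1' e2 by (simp add: a3_eq_iff monogenic_extension_def)
qed

section \<open>The given subspace and the cylinder over a plane domain\<close>

text \<open>A vector of the kernel that is not a multiple of \<open>l\<close> would give four independent vectors in a
  space spanned by three.\<close>

lemma fibred_subspaceI:
  assumes E: "E = {x *\<^sub>R e1 + y *\<^sub>R e2 + z *\<^sub>R e3 | x y z. True}" and surj: "coeff0 ` E = UNIV"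
    and l: "l \<in> E \<inter> radical_a3" "l \<noteq> 0"
  obtains b1 b2 where "fibred_subspace E l b1 b2"
proof -
  have span: "E = span {e1, e2, e3}"
  proof (intro set_eqI iffI)
    fix v assume "v \<in> span {e1, e2, e3}"
    then obtain x y z where "v - x *\<^sub>R e1 - y *\<^sub>R e2 - z *\<^sub>R e3 = 0"
      by (auto simp: span_insert)
    then have "v = x *\<^sub>R e1 + y *\<^sub>R e2 + z *\<^sub>R e3" by (simp add: algebra_simps)
    then show "v \<in> E" unfolding E by blast
  next
    fix v assume "v \<in> E"
    then obtain x y z where "v = x *\<^sub>R e1 + y *\<^sub>R e2 + z *\<^sub>R e3" unfolding E by blast
    then show "v \<in> span {e1, e2, e3}"
      by (auto intro!: span_add span_scale intro: span_base)
  qed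
  obtain b1 where b1: "b1 \<in> E" "coeff0 b1 = 1" using surj by (metis UNIV_I imageE)
  obtain b2 where b2: "b2 \<in> E" "coeff0 b2 = \<i>" using surj by (metis UNIV_I imageE)
  have l0: "coeff0 l = 0" using l by (simp add: radical_a3_eq_kernel)
  have "\<exists>c::real. x = c *\<^sub>R l" if x: "x \<in> E" "coeff0 x = 0" for x
  proof (rule ccontr)
    assume none: "\<not> ?thesis"
    have ker: "subspace {x. coeff0 x = 0}" and imag: "subspace {x. Re (coeff0 x) = 0}"
      by (auto simp: subspace_def)
    have x_l: "x \<notin> span {l}" using none by (auto simp: span_singleton)
    have "span {x, l} \<subseteq> {x. coeff0 x = 0}" using x l0 by (intro span_minimal ker) auto
    then have b2_xl: "b2 \<notin> span {x, l}" using b2 by auto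
    have "span {b2, x, l} \<subseteq> {x. Re (coeff0 x) = 0}" using x l0 b2 by (intro span_minimal imag) auto
    then have b1_xl: "b1 \<notin> span {b2, x, l}" using b1 by auto
    have distinct: "x \<notin> {l}" "b2 \<notin> {x, l}" "b1 \<notin> {b2, x, l}"
      using x_l b2_xl b1_xl span_base[of x "{l}"] span_base[of b2 "{x, l}"] span_base[of b1 "{b2, x, l}"]
      by meson+
    have "independent {b1, b2, x, l}"
      using l(2) x_l b2_xl b1_xl distinct by (simp add: independent_insert)
    moreover have "{b1, b2, x, l} \<subseteq> span {e1, e2, e3}"
      using b1 b2 x l span by auto
    ultimately have "card {b1, b2, x, l} \<le> card {e1, e2, e3}"
      using independent_span_bound[of "{e1, e2, e3}"] by blast
    also have "\<dots> \<le> 3" by (simp add: card_insert_if)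
    finally show False using distinct by (simp add: card_insert_if)
  qed
  moreover have "subspace E" unfolding span by (rule subspace_span)
  ultimately have "fibred_subspace E l b1 b2"
    using b1 b2 l l0 by unfold_locales auto
  then show ?thesis by (rule that)
qed

context fibred_subspace
begin

lemma cylinder:
  assumes "open D" "connected D" "D \<noteq> {}"
  defines "P \<equiv> {\<zeta> \<in> E. coeff0 \<zeta> \<in> D}"
  shows "domain_in E P" "coeff0 ` P = D" "convex_in_direction (E \<inter> radical_a3) P"
proof -
  show img: "coeff0 ` P = D"
  proof
    show "D \<subseteq> coeff0 ` P"
    proof
      fix z assume "z \<in> D"
      then have "slice z \<in> P" using slice_in_E by (simp add: P_def)
      then show "z \<in> coeff0 ` P" by force
    qed
  qed (auto simp: P_def)
  have "P = E \<inter> coeff0 -` D" by (auto simp: P_def)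
  moreover have "open (coeff0 -` D)"
    using \<open>open D\<close> by (intro open_vimage linear_continuous_on bounded_linear_coeff)
  ultimately have "openin (top_of_set E) P" by (simp add: openin_open_Int)
  moreover have "connected P"
  proof -
    have "P = (\<lambda>(z, t). slice z + t *\<^sub>R l) ` (D \<times> UNIV)"
    proof
      show "P \<subseteq> (\<lambda>(z, t). slice z + t *\<^sub>R l) ` (D \<times> UNIV)"
      proof
        fix x assume "x \<in> P"
        then obtain t where "x = slice (coeff0 x) + t *\<^sub>R l" "coeff0 x \<in> D"
          using E_decomp unfolding P_def by blast
        then show "x \<in> (\<lambda>(z, t). slice z + t *\<^sub>R l) ` (D \<times> UNIV)" by force
      qed
      show "(\<lambda>(z, t). slice z + t *\<^sub>R l) ` (D \<times> UNIV) \<subseteq> P"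
        using subsp slice_in_E l by (auto simp: P_def intro: subspace_add subspace_scale)
    qed
    moreover have "connected ((\<lambda>(z, t::real). slice z + t *\<^sub>R l) ` (D \<times> UNIV))"
      unfolding case_prod_unfold
      by (intro connected_continuous_image connected_Times assms connected_UNIV continuous_intros
          bounded_linear.continuous_on[OF bounded_linear_slice])
    ultimately show ?thesis by simp
  qed
  moreover have "P \<noteq> {}" using img \<open>D \<noteq> {}\<close> by auto
  ultimately show "domain_in E P" by (simp add: domain_in_def)
  show "convex_in_direction (E \<inter> radical_a3) P"
    unfolding convex_in_direction_def
  proof (intro ballI impI subsetI)
    fix \<zeta>1 \<zeta>2 x assume \<zeta>: "\<zeta>1 \<in> P" "\<zeta>2 \<in> P" "\<zeta>2 - \<zeta>1 \<in> E \<inter> radical_a3" "x \<in> closed_segment \<zeta>1 \<zeta>2"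
    then obtain u where x: "x = (1 - u) *\<^sub>R \<zeta>1 + u *\<^sub>R \<zeta>2" by (auto simp: closed_segment_def)
    have "coeff0 \<zeta>2 = coeff0 \<zeta>1" using \<zeta>(3) by (simp add: radical_a3_eq_kernel)
    then have "coeff0 x = coeff0 \<zeta>1" by (simp add: x scaleR_left_diff_distrib)
    moreover have "x \<in> E" unfolding x using \<zeta> subsp by (intro subspace_add subspace_scale) (auto simp: P_def)
    ultimately show "x \<in> P" using \<zeta>(1) by (simp add: P_def)
  qed
qed

end

section \<open>The extension theorem\<close>

theorem mainTheorem1:
  fixes e1 e2 e3 l :: a3 and E L \<Omega> P :: "a3 set" and D :: "complex set" and \<Phi> :: "a3 \<Rightarrow> a3"
  assumes "distinct [e1, e2, e3]" and "independent {e1, e2, e3}"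
    and E: "E = {x *\<^sub>R e1 + y *\<^sub>R e2 + z *\<^sub>R e3 | x y z. True}"
    and "coeff0 ` E = UNIV"
    and L: "L = E \<inter> radical_a3" and "l \<in> L" and "l \<noteq> 0"
    and "domain_in E \<Omega>" and "convex_in_direction L \<Omega>"
    and D: "D = coeff0 ` \<Omega>" and P: "P = {\<zeta> \<in> E. coeff0 \<zeta> \<in> D}"
    and "continuous_on \<Omega> \<Phi>"
    and "countable {\<zeta> \<in> \<Omega>. \<not> condition_K E l \<Phi> \<zeta>}"
  shows "monogenic_in E \<Omega> \<Phi> \<and>
    domain_in E P \<and>
    (\<exists>\<Psi>. (\<forall>\<zeta>\<in>\<Omega>. \<Psi> \<zeta> = \<Phi> \<zeta>) \<and> monogenic_in E P \<Psi> \<and>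
       (\<forall>\<Psi>'. (\<forall>\<zeta>\<in>\<Omega>. \<Psi>' \<zeta> = \<Phi> \<zeta>) \<and> monogenic_in E P \<Psi>' \<longrightarrow> (\<forall>\<zeta>\<in>P. \<Psi>' \<zeta> = \<Psi> \<zeta>)) \<and>
       (\<exists>F0 F1 F2. F0 holomorphic_on D \<and> F1 holomorphic_on D \<and> F2 holomorphic_on D \<and>
          (\<forall>\<zeta>\<in>P. \<forall>\<gamma>. pos_jordan_rectifiable \<gamma> \<and> path_image \<gamma> \<subseteq> D \<and>
             inside (path_image \<gamma>) \<subseteq> D \<and> coeff0 \<zeta> \<in> inside (path_image \<gamma>) \<longrightarrow>
             (\<exists>I. has_line_integral
                (\<lambda>\<xi>. (of_cpx (F0 \<xi>) + of_cpx (F1 \<xi>) * rho + of_cpx (F2 \<xi>) * rho\<^sup>2)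
                      * inverse (of_cpx \<xi> - \<zeta>)) I \<gamma> \<and>
                \<Psi> \<zeta> = of_cpx (1 / (2 * of_real pi * \<i>)) * I))) \<and>
       lorch_differentiable_in E P \<Psi>)"
proof -
  obtain b1 b2 where "fibred_subspace E l b1 b2"
    using fibred_subspaceI[OF E assms(4)] \<open>l \<in> L\<close> \<open>l \<noteq> 0\<close> L by blast
  then interpret fibred_subspace E l b1 b2 .
  have \<Omega>: "openin (top_of_set E) \<Omega>" "connected \<Omega>" "\<Omega> \<noteq> {}"
    using \<open>domain_in E \<Omega>\<close> by (auto simp: domain_in_def)
  have "open D" unfolding D by (rule open_coeff0_image[OF \<Omega>(1)])
  have "connected D"
    unfolding D using \<Omega>(2)
    by (intro connected_continuous_image linear_continuous_on bounded_linear_coeff)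
  have "D \<noteq> {}" using D \<Omega>(3) by simp
  note cyl = cylinder[OF \<open>open D\<close> \<open>connected D\<close> \<open>D \<noteq> {}\<close>, folded P L]
  have Popen: "openin (top_of_set E) P" using cyl(1) by (simp add: domain_in_def)
  have "\<Omega> \<subseteq> P" using \<Omega>(1) openin_imp_subset by (auto simp: P D)
  obtain F0 F1 F2 where F: "F0 holomorphic_on D" "F1 holomorphic_on D" "F2 holomorphic_on D"
    and \<Phi>: "\<And>\<zeta>. \<zeta> \<in> \<Omega> \<Longrightarrow> \<Phi> \<zeta> = monogenic_extension F0 F1 F2 \<zeta>"
    by (rule monogenic_extension_exists[OF \<Omega>(1) assms(9)[unfolded L] \<open>continuous_on \<Omega> \<Phi>\<close> assms(13), folded D], rule that)
  define \<Psi> where "\<Psi> = monogenic_extension F0 F1 F2"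
  have der: "(\<Psi> has_derivative (\<lambda>h. h * monogenic_extension (deriv F0) (deriv F1) (deriv F2) \<zeta>)) (at \<zeta>)"
    if "\<zeta> \<in> P" for \<zeta>
    unfolding \<Psi>_def using that by (intro monogenic_extension_has_derivative[OF F \<open>open D\<close>]) (simp add: P)
  have ext: "\<forall>\<zeta>\<in>\<Omega>. \<Psi> \<zeta> = \<Phi> \<zeta>" using \<Phi> by (simp add: \<Psi>_def)
  have mono\<Psi>: "monogenic_in E P \<Psi>" using der by (rule has_derivative_imp_monogenic)
  have mono\<Phi>: "monogenic_in E \<Omega> \<Phi>"
  proof -
    \<comment> \<open>\<open>\<Psi>\<close> agrees with \<open>\<Phi>\<close> on a relatively open set only, which suffices for directional limits within \<open>E\<close>.\<close>
    have "continuous_on \<Omega> \<Phi>" by fact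
    moreover have "\<exists>\<Phi>'. \<forall>h\<in>E. ((\<lambda>\<delta>::real. (\<Phi> (\<zeta> + \<delta> *\<^sub>R h) - \<Phi> \<zeta>) /\<^sub>R \<delta>) \<longlongrightarrow> h * \<Phi>') (at_right 0)"
      if "\<zeta> \<in> \<Omega>" for \<zeta>
    proof -
      obtain c where c: "\<And>h. h \<in> E \<Longrightarrow> ((\<lambda>\<delta>::real. (\<Psi> (\<zeta> + \<delta> *\<^sub>R h) - \<Psi> \<zeta>) /\<^sub>R \<delta>) \<longlongrightarrow> h * c) (at_right 0)"
        using mono\<Psi> subsetD[OF \<open>\<Omega> \<subseteq> P\<close> \<open>\<zeta> \<in> \<Omega>\<close>] unfolding monogenic_in_def by meson
      have "((\<lambda>\<delta>::real. (\<Phi> (\<zeta> + \<delta> *\<^sub>R h) - \<Phi> \<zeta>) /\<^sub>R \<delta>) \<longlongrightarrow> h * c) (at_right 0)" if "h \<in> E" for h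
      proof (rule Lim_transform_eventually[OF c[OF that]])
        have "\<forall>\<^sub>F \<delta> in at_right 0. \<zeta> + \<delta> *\<^sub>R h \<in> \<Omega>"
          using line_in_open[OF \<Omega>(1) \<open>\<zeta> \<in> \<Omega>\<close> that] by (rule filter_leD[OF at_within_le_at])
        then show "\<forall>\<^sub>F \<delta> in at_right 0. (\<Psi> (\<zeta> + \<delta> *\<^sub>R h) - \<Psi> \<zeta>) /\<^sub>R \<delta> = (\<Phi> (\<zeta> + \<delta> *\<^sub>R h) - \<Phi> \<zeta>) /\<^sub>R \<delta>"
          by eventually_elim (use ext \<open>\<zeta> \<in> \<Omega>\<close> in simp)
      qed
      then show ?thesis by blast
    qed
    ultimately show ?thesis by (simp add: monogenic_in_def)
  qed
  have unique: "\<Psi>' \<zeta> = \<Psi> \<zeta>" if \<Psi>': "\<forall>\<zeta>\<in>\<Omega>. \<Psi>' \<zeta> = \<Phi> \<zeta>" "monogenic_in E P \<Psi>'" and "\<zeta> \<in> P" for \<Psi>' \<zeta>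
  proof -
    have "{\<zeta> \<in> P. \<not> condition_K E l \<Psi>' \<zeta>} = {}"
      using monogenic_imp_condition_K[OF \<Psi>'(2)] by blast
    then have "countable {\<zeta> \<in> P. \<not> condition_K E l \<Psi>' \<zeta>}" by (simp only: countable_empty)
    moreover have "continuous_on P \<Psi>'" using \<Psi>'(2) by (simp add: monogenic_in_def)
    ultimately obtain G0 G1 G2 where G: "\<And>\<zeta>. \<zeta> \<in> P \<Longrightarrow> \<Psi>' \<zeta> = monogenic_extension G0 G1 G2 \<zeta>"
      using monogenic_extension_exists[OF Popen cyl(3)[unfolded L]] by metis
    have "monogenic_extension G0 G1 G2 \<zeta> = monogenic_extension F0 F1 F2 \<zeta>"
    proof (rule monogenic_extension_determined[OF \<open>open D\<close> D])
      fix x assume "x \<in> \<Omega>"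
      then show "monogenic_extension G0 G1 G2 x = monogenic_extension F0 F1 F2 x"
        using G[of x] \<Psi>'(1) \<Phi> \<open>\<Omega> \<subseteq> P\<close> by auto
    qed (use \<open>\<zeta> \<in> P\<close> P in simp)
    then show ?thesis using G[OF \<open>\<zeta> \<in> P\<close>] by (simp add: \<Psi>_def)
  qed
  have cauchy: "\<exists>I. has_line_integral
      (\<lambda>\<xi>. (of_cpx (F0 \<xi>) + of_cpx (F1 \<xi>) * rho + of_cpx (F2 \<xi>) * rho\<^sup>2) * inverse (of_cpx \<xi> - \<zeta>)) I \<gamma> \<and>
      \<Psi> \<zeta> = of_cpx (1 / (2 * of_real pi * \<i>)) * I"
    if \<gamma>: "pos_jordan_rectifiable \<gamma>" "path_image \<gamma> \<subseteq> D" "inside (path_image \<gamma>) \<subseteq> D" "coeff0 \<zeta> \<in> inside (path_image \<gamma>)"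
    for \<zeta> \<gamma>
  proof (intro exI conjI)
    show "has_line_integral
      (\<lambda>\<xi>. (of_cpx (F0 \<xi>) + of_cpx (F1 \<xi>) * rho + of_cpx (F2 \<xi>) * rho\<^sup>2) * inverse (of_cpx \<xi> - \<zeta>))
      (of_cpx (2 * of_real pi * \<i>) * \<Psi> \<zeta>) \<gamma>"
      unfolding \<Psi>_def by (rule monogenic_extension_cauchy_integral[OF \<open>open D\<close> \<open>connected D\<close> F \<gamma>])
    show "\<Psi> \<zeta> = of_cpx (1 / (2 * of_real pi * \<i>)) * (of_cpx (2 * of_real pi * \<i>) * \<Psi> \<zeta>)"
      by (simp add: a3_eq_iff)
  qed
  have lorch: "lorch_differentiable_in E P \<Psi>"
    using der subsp Popen by (rule has_derivative_imp_lorch)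
  show ?thesis
    using mono\<Phi> cyl(1) ext mono\<Psi> unique F cauchy lorch by blast
qed

end
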